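(* Let $C$ be a commutative C*-algebra. Under the tensor product of Hilbert $C$-modules, the category $\mathbf{Hilb}_C^{\mathrm{bd}}$ is symmetric monoidal, and $\mathbf{Hilb}_C$ is a symmetric monoidal dagger category.
   Context: C*-algebras need not be unital. A Hilbert $C$-module is a right $C$-module $E$ with a function $\langle -\mid -\rangle\colon E\times E\to C$ that is $C$-linear in the second variable, with $\langle x\mid y\rangle^*=\langle y\mid x\rangle$, $\langle x\mid x\rangle\ge 0$ with equality iff $x=0$, and $E$ complete in the norm $\|x\|^2=\|\langle x\mid x\rangle\|_C$. A map $f\colon E\to F$ is adjointable if there is $f^\dagger\colon F\to E$ with $\langle f(x)\mid y\rangle=\langle x\mid f^\dagger(y)\rangle$ for all $x,y$. $\mathbf{Hilb}_C^{\mathrm{bd}}$ is the category of Hilbert $C$-modules and bounded $C$-linear maps; $\mathbf{Hilb}_C$ is the category of Hilbert $C$-modules and adjointable maps, with dagger $f\mapsto f^\dagger$. The tensor product $E\otimes F$ is the Hilbert $C$-module obtained from the algebraic tensor product $E\otimes_{\mathbb C}F$ with $\langle x_1\otimes y_1\mid x_2\otimes y_2\rangle=\langle x_1\mid x_2\rangle\langle y_1\mid y_2\rangle$ and $(x\otimes y)c=x\otimes(yc)$ by quotienting out vectors of zero norm and completing. The tensor unit is $C$ with $\langle a\mid b\rangle=a^*b$. A dagger category is a category with a contravariant functor $\dagger$ to itself that is the identity on objects and satisfies $f^{\dagger\dagger}=f$. A monoidal dagger category is a monoidal category that is also a dagger category in which $(f\otimes g)^\dagger=f^\dagger\otimes g^\dagger$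 and the coherence isomorphisms are unitary (inverse equals dagger); a symmetric monoidal dagger category is one that is symmetric monoidal with unitary symmetry. *)

theory Defs
  imports "HOL-Analysis.Analysis" "HOL-Library.Poly_Mapping" "HOL-Library.FuncSet"
begin

section \<open>C*-algebras\<close>

text \<open>
  No unit is assumed, and the zero algebra is allowed.
  The submultiplicative complete norm comes from the two library classes.
\<close>

class cstar_algebra = real_normed_algebra + banach +
  fixes scaleC :: "complex \<Rightarrow> 'a \<Rightarrow> 'a" (infixr "*\<^sub>C" 75)
    and star :: "'a \<Rightarrow> 'a"
  assumes scaleC_add_right: "z *\<^sub>C (a + b) = z *\<^sub>C a + z *\<^sub>C b"
    and scaleC_add_left: "(z + w) *\<^sub>C a = z *\<^sub>C a + w *\<^sub>C a"
    and scaleC_scaleC: "z *\<^sub>C w *\<^sub>C a = (z * w) *\<^sub>C a"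
    and scaleC_of_real: "of_real r *\<^sub>C a = r *\<^sub>R a"
    and norm_scaleC: "norm (z *\<^sub>C a) = cmod z * norm a"
    and mult_scaleC_left: "(z *\<^sub>C a) * b = z *\<^sub>C (a * b)"
    and mult_scaleC_right: "a * (z *\<^sub>C b) = z *\<^sub>C (a * b)"
    and star_add: "star (a + b) = star a + star b"
    and star_scaleC: "star (z *\<^sub>C a) = cnj z *\<^sub>C star a"
    and star_mult: "star (a * b) = star b * star a"
    and star_star: "star (star a) = a"
    and cstar_identity: "norm (star a * a) = (norm a)\<^sup>2"

class comm_cstar_algebra = cstar_algebra + comm_ring

definition cstar_nonneg :: "'c::cstar_algebra \<Rightarrow> bool" where
  "cstar_nonneg a \<longleftrightarrow> (\<exists>b. a = star b * b)"


section \<open>Hilbert modules\<close>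

text \<open>
  \<open>act x a\<close> is the right action \<open>x a\<close> of the algebra and \<open>csc z x\<close> is multiplication by a
  complex number.  Since the algebra need not have a unit, the underlying complex vector space is
  part of the structure.
\<close>

record ('c, 'u) hmod =
  carrier :: "'u set"
  zero :: 'u
  add :: "'u \<Rightarrow> 'u \<Rightarrow> 'u"
  csc :: "complex \<Rightarrow> 'u \<Rightarrow> 'u"
  act :: "'u \<Rightarrow> 'c \<Rightarrow> 'u"
  inner :: "'u \<Rightarrow> 'u \<Rightarrow> 'c"

definition hdiff :: "('c, 'u) hmod \<Rightarrow> 'u \<Rightarrow> 'u \<Rightarrow> 'u" where
  "hdiff E x y = add E x (csc E (-1) y)"

definition hnorm :: "('c::cstar_algebra, 'u) hmod \<Rightarrow> 'u \<Rightarrow> real" where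
  "hnorm E x = sqrt (norm (inner E x x))"

definition hCauchy :: "('c::cstar_algebra, 'u) hmod \<Rightarrow> (nat \<Rightarrow> 'u) \<Rightarrow> bool" where
  "hCauchy E s \<longleftrightarrow> (\<forall>n. s n \<in> carrier E) \<and>
     (\<forall>e>0. \<exists>N. \<forall>m\<ge>N. \<forall>n\<ge>N. hnorm E (hdiff E (s m) (s n)) < e)"

locale hilbert_module =
  fixes E :: "('c::cstar_algebra, 'u) hmod"
  assumes zero_closed: "zero E \<in> carrier E"
    and add_closed: "\<lbrakk>x \<in> carrier E; y \<in> carrier E\<rbrakk> \<Longrightarrow> add E x y \<in> carrier E"
    and csc_closed: "x \<in> carrier E \<Longrightarrow> csc E z x \<in> carrier E"
    and act_closed: "x \<in> carrier E \<Longrightarrow> act E x a \<in> carrier E"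
    and add_assoc: "\<lbrakk>x \<in> carrier E; y \<in> carrier E; v \<in> carrier E\<rbrakk>
          \<Longrightarrow> add E (add E x y) v = add E x (add E y v)"
    and add_commute: "\<lbrakk>x \<in> carrier E; y \<in> carrier E\<rbrakk> \<Longrightarrow> add E x y = add E y x"
    and add_zero: "x \<in> carrier E \<Longrightarrow> add E x (zero E) = x"
    and hdiff_self: "x \<in> carrier E \<Longrightarrow> hdiff E x x = zero E"
    and csc_one: "x \<in> carrier E \<Longrightarrow> csc E 1 x = x"
    and csc_csc: "x \<in> carrier E \<Longrightarrow> csc E z (csc E w x) = csc E (z * w) x"
    and csc_add_left: "x \<in> carrier E \<Longrightarrow> csc E (z + w) x = add E (csc E z x) (csc E w x)"
    and csc_add_right: "\<lbrakk>x \<in> carrier E; y \<in> carrier E\<rbrakk>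
          \<Longrightarrow> csc E z (add E x y) = add E (csc E z x) (csc E z y)"
    and act_add_left: "\<lbrakk>x \<in> carrier E; y \<in> carrier E\<rbrakk>
          \<Longrightarrow> act E (add E x y) a = add E (act E x a) (act E y a)"
    and act_add_right: "x \<in> carrier E \<Longrightarrow> act E x (a + b) = add E (act E x a) (act E x b)"
    and act_act: "x \<in> carrier E \<Longrightarrow> act E (act E x a) b = act E x (a * b)"
    and act_csc: "x \<in> carrier E \<Longrightarrow> act E (csc E z x) a = csc E z (act E x a)"
    and act_scaleC: "x \<in> carrier E \<Longrightarrow> act E x (z *\<^sub>C a) = csc E z (act E x a)"
    and inner_add: "\<lbrakk>x \<in> carrier E; y \<in> carrier E; v \<in> carrier E\<rbrakk>
          \<Longrightarrow> inner E x (add E y v) = inner E x y + inner E x v"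
    and inner_csc: "\<lbrakk>x \<in> carrier E; y \<in> carrier E\<rbrakk>
          \<Longrightarrow> inner E x (csc E z y) = z *\<^sub>C inner E x y"
    and inner_act: "\<lbrakk>x \<in> carrier E; y \<in> carrier E\<rbrakk>
          \<Longrightarrow> inner E x (act E y a) = inner E x y * a"
    and inner_star: "\<lbrakk>x \<in> carrier E; y \<in> carrier E\<rbrakk> \<Longrightarrow> star (inner E x y) = inner E y x"
    and inner_nonneg: "x \<in> carrier E \<Longrightarrow> cstar_nonneg (inner E x x)"
    and inner_eq_zero: "x \<in> carrier E \<Longrightarrow> inner E x x = 0 \<longleftrightarrow> x = zero E"
    and complete: "hCauchy E s
          \<Longrightarrow> \<exists>x\<in>carrier E. (\<lambda>n. hnorm E (hdiff E (s n) x)) \<longlonglongrightarrow> 0"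

definition transport :: "('u \<Rightarrow> 'v) \<Rightarrow> ('c, 'u) hmod \<Rightarrow> ('c, 'v) hmod" where
  "transport h E = (let k = inv_into (carrier E) h in
     \<lparr> carrier = h ` carrier E,
       zero = h (zero E),
       add = (\<lambda>x y. h (add E (k x) (k y))),
       csc = (\<lambda>z x. h (csc E z (k x))),
       act = (\<lambda>x a. h (act E (k x) a)),
       inner = (\<lambda>x y. inner E (k x) (k y)) \<rparr>)"

definition algebra_module :: "('c::cstar_algebra, 'c) hmod" where
  "algebra_module =
     \<lparr> carrier = UNIV, zero = 0, add = (+), csc = (*\<^sub>C), act = (*), inner = (\<lambda>a b. star a * b) \<rparr>"


section \<open>The tensor product\<close>

subsection \<open>Algebraic tensor product over the complex numbers\<close>

text \<open>
  The free vector space on pairs of vectors, with \<open>Poly_Mapping.single (x, y) 1\<close> as the basis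
  vector of \<open>(x, y)\<close>, modulo the span of the bilinearity relations.
\<close>

definition formal_sums ::
  "('c, 'u) hmod \<Rightarrow> ('c, 'v) hmod \<Rightarrow> ('u \<times> 'v \<Rightarrow>\<^sub>0 complex) set" where
  "formal_sums E F = {f. Poly_Mapping.keys f \<subseteq> carrier E \<times> carrier F}"

inductive_set bilinearity_span ::
  "('c, 'u) hmod \<Rightarrow> ('c, 'v) hmod \<Rightarrow> ('u \<times> 'v \<Rightarrow>\<^sub>0 complex) set"
  for E :: "('c, 'u) hmod" and F :: "('c, 'v) hmod"
  where
    span_zero: "0 \<in> bilinearity_span E F"
  | span_add: "\<lbrakk>f \<in> bilinearity_span E F; g \<in> bilinearity_span E F\<rbrakk>
      \<Longrightarrow> f + g \<in> bilinearity_span E F"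
  | span_csc: "f \<in> bilinearity_span E F \<Longrightarrow> Poly_Mapping.map ((*) z) f \<in> bilinearity_span E F"
  | add_left: "\<lbrakk>x \<in> carrier E; x' \<in> carrier E; y \<in> carrier F\<rbrakk>
      \<Longrightarrow> Poly_Mapping.single (add E x x', y) 1
          - (Poly_Mapping.single (x, y) 1 + Poly_Mapping.single (x', y) 1) \<in> bilinearity_span E F"
  | add_right: "\<lbrakk>x \<in> carrier E; y \<in> carrier F; y' \<in> carrier F\<rbrakk>
      \<Longrightarrow> Poly_Mapping.single (x, add F y y') 1
          - (Poly_Mapping.single (x, y) 1 + Poly_Mapping.single (x, y') 1) \<in> bilinearity_span E F"
  | csc_left: "\<lbrakk>x \<in> carrier E; y \<in> carrier F\<rbrakk>
      \<Longrightarrow> Poly_Mapping.single (csc E z x, y) 1 - Poly_Mapping.single (x, y) z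
          \<in> bilinearity_span E F"
  | csc_right: "\<lbrakk>x \<in> carrier E; y \<in> carrier F\<rbrakk>
      \<Longrightarrow> Poly_Mapping.single (x, csc F z y) 1 - Poly_Mapping.single (x, y) z
          \<in> bilinearity_span E F"

definition bilinearity_rel ::
  "('c, 'u) hmod \<Rightarrow> ('c, 'v) hmod \<Rightarrow> (('u \<times> 'v \<Rightarrow>\<^sub>0 complex) \<times> ('u \<times> 'v \<Rightarrow>\<^sub>0 complex)) set" where
  "bilinearity_rel E F =
     {(f, g). f \<in> formal_sums E F \<and> g \<in> formal_sums E F \<and> f - g \<in> bilinearity_span E F}"

text \<open>Operations on quotients are computed on chosen representatives.\<close>

definition rep :: "'q set \<Rightarrow> 'q" where
  "rep X = (SOME x. x \<in> X)"

definition alg_tensor ::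
  "('c::cstar_algebra, 'u) hmod \<Rightarrow> ('c, 'v) hmod \<Rightarrow> ('c, ('u \<times> 'v \<Rightarrow>\<^sub>0 complex) set) hmod" where
  "alg_tensor E F = (let cls = (\<lambda>f. bilinearity_rel E F `` {f}) in
     \<lparr> carrier = formal_sums E F // bilinearity_rel E F,
       zero = cls 0,
       add = (\<lambda>X Y. cls (rep X + rep Y)),
       csc = (\<lambda>z X. cls (Poly_Mapping.map ((*) z) (rep X))),
       act = (\<lambda>X a. cls (\<Sum>(x, y) \<in> Poly_Mapping.keys (rep X).
                Poly_Mapping.single (x, act F y a) (Poly_Mapping.lookup (rep X) (x, y)))),
       inner = (\<lambda>X Y. \<Sum>(x\<^sub>1, y\<^sub>1) \<in> Poly_Mapping.keys (rep X). \<Sum>(x\<^sub>2, y\<^sub>2) \<in> Poly_Mapping.keys (rep Y).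
                (cnj (Poly_Mapping.lookup (rep X) (x\<^sub>1, y\<^sub>1)) * Poly_Mapping.lookup (rep Y) (x\<^sub>2, y\<^sub>2))
                *\<^sub>C (inner E x\<^sub>1 x\<^sub>2 * inner F y\<^sub>1 y\<^sub>2)) \<rparr>)"

subsection \<open>Separated completion\<close>

text \<open>
  Cauchy sequences modulo sequences at distance tending to zero.  Two constant sequences are
  identified iff the difference of their values has norm zero, so this both quotients out the
  vectors of zero norm and completes.
\<close>

definition null_rel :: "('c::cstar_algebra, 'v) hmod \<Rightarrow> ((nat \<Rightarrow> 'v) \<times> (nat \<Rightarrow> 'v)) set" where
  "null_rel H =
     {(s, t). hCauchy H s \<and> hCauchy H t \<and> (\<lambda>n. hnorm H (hdiff H (s n) (t n))) \<longlonglongrightarrow> 0}"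

definition completion :: "('c::cstar_algebra, 'v) hmod \<Rightarrow> ('c, (nat \<Rightarrow> 'v) set) hmod" where
  "completion H = (let cls = (\<lambda>s. null_rel H `` {s}) in
     \<lparr> carrier = {s. hCauchy H s} // null_rel H,
       zero = cls (\<lambda>n. zero H),
       add = (\<lambda>X Y. cls (\<lambda>n. add H (rep X n) (rep Y n))),
       csc = (\<lambda>z X. cls (\<lambda>n. csc H z (rep X n))),
       act = (\<lambda>X a. cls (\<lambda>n. act H (rep X n) a)),
       inner = (\<lambda>X Y. lim (\<lambda>n. inner H (rep X n) (rep Y n))) \<rparr>)"

subsection \<open>A universe closed under the tensor product\<close>

text \<open>
  The objects of a category must have their vectors in a single type, and tensor products must
  again be objects.  In the type below, \<open>Scalar\<close> embeds the algebra, \<open>Atom\<close> embeds the arbitrary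
  type \<open>'x\<close> (hence every Hilbert module with vectors in \<open>'x\<close> has an isomorphic copy there), and
  \<open>Limit\<close> makes room for tensor products: an element of the completed tensor product is determined
  by a sequence of formal sums of elementary tensors.  So for modules \<open>E\<close> and \<open>F\<close> in this universe
  an injection \<open>tensor_code E F\<close> as below exists.  Which one is chosen does not matter: it only
  replaces the tensor product by an isomorphic copy.
\<close>

datatype ('c, 'x) univ =
  Scalar 'c
| Atom 'x
| Limit "nat \<Rightarrow> (complex \<times> ('c, 'x) univ \<times> ('c, 'x) univ) list"

type_synonym ('c, 'x) umod = "('c, ('c, 'x) univ) hmod"

definition tensor_code ::
  "('c::cstar_algebra, 'x) umod \<Rightarrow> ('c, 'x) umod
    \<Rightarrow> (nat \<Rightarrow> (('c, 'x) univ \<times> ('c, 'x) univ \<Rightarrow>\<^sub>0 complex) set) set \<Rightarrow> ('c, 'x) univ" where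
  "tensor_code E F = (SOME h. inj_on h (carrier (completion (alg_tensor E F))))"

definition tensor :: "('c::cstar_algebra, 'x) umod \<Rightarrow> ('c, 'x) umod \<Rightarrow> ('c, 'x) umod" where
  "tensor E F = transport (tensor_code E F) (completion (alg_tensor E F))"

definition elem_tensor ::
  "('c::cstar_algebra, 'x) umod \<Rightarrow> ('c, 'x) umod
    \<Rightarrow> ('c, 'x) univ \<Rightarrow> ('c, 'x) univ \<Rightarrow> ('c, 'x) univ" where
  "elem_tensor E F x y = tensor_code E F
     (null_rel (alg_tensor E F) `` {\<lambda>n. bilinearity_rel E F `` {Poly_Mapping.single (x, y) 1}})"

definition tensor_unit :: "('c::cstar_algebra, 'x) umod" where
  "tensor_unit = transport Scalar algebra_module"


section \<open>Symmetric monoidal dagger categories\<close>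

record ('o, 'm) cat =
  Obj :: "'o set"
  Arr :: "'m set"
  Dom :: "'m \<Rightarrow> 'o"
  Cod :: "'m \<Rightarrow> 'o"
  Id :: "'o \<Rightarrow> 'm"
  Comp :: "'m \<Rightarrow> 'm \<Rightarrow> 'm" (infixr "\<cdot>\<index>" 60)

definition homset :: "('o, 'm) cat \<Rightarrow> 'o \<Rightarrow> 'o \<Rightarrow> 'm set" where
  "homset C A B = {f \<in> Arr C. Dom C f = A \<and> Cod C f = B}"

definition is_iso :: "('o, 'm) cat \<Rightarrow> 'm \<Rightarrow> bool" where
  "is_iso C f \<longleftrightarrow> f \<in> Arr C \<and> (\<exists>g \<in> homset C (Cod C f) (Dom C f).
     Comp C g f = Id C (Dom C f) \<and> Comp C f g = Id C (Cod C f))"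

locale category =
  fixes C :: "('o, 'm) cat" (structure)
  assumes Dom_Obj: "f \<in> Arr C \<Longrightarrow> Dom C f \<in> Obj C"
    and Cod_Obj: "f \<in> Arr C \<Longrightarrow> Cod C f \<in> Obj C"
    and Id_hom: "A \<in> Obj C \<Longrightarrow> Id C A \<in> homset C A A"
    and Comp_hom: "\<lbrakk>f \<in> homset C A B; g \<in> homset C B D\<rbrakk> \<Longrightarrow> g \<cdot> f \<in> homset C A D"
    and Comp_Id: "f \<in> homset C A B \<Longrightarrow> f \<cdot> Id C A = f"
    and Id_Comp: "f \<in> homset C A B \<Longrightarrow> Id C B \<cdot> f = f"
    and Comp_assoc: "\<lbrakk>f \<in> homset C A B; g \<in> homset C B D; h \<in> homset C D E\<rbrakk>
          \<Longrightarrow> (h \<cdot> g) \<cdot> f = h \<cdot> (g \<cdot> f)"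

locale monoidal_category = category C
  for C :: "('o, 'm) cat" (structure) +
  fixes tenO :: "'o \<Rightarrow> 'o \<Rightarrow> 'o" (infixr "\<otimes>\<^sub>o" 70)
    and tenA :: "'m \<Rightarrow> 'm \<Rightarrow> 'm" (infixr "\<otimes>\<^sub>a" 70)
    and unit :: 'o
    and assoc :: "'o \<Rightarrow> 'o \<Rightarrow> 'o \<Rightarrow> 'm"
    and lunit :: "'o \<Rightarrow> 'm"
    and runit :: "'o \<Rightarrow> 'm"
  assumes tenO_Obj: "\<lbrakk>A \<in> Obj C; B \<in> Obj C\<rbrakk> \<Longrightarrow> A \<otimes>\<^sub>o B \<in> Obj C"
    and unit_Obj: "unit \<in> Obj C"
    and tenA_hom: "\<lbrakk>f \<in> homset C A A'; g \<in> homset C B B'\<rbrakk>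
          \<Longrightarrow> f \<otimes>\<^sub>a g \<in> homset C (A \<otimes>\<^sub>o B) (A' \<otimes>\<^sub>o B')"
    and tenA_Id: "\<lbrakk>A \<in> Obj C; B \<in> Obj C\<rbrakk> \<Longrightarrow> Id C A \<otimes>\<^sub>a Id C B = Id C (A \<otimes>\<^sub>o B)"
    and tenA_Comp: "\<lbrakk>f \<in> homset C A A'; f' \<in> homset C A' A'';
            g \<in> homset C B B'; g' \<in> homset C B' B''\<rbrakk>
          \<Longrightarrow> (f' \<cdot> f) \<otimes>\<^sub>a (g' \<cdot> g) = (f' \<otimes>\<^sub>a g') \<cdot> (f \<otimes>\<^sub>a g)"
    and assoc_hom: "\<lbrakk>A \<in> Obj C; B \<in> Obj C; D \<in> Obj C\<rbrakk>
          \<Longrightarrow> assoc A B D \<in> homset C ((A \<otimes>\<^sub>o B) \<otimes>\<^sub>o D) (A \<otimes>\<^sub>o (B \<otimes>\<^sub>o D))"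
    and assoc_iso: "\<lbrakk>A \<in> Obj C; B \<in> Obj C; D \<in> Obj C\<rbrakk> \<Longrightarrow> is_iso C (assoc A B D)"
    and assoc_natural: "\<lbrakk>f \<in> homset C A A'; g \<in> homset C B B'; h \<in> homset C D D'\<rbrakk>
          \<Longrightarrow> assoc A' B' D' \<cdot> ((f \<otimes>\<^sub>a g) \<otimes>\<^sub>a h) = (f \<otimes>\<^sub>a (g \<otimes>\<^sub>a h)) \<cdot> assoc A B D"
    and lunit_hom: "A \<in> Obj C \<Longrightarrow> lunit A \<in> homset C (unit \<otimes>\<^sub>o A) A"
    and lunit_iso: "A \<in> Obj C \<Longrightarrow> is_iso C (lunit A)"
    and lunit_natural: "f \<in> homset C A B \<Longrightarrow> lunit B \<cdot> (Id C unit \<otimes>\<^sub>a f) = f \<cdot> lunit A"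
    and runit_hom: "A \<in> Obj C \<Longrightarrow> runit A \<in> homset C (A \<otimes>\<^sub>o unit) A"
    and runit_iso: "A \<in> Obj C \<Longrightarrow> is_iso C (runit A)"
    and runit_natural: "f \<in> homset C A B \<Longrightarrow> runit B \<cdot> (f \<otimes>\<^sub>a Id C unit) = f \<cdot> runit A"
    and pentagon: "\<lbrakk>A \<in> Obj C; B \<in> Obj C; D \<in> Obj C; E \<in> Obj C\<rbrakk>
          \<Longrightarrow> (Id C A \<otimes>\<^sub>a assoc B D E) \<cdot> assoc A (B \<otimes>\<^sub>o D) E \<cdot> (assoc A B D \<otimes>\<^sub>a Id C E)
              = assoc A B (D \<otimes>\<^sub>o E) \<cdot> assoc (A \<otimes>\<^sub>o B) D E"
    and triangle: "\<lbrakk>A \<in> Obj C; B \<in> Obj C\<rbrakk>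
          \<Longrightarrow> (Id C A \<otimes>\<^sub>a lunit B) \<cdot> assoc A unit B = runit A \<otimes>\<^sub>a Id C B"

locale symmetric_monoidal_category = monoidal_category C tenO tenA unit assoc lunit runit
  for C :: "('o, 'm) cat" (structure)
    and tenO (infixr "\<otimes>\<^sub>o" 70) and tenA (infixr "\<otimes>\<^sub>a" 70)
    and unit and assoc and lunit and runit +
  fixes symm :: "'o \<Rightarrow> 'o \<Rightarrow> 'm"
  assumes symm_hom: "\<lbrakk>A \<in> Obj C; B \<in> Obj C\<rbrakk> \<Longrightarrow> symm A B \<in> homset C (A \<otimes>\<^sub>o B) (B \<otimes>\<^sub>o A)"
    and symm_natural: "\<lbrakk>f \<in> homset C A A'; g \<in> homset C B B'\<rbrakk>
          \<Longrightarrow> symm A' B' \<cdot> (f \<otimes>\<^sub>a g) = (g \<otimes>\<^sub>a f) \<cdot> symm A B"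
    and symm_symm: "\<lbrakk>A \<in> Obj C; B \<in> Obj C\<rbrakk> \<Longrightarrow> symm B A \<cdot> symm A B = Id C (A \<otimes>\<^sub>o B)"
    and hexagon: "\<lbrakk>A \<in> Obj C; B \<in> Obj C; D \<in> Obj C\<rbrakk>
          \<Longrightarrow> assoc B D A \<cdot> symm A (B \<otimes>\<^sub>o D) \<cdot> assoc A B D
              = (Id C B \<otimes>\<^sub>a symm A D) \<cdot> assoc B A D \<cdot> (symm A B \<otimes>\<^sub>a Id C D)"

locale dagger_category = category C
  for C :: "('o, 'm) cat" (structure) +
  fixes dag :: "'m \<Rightarrow> 'm"
  assumes dag_hom: "f \<in> homset C A B \<Longrightarrow> dag f \<in> homset C B A"
    and dag_Id: "A \<in> Obj C \<Longrightarrow> dag (Id C A) = Id C A"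
    and dag_Comp: "\<lbrakk>f \<in> homset C A B; g \<in> homset C B D\<rbrakk> \<Longrightarrow> dag (g \<cdot> f) = dag f \<cdot> dag g"
    and dag_dag: "f \<in> Arr C \<Longrightarrow> dag (dag f) = f"

definition unitary :: "('o, 'm) cat \<Rightarrow> ('m \<Rightarrow> 'm) \<Rightarrow> 'm \<Rightarrow> bool" where
  "unitary C dag f \<longleftrightarrow> f \<in> Arr C \<and>
     Comp C (dag f) f = Id C (Dom C f) \<and> Comp C f (dag f) = Id C (Cod C f)"

locale monoidal_dagger_category =
  monoidal_category C tenO tenA unit assoc lunit runit + dagger_category C dag
  for C :: "('o, 'm) cat" (structure)
    and tenO (infixr "\<otimes>\<^sub>o" 70) and tenA (infixr "\<otimes>\<^sub>a" 70)
    and unit and assoc and lunit and runit and dag +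
  assumes dag_tenA: "\<lbrakk>f \<in> Arr C; g \<in> Arr C\<rbrakk> \<Longrightarrow> dag (f \<otimes>\<^sub>a g) = dag f \<otimes>\<^sub>a dag g"
    and assoc_unitary: "\<lbrakk>A \<in> Obj C; B \<in> Obj C; D \<in> Obj C\<rbrakk> \<Longrightarrow> unitary C dag (assoc A B D)"
    and lunit_unitary: "A \<in> Obj C \<Longrightarrow> unitary C dag (lunit A)"
    and runit_unitary: "A \<in> Obj C \<Longrightarrow> unitary C dag (runit A)"

locale symmetric_monoidal_dagger_category =
  symmetric_monoidal_category C tenO tenA unit assoc lunit runit symm +
  monoidal_dagger_category C tenO tenA unit assoc lunit runit dag
  for C :: "('o, 'm) cat" (structure)
    and tenO (infixr "\<otimes>\<^sub>o" 70) and tenA (infixr "\<otimes>\<^sub>a" 70)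
    and unit and assoc and lunit and runit and symm and dag +
  assumes symm_unitary: "\<lbrakk>A \<in> Obj C; B \<in> Obj C\<rbrakk> \<Longrightarrow> unitary C dag (symm A B)"


section \<open>Categories of Hilbert modules\<close>

text \<open>
  A morphism is a function together with its domain and codomain.  The function is required to be
  \<open>undefined\<close> outside the carrier of the domain, so that equality of morphisms is equality of maps
  between the carriers.
\<close>

datatype ('c, 'u) hmap =
  HMap (src: "('c, 'u) hmod") (fn: "'u \<Rightarrow> 'u") (tgt: "('c, 'u) hmod")

definition is_hmap :: "('c::cstar_algebra, 'u) hmap \<Rightarrow> bool" where
  "is_hmap f \<longleftrightarrow> hilbert_module (src f) \<and> hilbert_module (tgt f) \<and>
     fn f \<in> carrier (src f) \<rightarrow>\<^sub>E carrier (tgt f)"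

definition bounded_linear_hmap :: "('c::cstar_algebra, 'u) hmap \<Rightarrow> bool" where
  "bounded_linear_hmap f \<longleftrightarrow> is_hmap f \<and>
     (\<forall>x\<in>carrier (src f). \<forall>y\<in>carrier (src f).
        fn f (add (src f) x y) = add (tgt f) (fn f x) (fn f y)) \<and>
     (\<forall>x\<in>carrier (src f). \<forall>z. fn f (csc (src f) z x) = csc (tgt f) z (fn f x)) \<and>
     (\<forall>x\<in>carrier (src f). \<forall>a. fn f (act (src f) x a) = act (tgt f) (fn f x) a) \<and>
     (\<exists>K. \<forall>x\<in>carrier (src f). hnorm (tgt f) (fn f x) \<le> K * hnorm (src f) x)"

definition is_adjoint ::
  "('c::cstar_algebra, 'u) hmap \<Rightarrow> ('c, 'u) hmap \<Rightarrow> bool" where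
  "is_adjoint f g \<longleftrightarrow> is_hmap f \<and> is_hmap g \<and> src g = tgt f \<and> tgt g = src f \<and>
     (\<forall>x\<in>carrier (src f). \<forall>y\<in>carrier (tgt f).
        inner (tgt f) (fn f x) y = inner (src f) x (fn g y))"

definition adjointable :: "('c::cstar_algebra, 'u) hmap \<Rightarrow> bool" where
  "adjointable f \<longleftrightarrow> (\<exists>g. is_adjoint f g)"

definition hilb_dagger :: "('c::cstar_algebra, 'u) hmap \<Rightarrow> ('c, 'u) hmap" where
  "hilb_dagger f = (THE g. is_adjoint f g)"

definition hmap_cat :: "(('c::cstar_algebra, 'u) hmap \<Rightarrow> bool) \<Rightarrow>
    (('c, 'u) hmod, ('c, 'u) hmap) cat" where
  "hmap_cat P =
     \<lparr> Obj = {E. hilbert_module E},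
       Arr = {f. P f},
       Dom = src,
       Cod = tgt,
       Id = (\<lambda>E. HMap E (\<lambda>x\<in>carrier E. x) E),
       Comp = (\<lambda>g f. HMap (src f) (compose (carrier (src f)) (fn g) (fn f)) (tgt g)) \<rparr>"

definition Hilb_bd :: "(('c::cstar_algebra, 'u) hmod, ('c, 'u) hmap) cat" where
  "Hilb_bd = hmap_cat bounded_linear_hmap"

definition Hilb :: "(('c::cstar_algebra, 'u) hmod, ('c, 'u) hmap) cat" where
  "Hilb = hmap_cat adjointable"

text \<open>
  The evident actions on elementary tensors, which pin down the tensor product of morphisms and
  the coherence isomorphisms because elementary tensors span a dense subspace.
\<close>

definition canonical_on_elem_tensors ::
  "(('c::cstar_algebra, ('c, 'x) univ) hmap \<Rightarrow> ('c, ('c, 'x) univ) hmap \<Rightarrow> ('c, ('c, 'x) univ) hmap)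
   \<Rightarrow> (('c, 'x) umod \<Rightarrow> ('c, 'x) umod \<Rightarrow> ('c, 'x) umod \<Rightarrow> ('c, ('c, 'x) univ) hmap)
   \<Rightarrow> (('c, 'x) umod \<Rightarrow> ('c, ('c, 'x) univ) hmap)
   \<Rightarrow> (('c, 'x) umod \<Rightarrow> ('c, ('c, 'x) univ) hmap)
   \<Rightarrow> (('c, 'x) umod \<Rightarrow> ('c, 'x) umod \<Rightarrow> ('c, ('c, 'x) univ) hmap) \<Rightarrow> bool" where
  "canonical_on_elem_tensors tenA assoc lunit runit symm \<longleftrightarrow>
     (\<forall>f g x y. bounded_linear_hmap f \<and> bounded_linear_hmap g \<and>
        x \<in> carrier (src f) \<and> y \<in> carrier (src g) \<longrightarrow>
        fn (tenA f g) (elem_tensor (src f) (src g) x y)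
          = elem_tensor (tgt f) (tgt g) (fn f x) (fn g y)) \<and>
     (\<forall>A B D x y w. hilbert_module A \<and> hilbert_module B \<and> hilbert_module D \<and>
        x \<in> carrier A \<and> y \<in> carrier B \<and> w \<in> carrier D \<longrightarrow>
        fn (assoc A B D) (elem_tensor (tensor A B) D (elem_tensor A B x y) w)
          = elem_tensor A (tensor B D) x (elem_tensor B D y w)) \<and>
     (\<forall>A x c. hilbert_module A \<and> x \<in> carrier A \<longrightarrow>
        fn (lunit A) (elem_tensor tensor_unit A (Scalar c) x) = act A x c) \<and>
     (\<forall>A x c. hilbert_module A \<and> x \<in> carrier A \<longrightarrow>
        fn (runit A) (elem_tensor A tensor_unit x (Scalar c)) = act A x c) \<and>
     (\<forall>A B x y. hilbert_module A \<and> hilbert_module B \<and> x \<in> carrier A \<and> y \<in> carrier B \<longrightarrow>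
        fn (symm A B) (elem_tensor A B x y) = elem_tensor B A y x)"

end

theory Submission
  imports Defs
begin

text \<open>
  Positivity in a commutative C*-algebra is handled in its unitization, where square roots of elements
  \<open>a\<close> with \<open>\<parallel>1 - a\<parallel> \<le> 1\<close> are limits of an iteration; no characters are needed.  Gaussian elimination
  shows that entrywise products of positive matrices over the algebra are positive.  This makes the
  inner product of the algebraic tensor product positive, and together with
  \<open>\<langle>f x|f x\<rangle> \<le> \<parallel>f\<parallel>\<^sup>2 \<langle>x|x\<rangle>\<close> for bounded module maps it bounds \<open>f \<otimes> g\<close> on finite sums of elementary
  tensors.  The coherence maps preserve inner products of elementary tensors and have dense range, so
  they extend to unitaries; density then reduces every coherence equation to elementary tensors, and
  adjointable maps are bounded by the uniform boundedness principle.
\<close>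

section \<open>Commutative C*-algebras and their unitization\<close>

text \<open>Positivity is defined by an existential, \<open>a = star b * b\<close>, so even closure
  of the cone under sums needs an argument: once positive elements are squares of selfadjoint ones,
  d^2 + e^2 = (d + i e)^* (d + i e) gives it, by commutativity. The missing unit is the obstacle
  throughout. Elements such as 1 - a, (p + \<epsilon>)^{-1} and its square root live only in the
  unitization, which does act on a Hilbert module, through its complex part and its algebra part. So
  matrices and test coefficients are taken there, and a result with zero scalar part is brought back
  at the end. The unitors meet the same obstacle: without x = x 1, density of the vectors x c comes
  from the approximate units p (p + \<epsilon>)^{-1}. The bound for f \<otimes> g rests on writing
  M^2 N^2 <x|x'><y|y'> - <f x|f x'><g y|g y'> as a sum of two entrywise products of positive
  matrices. Both categories are then treated by one proof, for any class of bounded maps that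
  contains the unitaries and is closed under composition and tensor product.\<close>

lemma scaleC_zero_right [simp]: "z *\<^sub>C (0::'a::cstar_algebra) = 0"
  using scaleC_add_right[of z 0 "0::'a"] by simp

lemma scaleC_zero_left [simp]: "0 *\<^sub>C (a::'a::cstar_algebra) = 0"
  using scaleC_add_left[of 0 0 a] by simp

lemma scaleC_one [simp]: "1 *\<^sub>C (a::'a::cstar_algebra) = a"
  using scaleC_of_real[of 1 a] by simp

lemma scaleC_minus_right [simp]: "z *\<^sub>C (- a) = - (z *\<^sub>C (a::'a::cstar_algebra))"
  using scaleC_add_right[of z a "-a"] by (simp add: eq_neg_iff_add_eq_0 add.commute)

lemma scaleC_minus_left [simp]: "(- z) *\<^sub>C a = - (z *\<^sub>C (a::'a::cstar_algebra))"
  using scaleC_add_left[of z "-z" a] by (simp add: eq_neg_iff_add_eq_0 add.commute)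

lemma scaleC_diff_right: "z *\<^sub>C (a - b) = z *\<^sub>C a - z *\<^sub>C (b::'a::cstar_algebra)"
  using scaleC_add_right[of z a "-b"] by simp

lemma scaleC_diff_left: "(z - w) *\<^sub>C a = z *\<^sub>C a - w *\<^sub>C (a::'a::cstar_algebra)"
  using scaleC_add_left[of z "-w" a] by simp

lemma scaleR_scaleC: "r *\<^sub>R a = of_real r *\<^sub>C (a::'a::cstar_algebra)"
  by (simp add: scaleC_of_real)

lemma scaleC_sum_right: "z *\<^sub>C (\<Sum>i\<in>I. f i) = (\<Sum>i\<in>I. z *\<^sub>C (f i :: 'a::cstar_algebra))"
  by (induction I rule: infinite_finite_induct) (auto simp: scaleC_add_right)

lemma star_zero [simp]: "star (0::'a::cstar_algebra) = 0"
  using star_add[of 0 "0::'a"] by simp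

lemma star_minus [simp]: "star (- a) = - star (a::'a::cstar_algebra)"
  using star_add[of a "-a"] by (simp add: eq_neg_iff_add_eq_0 add.commute)

lemma star_diff: "star (a - b) = star a - star (b::'a::cstar_algebra)"
  using star_add[of a "-b"] by simp

lemma star_scaleR: "star (r *\<^sub>R a) = r *\<^sub>R star (a::'a::cstar_algebra)"
  by (simp add: scaleR_scaleC star_scaleC)

lemma star_sum: "star (\<Sum>i\<in>I. f i) = (\<Sum>i\<in>I. star (f i :: 'a::cstar_algebra))"
  by (induction I rule: infinite_finite_induct) (auto simp: star_add)

text \<open>Submultiplicativity in the C*-identity bounds the square of \<open>norm b\<close> by
  \<open>norm (star b) * norm b\<close>; the resulting inequality is applied to \<open>a\<close> and
  to \<open>star a\<close>.\<close>

lemma norm_star [simp]: "norm (star a) = norm (a::'a::cstar_algebra)"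
proof -
  have le: "norm b \<le> norm (star b)" for b :: 'a
  proof (cases "b = 0")
    case False
    have "norm b * norm b \<le> norm (star b) * norm b"
      using cstar_identity[of b] norm_mult_ineq[of "star b" b] by (simp add: power2_eq_square)
    then show ?thesis using False by simp
  qed simp
  show ?thesis using le[of a] le[of "star a"] by (simp add: star_star)
qed

lemma bounded_linear_scaleC: "bounded_linear (\<lambda>a::'a::cstar_algebra. z *\<^sub>C a)"
  by (rule bounded_linear_intro[where K = "cmod z"])
     (auto simp: scaleC_add_right scaleR_scaleC scaleC_scaleC norm_scaleC mult.commute)

lemma bounded_linear_star: "bounded_linear (star :: 'a::cstar_algebra \<Rightarrow> 'a)"
  by (rule bounded_linear_intro[where K = 1]) (auto simp: star_add star_scaleR)

lemmas tendsto_star = bounded_linear.tendsto[OF bounded_linear_star]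
lemmas tendsto_scaleC = bounded_linear.tendsto[OF bounded_linear_scaleC]

text \<open>The norm is that of \<open>A \<oplus> \<complex>\<close> acting on \<open>A\<close>, corrected by the scalar part because this
  action is not faithful when \<open>A\<close> already has a unit.\<close>

datatype 'a unitization = Unz (alg_part: 'a) (scalar_part: complex)

definition unz_op :: "'a::cstar_algebra unitization \<Rightarrow> 'a \<Rightarrow> 'a" where
  "unz_op u b = alg_part u * b + scalar_part u *\<^sub>C b"

lemma bounded_linear_unz_op: "bounded_linear (unz_op u)"
  unfolding unz_op_def
  by (intro bounded_linear_add bounded_linear_mult_right bounded_linear_scaleC)

instantiation unitization :: (comm_cstar_algebra) "{real_vector, comm_ring_1, real_algebra_1}"
begin
definition "0 = Unz 0 0"
definition "1 = Unz 0 1"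
definition "u + v = Unz (alg_part u + alg_part v) (scalar_part u + scalar_part v)"
definition "- u = Unz (- alg_part u) (- scalar_part u)"
definition "u - v = Unz (alg_part u - alg_part v) (scalar_part u - scalar_part v)"
definition "u * v = Unz (alg_part u * alg_part v + scalar_part u *\<^sub>C alg_part v + scalar_part v *\<^sub>C alg_part u)
    (scalar_part u * scalar_part v)"
definition "scaleR r u = Unz (r *\<^sub>R alg_part u) (of_real r * scalar_part u)"
instance
  by intro_classes
    (auto simp: zero_unitization_def one_unitization_def plus_unitization_def
      uminus_unitization_def minus_unitization_def times_unitization_def scaleR_unitization_def
      unitization.expand algebra_simps scaleC_add_right scaleC_add_left scaleC_scaleC
      mult_scaleC_left mult_scaleC_right scaleR_scaleC)
end

lemma unz_parts [simp]:
  fixes u v :: "'a::comm_cstar_algebra unitization"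
  shows "alg_part (0::'a unitization) = 0" "scalar_part (0::'a unitization) = 0"
    "alg_part (1::'a unitization) = 0" "scalar_part (1::'a unitization) = 1"
    "alg_part (u + v) = alg_part u + alg_part v" "scalar_part (u + v) = scalar_part u + scalar_part v"
    "alg_part (- u) = - alg_part u" "scalar_part (- u) = - scalar_part u"
    "alg_part (u - v) = alg_part u - alg_part v" "scalar_part (u - v) = scalar_part u - scalar_part v"
    "alg_part (u * v) = alg_part u * alg_part v + scalar_part u *\<^sub>C alg_part v + scalar_part v *\<^sub>C alg_part u"
    "scalar_part (u * v) = scalar_part u * scalar_part v"
    "alg_part (r *\<^sub>R u) = r *\<^sub>R alg_part u" "scalar_part (r *\<^sub>R u) = of_real r * scalar_part u"
  by (auto simp: zero_unitization_def one_unitization_def plus_unitization_def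
      uminus_unitization_def minus_unitization_def times_unitization_def scaleR_unitization_def)

lemma unz_op_simps:
  fixes u v :: "'a::comm_cstar_algebra unitization"
  shows "unz_op (u + v) = (\<lambda>b. unz_op u b + unz_op v b)"
    "unz_op (u * v) = unz_op u \<circ> unz_op v"
    "unz_op (r *\<^sub>R u) = (\<lambda>b. r *\<^sub>R unz_op u b)"
    "unz_op 1 = (\<lambda>b::'a. b)" "unz_op 0 = (\<lambda>b::'a. 0)"
  by (auto simp: unz_op_def fun_eq_iff algebra_simps scaleC_add_right scaleC_add_left scaleC_scaleC
      mult_scaleC_left mult_scaleC_right scaleR_scaleC)

text \<open>By the C*-identity, multiplication by \<open>a\<close> attains its bound at
  \<open>star a\<close>. Hence the algebra embeds isometrically in its unitization.\<close>

lemma onorm_unz_op_alg: "onorm (unz_op (Unz (a::'a::cstar_algebra) 0)) = norm a"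
proof (rule antisym)
  show "onorm (unz_op (Unz a 0)) \<le> norm a"
    by (rule onorm_bound) (auto simp: unz_op_def norm_mult_ineq)
  show "norm a \<le> onorm (unz_op (Unz a 0))"
  proof (cases "a = 0")
    case True then show ?thesis by (simp add: onorm_pos_le bounded_linear_unz_op)
  next
    case False
    have "norm (a * star a) = norm a * norm a"
      using cstar_identity[of "star a"] by (simp add: star_star power2_eq_square)
    then have "norm a * norm a \<le> onorm (unz_op (Unz a 0)) * norm a"
      using onorm[OF bounded_linear_unz_op, of "Unz a 0" "star a"] by (simp add: unz_op_def)
    then show ?thesis using False by simp
  qed
qed

instantiation unitization :: (comm_cstar_algebra) "{real_normed_algebra_1}"
begin
definition "norm u = max (cmod (scalar_part u)) (onorm (unz_op u))"
definition "sgn (u::'a unitization) = u /\<^sub>R norm u"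
definition "dist u v = norm (u - v :: 'a unitization)"
definition "uniformity = (INF e\<in>{0<..}. principal {(u, v::'a unitization). dist u v < e})"
definition "open (U::'a unitization set) \<longleftrightarrow> (\<forall>u\<in>U. \<forall>\<^sub>F (u', v) in uniformity. u' = u \<longrightarrow> v \<in> U)"
instance
proof
  fix u v :: "'a unitization" and r :: real
  note bl = bounded_linear_unz_op
  show "sgn u = u /\<^sub>R norm u" "dist u v = norm (u - v)"
    "uniformity = (INF e\<in>{0<..}. principal {(u, v::'a unitization). dist u v < e})"
    by (fact sgn_unitization_def dist_unitization_def uniformity_unitization_def)+
  show "open U \<longleftrightarrow> (\<forall>u\<in>U. \<forall>\<^sub>F (u', v) in uniformity. u' = u \<longrightarrow> v \<in> U)" for U :: "'a unitization set"
    by (fact open_unitization_def)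
  show "norm u = 0 \<longleftrightarrow> u = 0"
  proof
    assume "norm u = 0"
    then have "max (cmod (scalar_part u)) (onorm (unz_op u)) = 0" by (simp add: norm_unitization_def)
    then have "scalar_part u = 0" "onorm (unz_op u) = 0"
      using onorm_pos_le[OF bl, of u] by (smt (verit) norm_ge_zero norm_eq_zero)+
    moreover from this have "norm (alg_part u) = 0"
      using onorm_unz_op_alg[of "alg_part u"] by (metis unitization.collapse)
    ultimately show "u = 0" by (simp add: unitization.expand)
  qed (simp add: norm_unitization_def unz_op_simps onorm_zero)
  show "norm (u + v) \<le> norm u + norm v"
    unfolding norm_unitization_def unz_op_simps unz_parts
    by (intro max.boundedI order_trans[OF norm_triangle_ineq] order_trans[OF onorm_triangle[OF bl bl]]
        add_mono max.cobounded1 max.cobounded2)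
  show "norm (r *\<^sub>R u) = \<bar>r\<bar> * norm u"
    by (simp add: norm_unitization_def unz_op_simps onorm_scaleR[OF bl] norm_mult max_mult_distrib_left)
  show "norm (u * v) \<le> norm u * norm v"
  proof -
    have "cmod (scalar_part u) * cmod (scalar_part v) \<le> norm u * norm v"
      by (intro mult_mono) (auto simp: norm_unitization_def le_max_iff_disj)
    moreover have "onorm (unz_op u \<circ> unz_op v) \<le> norm u * norm v"
      by (rule order_trans[OF onorm_compose[OF bl bl]])
         (auto simp: norm_unitization_def le_max_iff_disj onorm_pos_le[OF bl] intro!: mult_mono)
    ultimately show ?thesis by (simp add: norm_unitization_def unz_op_simps norm_mult)
  qed
  show "norm (1::'a unitization) = 1"
    using onorm_id_le[where 'a='a] by (simp add: norm_unitization_def unz_op_simps)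
qed
end

lemma norm_Unz_alg: "norm (Unz (a::'a::comm_cstar_algebra) 0) = norm a"
  by (simp add: norm_unitization_def onorm_unz_op_alg)

instantiation unitization :: (comm_cstar_algebra) comm_cstar_algebra
begin
definition "scaleC z u = Unz (z *\<^sub>C alg_part u) (z * scalar_part u)"
definition "star u = Unz (star (alg_part u)) (cnj (scalar_part u))"
instance
proof
  fix u v :: "'a unitization" and z w :: complex and r :: real
  note bl = bounded_linear_unz_op
  show "z *\<^sub>C (u + v) = z *\<^sub>C u + z *\<^sub>C v" "(z + w) *\<^sub>C u = z *\<^sub>C u + w *\<^sub>C u"
    "z *\<^sub>C w *\<^sub>C u = (z * w) *\<^sub>C u" "of_real r *\<^sub>C u = r *\<^sub>R u"
    "(z *\<^sub>C u) * v = z *\<^sub>C (u * v)" "u * (z *\<^sub>C v) = z *\<^sub>C (u * v)"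
    "star (u + v) = star u + star v" "star (z *\<^sub>C u) = cnj z *\<^sub>C star u"
    "star (u * v) = star v * star u" "star (star u) = u"
    by (auto simp: scaleC_unitization_def star_unitization_def unitization.expand algebra_simps
        scaleC_add_right scaleC_add_left scaleC_scaleC mult_scaleC_left mult_scaleC_right
        scaleR_scaleC star_add star_scaleC star_mult star_star)
  show "norm (z *\<^sub>C u) = cmod z * norm u"
  proof -
    have "unz_op (z *\<^sub>C u) = unz_op (Unz 0 z) \<circ> unz_op u"
      by (auto simp: unz_op_def fun_eq_iff scaleC_unitization_def scaleC_add_right scaleC_scaleC mult_scaleC_left)
    have le: "onorm (unz_op (z *\<^sub>C u)) \<le> cmod z * onorm (unz_op u)" for z and u :: "'a unitization"
    proof (rule onorm_bound)
      show "0 \<le> cmod z * onorm (unz_op u)" by (simp add: onorm_pos_le[OF bl])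
      fix b
      have "norm (unz_op (z *\<^sub>C u) b) = cmod z * norm (unz_op u b)"
        by (simp add: unz_op_def scaleC_unitization_def scaleC_add_right scaleC_scaleC mult_scaleC_left
            flip: norm_scaleC)
      also have "\<dots> \<le> cmod z * (onorm (unz_op u) * norm b)"
        by (intro mult_left_mono onorm[OF bl]) auto
      finally show "norm (unz_op (z *\<^sub>C u) b) \<le> cmod z * onorm (unz_op u) * norm b"
        by (simp add: mult.assoc)
    qed
    \<comment> \<open>The reverse inequality is \<open>le\<close> for the inverse scalar.\<close>
    have "cmod z * onorm (unz_op u) \<le> onorm (unz_op (z *\<^sub>C u))"
    proof (cases "z = 0")
      case False
      have "inverse z *\<^sub>C z *\<^sub>C u = u"
        using False by (simp add: scaleC_unitization_def scaleC_scaleC unitization.expand)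
      then have "onorm (unz_op u) \<le> cmod (inverse z) * onorm (unz_op (z *\<^sub>C u))"
        using le[of "inverse z" "z *\<^sub>C u"] by simp
      then show ?thesis using False by (simp add: norm_divide field_simps)
    qed (simp add: onorm_pos_le[OF bl])
    with le[of z u] have "onorm (unz_op (z *\<^sub>C u)) = cmod z * onorm (unz_op u)" by simp
    then show ?thesis
      by (simp add: norm_unitization_def norm_mult max_mult_distrib_left) (simp add: scaleC_unitization_def norm_mult)
  qed
  show "norm (star u * u) = (norm u)\<^sup>2"
  proof -
    \<comment> \<open>Commutativity turns the star of u^* b into u b^*, so both operators have the
      same norm.\<close>
    have op_star: "onorm (unz_op (star u)) = onorm (unz_op u)" for u :: "'a unitization"
    proof -
      have eq: "norm (unz_op (star u) b) = norm (unz_op u (star b))" for b and u :: "'a unitization"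
        by (subst norm_star[symmetric])
           (simp add: unz_op_def star_unitization_def star_add star_scaleC star_mult star_star mult.commute)
      have "onorm (unz_op (star u)) \<le> onorm (unz_op u)" for u :: "'a unitization"
        by (rule onorm_bound[OF onorm_pos_le[OF bl]])
          (use onorm[OF bl, of u] norm_star in \<open>metis eq\<close>)
      from this[of u] this[of "star u"] show ?thesis
        by (simp add: star_unitization_def star_star)
    qed
    have "onorm (unz_op (star u * u)) \<le> onorm (unz_op u) * onorm (unz_op u)"
      using onorm_compose[OF bl bl, of "star u" u] by (simp add: unz_op_simps op_star)
    moreover have "onorm (unz_op u) \<le> sqrt (onorm (unz_op (star u * u)))"
    proof (rule onorm_bound)
      show "0 \<le> sqrt (onorm (unz_op (star u * u)))" by (simp add: onorm_pos_le[OF bl])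
      fix b
      \<comment> \<open>The C*-identity of the algebra itself, with (u b)^* (u b) = b^* (u^* u
        b).\<close>
      have "(norm (unz_op u b))\<^sup>2 = norm (star b * unz_op (star u * u) b)"
        by (subst cstar_identity[symmetric], rule arg_cong[where f = norm])
          (simp add: unz_op_def star_unitization_def star_add star_scaleC star_mult algebra_simps
            mult_scaleC_left mult_scaleC_right scaleC_add_right scaleC_scaleC scaleC_add_left)
      also have "\<dots> \<le> norm b * (onorm (unz_op (star u * u)) * norm b)"
        by (rule order_trans[OF norm_mult_ineq]) (auto intro!: mult_left_mono onorm[OF bl])
      also have "\<dots> = (sqrt (onorm (unz_op (star u * u))) * norm b)\<^sup>2"
        by (simp add: power_mult_distrib onorm_pos_le[OF bl] power2_eq_square mult.left_commute mult.commute)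
      finally show "norm (unz_op u b) \<le> sqrt (onorm (unz_op (star u * u))) * norm b"
        by (rule power2_le_imp_le) (simp add: onorm_pos_le[OF bl])
    qed
    then have "(onorm (unz_op u))\<^sup>2 \<le> (sqrt (onorm (unz_op (star u * u))))\<^sup>2"
      by (intro power_mono onorm_pos_le[OF bl])
    ultimately have "onorm (unz_op (star u * u)) = (onorm (unz_op u))\<^sup>2"
      by (simp add: onorm_pos_le[OF bl] power2_eq_square)
    moreover have "max (x\<^sup>2) (y\<^sup>2) = (max x y)\<^sup>2" if "0 \<le> x" "0 \<le> y" for x y :: real
      using that by (auto simp: max_def)
    moreover have "cmod (scalar_part (star u * u)) = (cmod (scalar_part u))\<^sup>2"
      by (simp add: star_unitization_def norm_mult power2_eq_square)
    ultimately show ?thesis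
      using onorm_pos_le[OF bl, of u] by (simp add: norm_unitization_def del: unz_parts)
  qed
  show "convergent X" if cau: "Cauchy X" for X :: "nat \<Rightarrow> 'a unitization"
  proof -
    have "norm (scalar_part u) \<le> norm u" for u :: "'a unitization"
      by (simp add: norm_unitization_def)
    have bs: "dist (scalar_part u) (scalar_part v) \<le> dist u v" for u v :: "'a unitization"
      unfolding dist_norm by (simp add: norm_unitization_def)
    \<comment> \<open>The algebra part of w is w minus its scalar part, and both have norm at most
      that of w; hence the factor 2.\<close>
    have ba: "dist (alg_part u) (alg_part v) \<le> 2 * dist u v" for u v :: "'a unitization"
    proof -
      have e: "Unz (alg_part w) 0 = w - Unz 0 (scalar_part w)" for w :: "'a unitization"
        by (simp add: unitization.expand)
      have "norm (Unz (0::'a) z) \<le> cmod z" for z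
        unfolding norm_unitization_def by (auto intro!: onorm_bound simp: unz_op_def norm_scaleC)
      then have "norm (alg_part w) \<le> norm w + cmod (scalar_part w)" for w :: "'a unitization"
        using norm_triangle_ineq4[of w "Unz 0 (scalar_part w)"] unfolding norm_Unz_alg[symmetric] e
        by (meson add_left_mono order_trans)
      moreover have "cmod (scalar_part w) \<le> norm w" for w :: "'a unitization"
        by (simp add: norm_unitization_def)
      ultimately show ?thesis unfolding dist_norm
        by (metis add_left_mono mult_2 order_trans unz_parts(9))
    qed
    have "Cauchy (\<lambda>n. scalar_part (X n))"
      using cau bs unfolding Cauchy_def by (meson le_less_trans)
    moreover have "Cauchy (\<lambda>n. alg_part (X n))"
    proof (rule metric_CauchyI)
      fix e :: real assume "e > 0"
      then obtain M where "\<forall>m\<ge>M. \<forall>n\<ge>M. dist (X m) (X n) < e / 2"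
        using metric_CauchyD[OF cau, of "e/2"] by auto
      then show "\<exists>M. \<forall>m\<ge>M. \<forall>n\<ge>M. dist (alg_part (X m)) (alg_part (X n)) < e"
        by (metis ba le_less_trans less_divide_eq_numeral1(1) mult.commute)
    qed
    ultimately obtain a z where lim: "(\<lambda>n. alg_part (X n)) \<longlonglongrightarrow> a" "(\<lambda>n. scalar_part (X n)) \<longlonglongrightarrow> z"
      by (meson Cauchy_convergent convergent_def)
    \<comment> \<open>With this bound, convergence of the two parts implies convergence in the
      unitization.\<close>
    have nb: "norm w \<le> norm (alg_part w) + cmod (scalar_part w)" for w :: "'a unitization"
    proof -
      have "onorm (unz_op w) \<le> norm (alg_part w) + cmod (scalar_part w)"
      proof (rule onorm_bound)
        fix b
        show "norm (unz_op w b) \<le> (norm (alg_part w) + cmod (scalar_part w)) * norm b"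
          unfolding unz_op_def distrib_right
          by (rule norm_triangle_le) (intro add_mono norm_mult_ineq norm_scaleC[THEN eq_refl])
      qed simp
      then show ?thesis by (simp add: norm_unitization_def)
    qed
    have "(\<lambda>n. norm (X n - Unz a z)) \<longlonglongrightarrow> 0"
    proof (rule tendsto_sandwich[where f = "\<lambda>_. 0"])
      show "(\<lambda>n. norm (alg_part (X n) - a) + cmod (scalar_part (X n) - z)) \<longlonglongrightarrow> 0"
        using tendsto_add[OF lim[THEN LIM_zero, THEN tendsto_norm]] by simp
      show "\<forall>\<^sub>F n in sequentially. norm (X n - Unz a z) \<le> norm (alg_part (X n) - a) + cmod (scalar_part (X n) - z)"
        using nb by (intro always_eventually allI) (metis unitization.sel unz_parts(9,10))
    qed auto
    then show ?thesis
      unfolding convergent_def using LIM_zero_cancel tendsto_norm_zero_iff by blast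
  qed
qed
end

section \<open>The positive cone\<close>

text \<open>Square roots and inverses are developed for an arbitrary unital algebra, to be applied
  to unitizations. The class excludes the zero ring, but the unitization of the zero algebra is a
  copy of the complex numbers and so is covered.\<close>

class unital_comm_cstar_algebra = comm_cstar_algebra + comm_ring_1 + real_normed_algebra_1

instance unitization :: (comm_cstar_algebra) unital_comm_cstar_algebra ..

lemma star_one [simp]: "star (1::'a::unital_comm_cstar_algebra) = 1"
  by (metis mult.left_neutral mult.right_neutral star_mult star_star)

lemma norm_square_selfadjoint: "star a = a \<Longrightarrow> norm (a * a) = (norm (a::'a::cstar_algebra))\<^sup>2"
  using cstar_identity[of a] by simp

text \<open>The mixed terms i (a b - b a) cancel by commutativity. Additivity of the positive cone
  comes from this identity: a sum of two selfadjoint squares is again of the form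
  \<open>star c * c\<close>.\<close>

lemma star_mult_Re_Im:
  fixes a b :: "'a::comm_cstar_algebra"
  assumes "star a = a" "star b = b"
  shows "star (a + \<i> *\<^sub>C b) * (a + \<i> *\<^sub>C b) = a * a + b * b"
  using assms by (simp add: star_add star_scaleC algebra_simps mult_scaleC_left mult_scaleC_right scaleC_scaleC)

text \<open>For \<open>z = a + \<i> b\<close> one has \<open>z\<^sup>* z = a\<^sup>2 + b\<^sup>2\<close> and \<open>a = (z + z\<^sup>*) / 2\<close>, so \<open>\<parallel>a\<parallel> \<le> \<parallel>z\<parallel>\<close>.\<close>

lemma norm_square_le_sum_squares:
  fixes a b :: "'a::comm_cstar_algebra"
  assumes "star a = a" "star b = b"
  shows "norm (a * a) \<le> norm (a * a + b * b)"
proof -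
  define z where "z = a + \<i> *\<^sub>C b"
  have "2 *\<^sub>R a = z + star z"
    using assms by (simp add: z_def star_add star_scaleC scaleR_2)
  then have "2 * norm a \<le> norm z + norm (star z)"
    using norm_triangle_ineq[of z "star z"] by (metis abs_numeral norm_scaleR)
  then have "norm a \<le> norm z" by simp
  then have "(norm a)\<^sup>2 \<le> (norm z)\<^sup>2" by (simp add: power_mono)
  then show ?thesis
    using star_mult_Re_Im[OF assms] cstar_identity[of z] assms by (simp add: z_def norm_square_selfadjoint)
qed

text \<open>\<open>1 - sqrt (1 - u)\<close> is the limit of \<open>y\<^sub>0 = 0\<close>, \<open>y\<^sub>n\<^sub>+\<^sub>1 = (u + y\<^sub>n\<^sup>2) / 2\<close>; the increments are dominated
  by those of the same iteration for the real number \<open>u = 1\<close>.\<close>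

primrec sqrt_iter :: "'a::real_algebra_1 \<Rightarrow> nat \<Rightarrow> 'a" where
  "sqrt_iter u 0 = 0"
| "sqrt_iter u (Suc n) = (u + sqrt_iter u n * sqrt_iter u n) /\<^sub>R 2"

lemma sqrt_iter_real_bounds: "0 \<le> sqrt_iter (1::real) n" "sqrt_iter (1::real) n \<le> 1"
proof (induction n)
  case (Suc n)
  { case 1 then show ?case by simp }
  { case 2 with Suc show ?case by (simp add: mult_le_one) }
qed auto

lemma norm_sqrt_iter_le:
  fixes u :: "'a::real_normed_algebra_1"
  assumes "norm u \<le> 1"
  shows "norm (sqrt_iter u n) \<le> sqrt_iter 1 n"
proof (induction n)
  case (Suc n)
  have "norm (sqrt_iter u n * sqrt_iter u n) \<le> sqrt_iter 1 n * sqrt_iter 1 n"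
    by (rule order_trans[OF norm_mult_ineq]) (intro mult_mono Suc norm_ge_zero sqrt_iter_real_bounds)
  then have "norm (u + sqrt_iter u n * sqrt_iter u n) \<le> 1 + sqrt_iter 1 n * sqrt_iter 1 n"
    using norm_triangle_ineq[of u "sqrt_iter u n * sqrt_iter u n"] assms by linarith
  then show ?case by simp
qed simp

lemma norm_sqrt_iter_increment:
  fixes u :: "'a::{real_normed_algebra_1, comm_ring_1}"
  assumes "norm u \<le> 1"
  shows "norm (sqrt_iter u (Suc n) - sqrt_iter u n) \<le> sqrt_iter 1 (Suc n) - sqrt_iter 1 n"
proof (induction n)
  case (Suc n)
  \<comment> \<open>The halves of \<open>v\<close> cancel, and a^2 - b^2 = (a - b) (a + b) by
    commutativity.\<close>
  have split: "sqrt_iter v (Suc (Suc n)) - sqrt_iter v (Suc n)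
      = ((sqrt_iter v (Suc n) - sqrt_iter v n) * (sqrt_iter v (Suc n) + sqrt_iter v n)) /\<^sub>R 2"
    for v :: "'b::{real_normed_algebra_1, comm_ring_1}"
    unfolding sqrt_iter.simps(2)[of v "Suc n"] sqrt_iter.simps(2)[of v n]
    by (simp only: flip: scaleR_diff_right) (simp add: algebra_simps)
  have "norm ((sqrt_iter u (Suc n) - sqrt_iter u n) * (sqrt_iter u (Suc n) + sqrt_iter u n))
      \<le> (sqrt_iter 1 (Suc n) - sqrt_iter 1 n) * (sqrt_iter 1 (Suc n) + sqrt_iter 1 n)"
    by (rule order_trans[OF norm_mult_ineq], rule mult_mono[OF Suc])
       (intro norm_triangle_le add_mono norm_sqrt_iter_le[OF assms] norm_ge_zero order_trans[OF norm_ge_zero Suc])+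
  then show ?case unfolding split by (simp only: norm_scaleR real_scaleR_def) simp
qed (use assms in simp)

text \<open>The increments of the iteration are summable, being dominated by those of a bounded
  increasing real sequence. The limit \<open>l\<close> solves 2 l = (1 - a) + l^2, which says that
  (1 - l)^2 = a.\<close>

lemma sqrt_exists:
  fixes a :: "'a::unital_comm_cstar_algebra"
  assumes "norm (1 - a) \<le> 1" "star a = a"
  obtains d where "star d = d" "d * d = a"
proof -
  define y where "y = sqrt_iter (1 - a)"
  define r :: "nat \<Rightarrow> real" where "r = sqrt_iter 1"
  have inc: "norm (y (Suc n) - y n) \<le> r (Suc n) - r n" for n
    unfolding y_def r_def by (rule norm_sqrt_iter_increment[OF assms(1)])
  \<comment> \<open>The increments of \<open>r\<close> bound norms and are therefore
    nonnegative.\<close>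
  have "incseq r"
    by (rule incseq_SucI) (meson diff_ge_0_iff_ge inc norm_ge_zero order_trans)
  moreover have "bdd_above (range r)"
    using sqrt_iter_real_bounds(2) by (auto simp: r_def bdd_above_def)
  ultimately have "convergent r"
    using LIMSEQ_incseq_SUP convergentI by blast
  then have "summable (\<lambda>n. r (Suc n) - r n)"
    unfolding convergent_def by (blast intro: telescope_summable)
  then have "summable (\<lambda>n. y (Suc n) - y n)"
    by (rule summable_comparison_test'[where N = 0]) (rule inc)
  then have "convergent (\<lambda>n. \<Sum>i<n. y (Suc i) - y i)"
    by (simp only: summable_iff_convergent)
  moreover have "(\<Sum>i<n. y (Suc i) - y i) = y n" for n
    by (simp only: sum_lessThan_telescope) (simp add: y_def)
  ultimately obtain l where l: "y \<longlonglongrightarrow> l"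
    by (auto simp: convergent_def)
  have "(\<lambda>n. y (Suc n)) \<longlonglongrightarrow> l" using l by (rule LIMSEQ_Suc)
  moreover have "(\<lambda>n. y (Suc n)) \<longlonglongrightarrow> ((1 - a) + l * l) /\<^sub>R 2"
    unfolding y_def sqrt_iter.simps using l[unfolded y_def] by (intro tendsto_intros)
  ultimately have eq: "l = ((1 - a) + l * l) /\<^sub>R 2" by (rule LIMSEQ_unique)
  have "star (y n) = y n" for n
    by (induction n) (simp_all add: y_def star_add star_diff star_scaleR star_mult assms)
  then have "star l = l"
    using tendsto_star[OF l] l LIMSEQ_unique by auto
  show thesis
  proof
    show "star (1 - l) = 1 - l" by (simp add: star_diff \<open>star l = l\<close>)
    have "2 *\<^sub>R l = (1 - a) + l * l" by (subst eq) simp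
    then show "(1 - l) * (1 - l) = a" by (simp add: algebra_simps scaleR_2)
  qed
qed

section \<open>Square roots, order and norm on the positive cone\<close>

lemma cstar_nonneg_star: "cstar_nonneg a \<Longrightarrow> star a = a"
  by (auto simp: cstar_nonneg_def star_mult star_star)

lemma cstar_nonneg_square: "star a = a \<Longrightarrow> cstar_nonneg (a * a)"
  by (metis cstar_nonneg_def)

lemma cstar_nonneg_star_mult: "cstar_nonneg (star a * a)"
  by (auto simp: cstar_nonneg_def)

lemma cstar_nonneg_zero [simp]: "cstar_nonneg 0"
  unfolding cstar_nonneg_def by (rule exI[of _ 0]) simp

lemma cstar_nonneg_one [simp]: "cstar_nonneg (1::'a::unital_comm_cstar_algebra)"
  unfolding cstar_nonneg_def by (rule exI[of _ 1]) simp

lemma cstar_nonneg_scaleR: "0 \<le> r \<Longrightarrow> cstar_nonneg a \<Longrightarrow> cstar_nonneg (r *\<^sub>R a)"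
  unfolding cstar_nonneg_def
  by (metis (no_types, lifting) mult_scaleR_left mult_scaleR_right real_sqrt_mult_self scaleR_scaleR star_scaleR abs_of_nonneg)

lemma cstar_nonneg_scaleR_iff: "0 < r \<Longrightarrow> cstar_nonneg (r *\<^sub>R a) \<longleftrightarrow> cstar_nonneg a"
  using cstar_nonneg_scaleR[of r a] cstar_nonneg_scaleR[of "inverse r" "r *\<^sub>R a"] by auto

lemma cstar_nonneg_mult:
  "cstar_nonneg a \<Longrightarrow> cstar_nonneg b \<Longrightarrow> cstar_nonneg (a * b :: 'a::comm_cstar_algebra)"
  unfolding cstar_nonneg_def by (metis star_mult mult.assoc mult.commute)

text \<open>As a^2 has norm at most 1, the element 1 - a^2 has a selfadjoint root k; then k^2 + a^2
  = 1, and dropping a summand a^2 does not increase the norm.\<close>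

lemma norm_one_minus_square_le:
  fixes a :: "'a::unital_comm_cstar_algebra"
  assumes "star a = a" "norm a \<le> 1"
  shows "norm (1 - a * a) \<le> 1"
proof -
  have "norm (a * a) \<le> 1"
    using assms by (simp add: norm_square_selfadjoint power_le_one)
  then obtain k where k: "star k = k" "k * k = 1 - a * a"
    using sqrt_exists[of "1 - a * a"] assms by (auto simp: star_diff star_mult)
  then show ?thesis
    using norm_square_le_sum_squares[of k a] assms by simp
qed

lemma Re_Im_exist:
  fixes b :: "'a::comm_cstar_algebra"
  obtains x y where "star x = x" "star y = y" "b = x + \<i> *\<^sub>C y"
proof
  show "star ((b + star b) /\<^sub>R 2) = (b + star b) /\<^sub>R 2"
    by (simp add: star_scaleR star_add star_star add.commute)
  show "star ((- \<i> / 2) *\<^sub>C (b - star b)) = (- \<i> / 2) *\<^sub>C (b - star b)"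
    by (simp add: star_scaleC star_diff star_star scaleC_diff_right)
  show "b = (b + star b) /\<^sub>R 2 + \<i> *\<^sub>C (- \<i> / 2) *\<^sub>C (b - star b)"
    by (simp add: scaleC_scaleC scaleR_scaleC scaleC_add_right scaleC_diff_right flip: scaleC_add_left)
qed

text \<open>With selfadjoint parts, a = x^2 + y^2. After scaling, 1 - a / s^2 is the mean of two
  elements 1 - z^2 with z in the unit ball, so it has norm at most 1 and \<open>sqrt_exists\<close>
  applies.\<close>

lemma cstar_nonneg_sqrt:
  fixes a :: "'a::unital_comm_cstar_algebra"
  assumes "cstar_nonneg a"
  obtains d where "star d = d" "d * d = a"
proof -
  obtain b where b: "a = star b * b" using assms cstar_nonneg_def by blast
  obtain x y where xy: "star x = x" "star y = y" "b = x + \<i> *\<^sub>C y" by (rule Re_Im_exist)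
  have a: "a = x * x + y * y" using star_mult_Re_Im xy b by metis
  \<comment> \<open>The factor \<open>sqrt 2\<close> is there because each of x^2 and y^2 is doubled
    in the mean: t x and t y then have norm at most 1. The outer \<open>max 1\<close> keeps
    \<open>s\<close> positive.\<close>
  define s where "s = sqrt 2 * max 1 (max (norm x) (norm y))"
  have s: "0 < s" "sqrt 2 * norm x \<le> s" "sqrt 2 * norm y \<le> s" by (auto simp: s_def)
  define t where "t = sqrt 2 / s"
  have st: "s * s * (t * t) = 2" "t > 0" using s by (simp_all add: t_def field_simps)
  have half: "norm (1 - (t *\<^sub>R z) * (t *\<^sub>R z)) \<le> 1" if "star z = z" "sqrt 2 * norm z \<le> s" for z :: 'a
    using that s by (intro norm_one_minus_square_le) (auto simp: t_def star_scaleR field_simps)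
  have "1 - a /\<^sub>R (s * s) = (1/2) *\<^sub>R ((1 - (t *\<^sub>R x) * (t *\<^sub>R x)) + (1 - (t *\<^sub>R y) * (t *\<^sub>R y)))"
    using s by (simp add: a t_def algebra_simps inverse_eq_divide scaleR_2[symmetric])
  also have "norm \<dots> \<le> (1/2) * (1 + 1)"
    unfolding norm_scaleR using half[OF xy(1) s(2)] half[OF xy(2) s(3)]
    by (intro mult_mono norm_triangle_le add_mono) auto
  finally obtain d where d: "star d = d" "d * d = a /\<^sub>R (s * s)"
    using sqrt_exists[of "a /\<^sub>R (s * s)"] cstar_nonneg_star[OF assms] by (auto simp: star_scaleR)
  show thesis
    using that[of "s *\<^sub>R d"] d s by (simp add: star_scaleR mult.assoc[symmetric])
qed

lemma cstar_nonneg_add_unital: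
  fixes a b :: "'a::unital_comm_cstar_algebra"
  assumes "cstar_nonneg a" "cstar_nonneg b"
  shows "cstar_nonneg (a + b)"
  using cstar_nonneg_sqrt[OF assms(1)] cstar_nonneg_sqrt[OF assms(2)]
  by (metis star_mult_Re_Im cstar_nonneg_star_mult)

lemma norm_mono_unital:
  fixes a b :: "'a::unital_comm_cstar_algebra"
  assumes "cstar_nonneg a" "cstar_nonneg (b - a)"
  shows "norm a \<le> norm b"
proof -
  obtain d e where "star d = d" "d * d = a" "star e = e" "e * e = b - a"
    using cstar_nonneg_sqrt assms by metis
  then show ?thesis using norm_square_le_sum_squares[of d e] by simp
qed

text \<open>For nonzero \<open>a\<close>, the element 1 - a / norm a differs from 1 by an element of
  norm one and hence has a selfadjoint square root.\<close>

lemma cstar_nonneg_norm_minus_selfadjoint: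
  fixes a :: "'a::unital_comm_cstar_algebra"
  assumes "star a = a"
  shows "cstar_nonneg (norm a *\<^sub>R 1 - a)"
proof (cases "a = 0")
  case False
  obtain d where "star d = d" "d * d = 1 - a /\<^sub>R norm a"
    using sqrt_exists[of "1 - a /\<^sub>R norm a"] assms False by (auto simp: star_diff star_scaleR)
  then have "cstar_nonneg (1 - a /\<^sub>R norm a)" using cstar_nonneg_square by metis
  then have "cstar_nonneg (norm a *\<^sub>R (1 - a /\<^sub>R norm a))" by (intro cstar_nonneg_scaleR) auto
  then show ?thesis using False by (simp add: scaleR_diff_right)
qed simp

text \<open>This trades the existential in the definition of positivity for a closed condition on
  the norm.\<close>

lemma cstar_nonneg_iff_norm:
  fixes a :: "'a::unital_comm_cstar_algebra"
  assumes "star a = a" "norm a \<le> 1"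
  shows "cstar_nonneg a \<longleftrightarrow> norm (1 - a) \<le> 1"
proof
  assume "cstar_nonneg a"
  then obtain d where d: "star d = d" "d * d = a" using cstar_nonneg_sqrt by metis
  then have "norm d \<le> 1"
    using assms norm_square_selfadjoint[of d] by (metis abs_norm_cancel abs_square_le_1)
  with d show "norm (1 - a) \<le> 1" using norm_one_minus_square_le by metis
next
  assume "norm (1 - a) \<le> 1"
  then show "cstar_nonneg a" using sqrt_exists[of a] assms cstar_nonneg_square by metis
qed

text \<open>A convergent sequence is bounded, so it can be scaled into the unit ball; there
  positivity is a norm inequality, which passes to the limit.\<close>

lemma cstar_nonneg_LIMSEQ_unital:
  fixes X :: "nat \<Rightarrow> 'a::unital_comm_cstar_algebra"
  assumes X: "X \<longlonglongrightarrow> a" and nn: "\<And>n. cstar_nonneg (X n)"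
  shows "cstar_nonneg a"
proof -
  obtain K where K: "0 < K" "\<And>n. norm (X n) \<le> K"
    using X convergent_imp_Bseq[of X] by (auto simp: convergent_def Bseq_def)
  have "norm (1 - X n /\<^sub>R K) \<le> 1" for n
    using K nn cstar_nonneg_iff_norm[of "X n /\<^sub>R K"] cstar_nonneg_star[OF nn]
    by (auto simp: star_scaleR field_simps intro!: cstar_nonneg_scaleR)
  moreover have "(\<lambda>n. norm (1 - X n /\<^sub>R K)) \<longlonglongrightarrow> norm (1 - a /\<^sub>R K)"
    using X by (intro tendsto_intros)
  ultimately have "norm (1 - a /\<^sub>R K) \<le> 1" by (meson LIMSEQ_le_const2)
  moreover have "star a = a"
    using tendsto_star[OF X] X LIMSEQ_unique cstar_nonneg_star[OF nn] by auto
  ultimately obtain d where "star d = d" "d * d = a /\<^sub>R K"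
    using sqrt_exists[of "a /\<^sub>R K"] by (auto simp: star_scaleR)
  then have "cstar_nonneg (a /\<^sub>R K)" using cstar_nonneg_square by metis
  then show ?thesis using K cstar_nonneg_scaleR_iff[of "inverse K" a] by simp
qed

text \<open>With M = norm q + \<delta>, the element u = 1 - p / M equals (norm q - q) / M. Since 0
  \<le> q \<le> norm q, its norm is at most norm q / M < 1, so 1 - u = p / M is invertible.\<close>

lemma cstar_inverse_exists:
  fixes p :: "'a::unital_comm_cstar_algebra"
  assumes p: "cstar_nonneg (p - \<delta> *\<^sub>R 1)" and \<delta>: "0 < \<delta>"
  obtains g where "cstar_nonneg g" "g * p = 1"
proof -
  have p0: "cstar_nonneg p"
    using cstar_nonneg_add_unital[OF p cstar_nonneg_scaleR[of \<delta> 1]] \<delta> by simp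
  define q where "q = p - \<delta> *\<^sub>R 1"
  define M where "M = norm q + \<delta>"
  have M: "M > 0" using \<delta> by (simp add: M_def add_nonneg_pos)
  define u where "u = 1 - p /\<^sub>R M"
  have ueq: "u = (norm q *\<^sub>R 1 - q) /\<^sub>R M"
  proof -
    have "M *\<^sub>R u = norm q *\<^sub>R 1 - q"
      using M by (simp add: u_def q_def algebra_simps) (simp add: M_def q_def algebra_simps)
    then show ?thesis using M by (metis less_irrefl scaleR_scaleR left_inverse scaleR_one)
  qed
  have "norm (norm q *\<^sub>R 1 - q) \<le> norm q"
  proof -
    have "cstar_nonneg (norm q *\<^sub>R 1 - q)"
      using p cstar_nonneg_norm_minus_selfadjoint cstar_nonneg_star q_def by metis
    then have "norm (norm q *\<^sub>R 1 - q) \<le> norm (norm q *\<^sub>R (1::'a))"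
      by (rule norm_mono_unital) (use p q_def in simp)
    then show ?thesis by simp
  qed
  then have "norm u \<le> norm q / M" using M ueq by (simp add: divide_inverse_commute mult_left_mono)
  then have u1: "norm u < 1" using M \<delta> by (smt (verit) M_def divide_less_eq_1_pos)
  \<comment> \<open>The fixed point of this contraction stands for the Neumann series of (1 -
    u)^{-1}.\<close>
  have "\<exists>!g. 1 + u * g = g"
  proof (rule banach_fix_type[OF norm_ge_zero u1])
    show "\<forall>x y. dist (1 + u * x) (1 + u * y) \<le> norm u * dist x y"
      by (simp add: dist_norm norm_mult_ineq flip: right_diff_distrib)
  qed
  then obtain h where "1 + u * h = h" by blast
  then have "(1 - u) * h = 1" by (metis add_diff_cancel_right' left_diff_distrib mult.left_neutral)
  then have hp: "(h /\<^sub>R M) * p = 1" by (simp add: u_def mult.commute)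
  define g where "g = h /\<^sub>R M"
  have gp: "g * p = 1" using hp g_def by simp
  then have "star g * p = 1"
    using cstar_nonneg_star[OF p0] by (metis mult.commute star_mult star_one)
  then have "star g = g" using gp by (metis mult.assoc mult.commute mult.right_neutral)
  \<comment> \<open>Writing the selfadjoint inverse as g^2 p exhibits it as a product of positive
    elements.\<close>
  then have "g = (g * g) * p" using gp by (simp add: mult.assoc)
  then have "cstar_nonneg g"
    using cstar_nonneg_mult[OF cstar_nonneg_square[OF \<open>star g = g\<close>] p0] by simp
  then show thesis using gp that by blast
qed

section \<open>Transfer between the algebra and its unitization\<close>

abbreviation unz :: "'a::comm_cstar_algebra \<Rightarrow> 'a unitization" where
  "unz a \<equiv> Unz a 0"

lemma unz_simps:
  fixes a b :: "'a::comm_cstar_algebra"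
  shows "unz (a + b) = unz a + unz b" "unz (a - b) = unz a - unz b" "unz (a * b) = unz a * unz b"
    "unz (r *\<^sub>R a) = r *\<^sub>R unz a" "unz (z *\<^sub>C a) = z *\<^sub>C unz a" "unz (star a) = star (unz a)" "unz 0 = 0"
  by (simp_all add: unitization.expand scaleC_unitization_def star_unitization_def)

lemma unz_sum: "unz (\<Sum>i\<in>I. f i) = (\<Sum>i\<in>I. unz (f i))"
  by (induction I rule: infinite_finite_induct) (simp_all add: unz_simps)

text \<open>If d^2 = \<open>unz a\<close>, then the scalar part of d squares to zero, so the root
  already lies in the algebra. This is how every positivity proof returns from the
  unitization.\<close>

lemma cstar_nonneg_unz_iff [simp]:
  "cstar_nonneg (unz a) \<longleftrightarrow> cstar_nonneg (a::'a::comm_cstar_algebra)"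
proof
  assume "cstar_nonneg (unz a)"
  then obtain d where d: "star d = d" "d * d = unz a" using cstar_nonneg_sqrt by metis
  then have "scalar_part d * scalar_part d = 0" by (metis unitization.sel(2) unz_parts(12))
  then have "d = unz (alg_part d)" by (simp add: unitization.expand)
  then have "star (unz (alg_part d)) * unz (alg_part d) = unz a" using d by simp
  then have "unz (star (alg_part d) * alg_part d) = unz a" by (simp only: unz_simps)
  then show "cstar_nonneg a" by (metis cstar_nonneg_star_mult unitization.inject)
qed (metis cstar_nonneg_def unz_simps(3) unz_simps(6))

lemma cstar_nonneg_add:
  "cstar_nonneg a \<Longrightarrow> cstar_nonneg b \<Longrightarrow> cstar_nonneg (a + b :: 'a::comm_cstar_algebra)"
  using cstar_nonneg_add_unital[of "unz a" "unz b"] by (simp flip: unz_simps)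

lemma norm_mono_cstar:
  fixes a b :: "'a::comm_cstar_algebra"
  assumes "cstar_nonneg a" "cstar_nonneg (b - a)"
  shows "norm a \<le> norm b"
  using norm_mono_unital[of "unz a" "unz b"] assms by (simp add: norm_Unz_alg flip: unz_simps)

lemma bounded_linear_unz: "bounded_linear (unz :: 'a::comm_cstar_algebra \<Rightarrow> _)"
  by (rule bounded_linear_intro[where K = 1]) (auto simp: unz_simps norm_Unz_alg)

lemma cstar_nonneg_LIMSEQ:
  fixes X :: "nat \<Rightarrow> 'a::comm_cstar_algebra"
  assumes "X \<longlonglongrightarrow> a" "\<And>n. cstar_nonneg (X n)"
  shows "cstar_nonneg a"
  using cstar_nonneg_LIMSEQ_unital[OF bounded_linear.tendsto[OF bounded_linear_unz assms(1)]] assms(2)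
  by simp

text \<open>In the unitization this is the product of the positive elements b^* b and norm p - p;
  its scalar part is zero.\<close>

lemma cstar_nonneg_norm_bound:
  fixes p b :: "'a::comm_cstar_algebra"
  assumes "star p = p"
  shows "cstar_nonneg (norm p *\<^sub>R (star b * b) - star b * b * p)"
proof -
  have "cstar_nonneg (star (unz b) * unz b * (norm (unz p) *\<^sub>R 1 - unz p))"
    using cstar_nonneg_norm_minus_selfadjoint[of "unz p"] assms
    by (intro cstar_nonneg_mult cstar_nonneg_star_mult) (simp flip: unz_simps)
  then have "cstar_nonneg (unz (norm p *\<^sub>R (star b * b) - star b * b * p))"
    by (simp add: right_diff_distrib norm_Unz_alg unz_simps)
  then show ?thesis by (simp only: cstar_nonneg_unz_iff)
qed

section \<open>Schur products of positive matrices\<close>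

text \<open>The test coefficients run over the algebra and not only over the complex numbers,
  because the elimination below substitutes algebra elements such as
  \<open>- (g * s)\<close>.\<close>

definition psd :: "'i set \<Rightarrow> ('i \<Rightarrow> 'i \<Rightarrow> 'a::cstar_algebra) \<Rightarrow> bool" where
  "psd I P \<longleftrightarrow> (\<forall>i\<in>I. \<forall>j\<in>I. star (P i j) = P j i) \<and>
     (\<forall>a. cstar_nonneg (\<Sum>i\<in>I. \<Sum>j\<in>I. star (a i) * P i j * a j))"

lemma sum_sum_insert:
  fixes f :: "'i \<Rightarrow> 'i \<Rightarrow> 'a::comm_monoid_add"
  assumes "finite I" "k \<notin> I"
  shows "(\<Sum>i\<in>insert k I. \<Sum>j\<in>insert k I. f i j)
    = (\<Sum>i\<in>I. \<Sum>j\<in>I. f i j) + ((\<Sum>j\<in>I. f k j) + (\<Sum>i\<in>I. f i k) + f k k)"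
  using assms by (simp add: sum.distrib algebra_simps)

text \<open>Gaussian elimination: the Schur complement of the pivot of a matrix bounded below by \<open>\<delta>\<close> is
  again bounded below by \<open>\<delta>\<close>, and the remaining rank one term is handled by positivity of \<open>Q\<close>.\<close>

lemma schur_product_nonneg_strict:
  fixes P Q :: "'i \<Rightarrow> 'i \<Rightarrow> 'a::unital_comm_cstar_algebra"
  assumes "finite I" "0 < \<delta>"
    and "psd I (\<lambda>i j. P i j - (if i = j then \<delta> *\<^sub>R 1 else 0))" "psd I Q"
  shows "cstar_nonneg (\<Sum>i\<in>I. \<Sum>j\<in>I. P i j * Q i j)"
  using assms
proof (induction I arbitrary: P rule: finite_induct)
  case empty
  then show ?case by simp
next
  case (insert k I)
  define D where "D i j = (if i = j then \<delta> *\<^sub>R (1::'a) else 0)" for i j :: 'i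
  have P: "psd (insert k I) (\<lambda>i j. P i j - D i j)" using insert.prems D_def by simp
  have sym: "star (P i j) = P j i" if "i \<in> insert k I" "j \<in> insert k I" for i j
  proof -
    have "star (P i j - D i j) = P j i - D j i" using P that unfolding psd_def by blast
    then show ?thesis by (simp add: star_diff D_def star_scaleR split: if_splits)
  qed
  have pos: "cstar_nonneg (\<Sum>i\<in>insert k I. \<Sum>j\<in>insert k I. star (a i) * (P i j - D i j) * a j)" for a
    using P unfolding psd_def by blast
  define p where "p = P k k"
  \<comment> \<open>The unit vector at \<open>k\<close> as test coefficients: the pivot is at least
    \<delta>, hence invertible.\<close>
  have "cstar_nonneg (p - \<delta> *\<^sub>R 1)"
    using pos[of "\<lambda>i. if i = k then 1 else 0"] insert.hyps
    by (simp add: sum_sum_insert if_distrib[of star] if_distrib[of "\<lambda>x. x * _"] if_distrib[of "\<lambda>x. _ * x"]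
        p_def D_def cong: if_cong)
  then obtain g where g: "cstar_nonneg g" "g * p = 1"
    using cstar_inverse_exists insert.prems by metis
  have sg: "star g = g" using g cstar_nonneg_star by blast
  define P' where "P' i j = P i j - g * P i k * P k j" for i j
  have "psd I (\<lambda>i j. P' i j - D i j)"
    unfolding psd_def
  proof (intro conjI ballI allI)
    fix i j assume "i \<in> I" "j \<in> I"
    then show "star (P' i j - D i j) = P' j i - D j i"
      by (simp add: P'_def D_def star_diff star_mult sym sg star_scaleR mult_ac)
  next
    fix a
    define s where "s = (\<Sum>j\<in>I. P k j * a j)"
    \<comment> \<open>The coordinate at \<open>k\<close> that minimizes the form of \<open>P\<close>
      when the others are given by \<open>a\<close>, as in completing the square.\<close>
    define t where "t = - (g * s)"
    define b where "b i = (if i = k then t else a i)" for i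
    have st: "star s = (\<Sum>i\<in>I. star (a i) * P i k)"
      unfolding s_def star_sum by (rule sum.cong) (auto simp: star_mult sym)
    have E1: "(\<Sum>j\<in>I. star (b k) * (P k j - D k j) * b j) = star t * s"
      unfolding s_def sum_distrib_left
      by (rule sum.cong) (use insert.hyps in \<open>auto simp: b_def D_def mult_ac\<close>)
    have E2: "(\<Sum>i\<in>I. star (b i) * (P i k - D i k) * b k) = star s * t"
      unfolding st sum_distrib_right
      by (rule sum.cong) (use insert.hyps in \<open>auto simp: b_def D_def mult_ac\<close>)
    have E3: "(\<Sum>i\<in>I. \<Sum>j\<in>I. star (b i) * (P i j - D i j) * b j)
        = (\<Sum>i\<in>I. \<Sum>j\<in>I. star (a i) * (P i j - D i j) * a j)"
      using insert.hyps by (intro sum.cong refl) (auto simp: b_def)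
    have F: "cstar_nonneg ((\<Sum>i\<in>I. \<Sum>j\<in>I. star (a i) * (P i j - D i j) * a j)
       + (star t * s + star s * t + star t * (p - \<delta> *\<^sub>R 1) * t))"
      using pos[of b] unfolding sum_sum_insert[OF insert.hyps] E1 E2 E3 by (simp add: b_def p_def D_def)
    have e: "star t * s + star s * t + star t * (p - \<delta> *\<^sub>R 1) * t = - (g * (star s * s)) - \<delta> *\<^sub>R (star t * t)"
    proof -
      have "star t * p * t = (g * p) * (g * (star s * s))" by (simp add: t_def star_mult sg mult_ac)
      then have "star t * p * t = g * (star s * s)" by (simp add: g)
      then have "star t * (p - \<delta> *\<^sub>R 1) * t = g * (star s * s) - \<delta> *\<^sub>R (star t * t)"
        by (simp add: algebra_simps)
      moreover have "star t * s = - (g * (star s * s))" "star s * t = - (g * (star s * s))"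
        by (simp_all add: t_def star_mult sg mult_ac)
      ultimately show ?thesis by simp
    qed
    have "(\<Sum>i\<in>I. \<Sum>j\<in>I. star (a i) * (P' i j - D i j) * a j)
        = (\<Sum>i\<in>I. \<Sum>j\<in>I. star (a i) * (P i j - D i j) * a j) - (\<Sum>i\<in>I. \<Sum>j\<in>I. g * ((star (a i) * P i k) * (P k j * a j)))"
      by (simp add: P'_def algebra_simps sum_subtractf sum.distrib)
    also have "(\<Sum>i\<in>I. \<Sum>j\<in>I. g * ((star (a i) * P i k) * (P k j * a j))) = g * (star s * s)"
      unfolding st unfolding s_def unfolding sum_product unfolding sum_distrib_left ..
    finally have eqS: "(\<Sum>i\<in>I. \<Sum>j\<in>I. star (a i) * (P' i j - D i j) * a j)
      = (\<Sum>i\<in>I. \<Sum>j\<in>I. star (a i) * (P i j - D i j) * a j) - g * (star s * s)" .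
    have cancel: "x + (- y - z) + z = x - y" for x y z :: 'a by simp
    \<comment> \<open>At the minimizer, subtracting \<open>D\<close> costs \<delta> t^* t in the
      coordinate \<open>k\<close>. This is positive and may be added back, which leaves exactly the
      form of the Schur complement.\<close>
    have "cstar_nonneg (\<delta> *\<^sub>R (star t * t))"
      using insert.prems by (intro cstar_nonneg_scaleR cstar_nonneg_star_mult) simp
    from cstar_nonneg_add[OF F[unfolded e] this, unfolded cancel]
    show "cstar_nonneg (\<Sum>i\<in>I. \<Sum>j\<in>I. star (a i) * (P' i j - D i j) * a j)"
      unfolding eqS .
  qed
  moreover have "psd I Q"
    unfolding psd_def
  proof (intro conjI ballI allI)
    fix a
    have "cstar_nonneg (\<Sum>i\<in>insert k I. \<Sum>j\<in>insert k I.
        star ((if i = k then 0 else a i)) * Q i j * (if j = k then 0 else a j))"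
      using insert.prems(3)[unfolded psd_def]
      by (auto dest: spec[of _ "\<lambda>i. if i = k then 0 else a i"])
    moreover have "(\<Sum>i\<in>insert k I. \<Sum>j\<in>insert k I.
        star ((if i = k then 0 else a i)) * Q i j * (if j = k then 0 else a j))
        = (\<Sum>i\<in>I. \<Sum>j\<in>I. star (a i) * Q i j * a j)"
      using insert.hyps by (simp add: sum_sum_insert) (intro sum.cong refl, auto)
    ultimately show "cstar_nonneg (\<Sum>i\<in>I. \<Sum>j\<in>I. star (a i) * Q i j * a j)" by simp
  qed (use insert.prems(3) in \<open>auto simp: psd_def\<close>)
  ultimately have 1: "cstar_nonneg (\<Sum>i\<in>I. \<Sum>j\<in>I. P' i j * Q i j)"
    using insert.IH[of P'] insert.prems(1) by (simp add: D_def)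
  \<comment> \<open>The part removed from \<open>P\<close> has entries
    \<open>g * P i k * P k j\<close>. Its entrywise product with \<open>Q\<close> sums to g times
    the form of \<open>Q\<close> at the vector \<open>P k j\<close>; in row and column
    \<open>k\<close> the relation g p = 1 gives back the entries of \<open>P\<close>.\<close>
  have "cstar_nonneg (\<Sum>i\<in>insert k I. \<Sum>j\<in>insert k I. star (P k i) * Q i j * P k j)"
    using insert.prems(3) unfolding psd_def by blast
  then have 2: "cstar_nonneg (g * (\<Sum>i\<in>insert k I. \<Sum>j\<in>insert k I. star (P k i) * Q i j * P k j))"
    using g cstar_nonneg_mult by blast
  have "g * (\<Sum>i\<in>insert k I. \<Sum>j\<in>insert k I. star (P k i) * Q i j * P k j)
      = (\<Sum>i\<in>insert k I. \<Sum>j\<in>insert k I. g * (P i k * Q i j * P k j))"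
    unfolding sum_distrib_left by (intro sum.cong refl) (simp add: sym)
  also have "\<dots> = (\<Sum>i\<in>I. \<Sum>j\<in>I. g * (P i k * Q i j * P k j)) +
      ((\<Sum>j\<in>I. P k j * Q k j) + (\<Sum>i\<in>I. P i k * Q i k) + P k k * Q k k)"
  proof -
    have gp: "g * P k k = 1" using g by (simp add: p_def)
    have "g * (P k k * x * y) = y * x" for x y
      using gp by (metis mult.assoc mult.commute mult.left_neutral)
    moreover have "g * (x * y * P k k) = x * y" for x y
      using gp by (metis mult.assoc mult.commute mult.left_neutral)
    ultimately show ?thesis by (simp only: sum_sum_insert[OF insert.hyps])
  qed
  finally have "(\<Sum>i\<in>insert k I. \<Sum>j\<in>insert k I. P i j * Q i j)
     = (\<Sum>i\<in>I. \<Sum>j\<in>I. P' i j * Q i j) + g * (\<Sum>i\<in>insert k I. \<Sum>j\<in>insert k I. star (P k i) * Q i j * P k j)"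
    using insert.hyps by (simp only: sum_sum_insert) (simp add: P'_def algebra_simps sum_subtractf sum.distrib)
  then show ?case using cstar_nonneg_add[OF 1 2] by simp
qed

text \<open>Adding \<epsilon> to the diagonal of \<open>P\<close> makes the pivots invertible; the
  cone is closed, so \<epsilon> can tend to 0.\<close>

lemma schur_product_nonneg:
  fixes P Q :: "'i \<Rightarrow> 'i \<Rightarrow> 'a::unital_comm_cstar_algebra"
  assumes I: "finite I" and P: "psd I P" and Q: "psd I Q"
  shows "cstar_nonneg (\<Sum>i\<in>I. \<Sum>j\<in>I. P i j * Q i j)"
proof (rule cstar_nonneg_LIMSEQ)
  define \<epsilon> where "\<epsilon> n = inverse (real (Suc n))" for n
  define X where "X n = (\<Sum>i\<in>I. \<Sum>j\<in>I. (P i j + (if i = j then \<epsilon> n *\<^sub>R 1 else 0)) * Q i j)" for n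
  show "cstar_nonneg (X n)" for n
    unfolding X_def
    by (rule schur_product_nonneg_strict[OF I, of "\<epsilon> n"]) (use P Q in \<open>auto simp: \<epsilon>_def cong: if_cong\<close>)
  have eq: "X n = (\<Sum>i\<in>I. \<Sum>j\<in>I. P i j * Q i j) + \<epsilon> n *\<^sub>R (\<Sum>i\<in>I. Q i i)" for n
  proof -
    have "X n = (\<Sum>i\<in>I. (\<Sum>j\<in>I. P i j * Q i j) + (\<Sum>j\<in>I. if i = j then \<epsilon> n *\<^sub>R Q i j else 0))"
      unfolding X_def by (intro sum.cong refl) (auto simp: distrib_right sum.distrib[symmetric] intro!: sum.cong)
    then show ?thesis using I by (simp add: sum.distrib scaleR_sum_right)
  qed
  show "X \<longlonglongrightarrow> (\<Sum>i\<in>I. \<Sum>j\<in>I. P i j * Q i j)"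
    unfolding eq \<epsilon>_def
    using tendsto_add[OF tendsto_const tendsto_scaleR[OF LIMSEQ_inverse_real_of_nat tendsto_const]] by force
qed

section \<open>Semi-inner-product modules\<close>

text \<open>The linear structure is only required to be respected by the inner product.\<close>

locale pre_hilbert =
  fixes H :: "('c::comm_cstar_algebra, 'u) hmod"
  assumes zero_in: "zero H \<in> carrier H"
    and add_in: "\<lbrakk>x \<in> carrier H; y \<in> carrier H\<rbrakk> \<Longrightarrow> add H x y \<in> carrier H"
    and csc_in: "x \<in> carrier H \<Longrightarrow> csc H z x \<in> carrier H"
    and act_in: "x \<in> carrier H \<Longrightarrow> act H x a \<in> carrier H"
    and inner_zero_right: "x \<in> carrier H \<Longrightarrow> inner H x (zero H) = 0"
    and inner_add_right: "\<lbrakk>x \<in> carrier H; y \<in> carrier H; v \<in> carrier H\<rbrakk>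
          \<Longrightarrow> inner H x (add H y v) = inner H x y + inner H x v"
    and inner_csc_right: "\<lbrakk>x \<in> carrier H; y \<in> carrier H\<rbrakk>
          \<Longrightarrow> inner H x (csc H z y) = z *\<^sub>C inner H x y"
    and inner_act_right: "\<lbrakk>x \<in> carrier H; y \<in> carrier H\<rbrakk>
          \<Longrightarrow> inner H x (act H y a) = inner H x y * a"
    and inner_conj: "\<lbrakk>x \<in> carrier H; y \<in> carrier H\<rbrakk> \<Longrightarrow> star (inner H x y) = inner H y x"
    and inner_self_nonneg: "x \<in> carrier H \<Longrightarrow> cstar_nonneg (inner H x x)"

lemma hilbert_pre_hilbert:
  fixes E :: "('c::comm_cstar_algebra, 'u) hmod"
  assumes "hilbert_module E"
  shows "pre_hilbert E"
proof -
  interpret hilbert_module E by fact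
  have "inner E x (zero E) = 0" if "x \<in> carrier E" for x
  proof -
    have "inner E x (add E (zero E) (zero E)) = inner E x (zero E) + inner E x (zero E)"
      using that by (intro inner_add zero_closed)
    then show ?thesis by (simp add: add_zero zero_closed)
  qed
  then show ?thesis
    by unfold_locales (auto intro: zero_closed add_closed csc_closed act_closed inner_add inner_csc
        inner_act inner_star inner_nonneg)
qed

definition hdist :: "('c::cstar_algebra, 'u) hmod \<Rightarrow> 'u \<Rightarrow> 'u \<Rightarrow> real" where
  "hdist H x y = hnorm H (hdiff H x y)"

section \<open>The seminorm and the Cauchy-Schwarz inequality\<close>

context pre_hilbert
begin

lemma hdiff_in: "x \<in> carrier H \<Longrightarrow> y \<in> carrier H \<Longrightarrow> hdiff H x y \<in> carrier H"
  by (simp add: hdiff_def add_in csc_in)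

lemmas in_simps [simp] = zero_in add_in csc_in act_in hdiff_in

lemma inner_left:
  "x \<in> carrier H \<Longrightarrow> y \<in> carrier H \<Longrightarrow> v \<in> carrier H \<Longrightarrow> inner H (add H x y) v = inner H x v + inner H y v"
  "x \<in> carrier H \<Longrightarrow> v \<in> carrier H \<Longrightarrow> inner H (csc H z x) v = cnj z *\<^sub>C inner H x v"
  "x \<in> carrier H \<Longrightarrow> v \<in> carrier H \<Longrightarrow> inner H (act H x a) v = star a * inner H x v"
  "v \<in> carrier H \<Longrightarrow> inner H (zero H) v = 0"
  by (simp_all flip: inner_conj[of v] add: inner_add_right inner_csc_right inner_act_right
      inner_zero_right star_add star_scaleC star_mult)

lemma inner_hdiff:
  assumes "x \<in> carrier H" "y \<in> carrier H" "v \<in> carrier H"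
  shows "inner H (hdiff H x y) v = inner H x v - inner H y v"
    "inner H v (hdiff H x y) = inner H v x - inner H v y"
  using assms by (simp_all add: hdiff_def inner_left inner_add_right inner_csc_right)

lemmas inner_simps = inner_left inner_hdiff inner_add_right inner_csc_right inner_act_right inner_zero_right

lemma hnorm_nonneg [simp]: "0 \<le> hnorm H x"
  by (simp add: hnorm_def)

lemma hdist_nonneg [simp]: "0 \<le> hdist H x y"
  by (simp add: hdist_def)

lemma hnorm_square: "(hnorm H x)\<^sup>2 = norm (inner H x x)"
  by (simp add: hnorm_def)

text \<open>With q = <x|y>, positivity of <v|v> for v = t x q - y, together with q^* q p \<le> P q^*
  q, gives (2 t - t^2 P) q^* q \<le> r. The choice t = 1 / P is optimal; for P = 0 one lets t
  grow.\<close>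

lemma cauchy_schwarz:
  assumes x: "x \<in> carrier H" and y: "y \<in> carrier H"
  shows "norm (inner H x y) \<le> hnorm H x * hnorm H y"
proof -
  define q p r where "q = inner H x y" and "p = inner H x x" and "r = inner H y y"
  define P where "P = norm p"
  have key: "(2 * t - t\<^sup>2 * P) * (norm q)\<^sup>2 \<le> norm r" if "0 \<le> t" "0 \<le> 2 * t - t\<^sup>2 * P" for t
  proof -
    define w where "w = act H x q"
    have w: "w \<in> carrier H" using x by (simp add: w_def)
    have ww: "inner H w w = star q * q * p" "inner H w y = star q * q" "inner H y w = star q * q"
      using x y inner_conj[OF x y] by (simp_all add: w_def inner_simps p_def q_def mult_ac)
    define v where "v = hdiff H (csc H (of_real t) w) y"
    have v: "v \<in> carrier H" using w y by (simp add: v_def)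
    have "inner H v v = t *\<^sub>R t *\<^sub>R (star q * q * p) - t *\<^sub>R (star q * q) - (t *\<^sub>R (star q * q) - r)"
      using w y unfolding v_def by (simp add: inner_simps ww r_def scaleC_of_real scaleR_diff_right)
    also have "\<dots> = t\<^sup>2 *\<^sub>R (star q * q * p) - (2 * t) *\<^sub>R (star q * q) + r"
      unfolding mult_2 scaleR_left_distrib by (simp add: power2_eq_square)
    finally have "inner H v v = t\<^sup>2 *\<^sub>R (star q * q * p) - (2 * t) *\<^sub>R (star q * q) + r" .
    then have "cstar_nonneg (t\<^sup>2 *\<^sub>R (star q * q * p) - (2 * t) *\<^sub>R (star q * q) + r)"
      using inner_self_nonneg[OF v] by simp
    moreover have "cstar_nonneg (t\<^sup>2 *\<^sub>R (P *\<^sub>R (star q * q) - star q * q * p))"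
      unfolding P_def using x by (intro cstar_nonneg_scaleR cstar_nonneg_norm_bound) (auto simp: p_def inner_conj)
    ultimately have "cstar_nonneg (t\<^sup>2 *\<^sub>R (star q * q * p) - (2 * t) *\<^sub>R (star q * q) + r
        + t\<^sup>2 *\<^sub>R (P *\<^sub>R (star q * q) - star q * q * p))"
      by (rule cstar_nonneg_add)
    then have "cstar_nonneg (r - (2 * t - t\<^sup>2 * P) *\<^sub>R (star q * q))"
      by (simp add: scaleR_diff_right scaleR_diff_left algebra_simps)
    moreover have "cstar_nonneg ((2 * t - t\<^sup>2 * P) *\<^sub>R (star q * q))"
      using that by (intro cstar_nonneg_scaleR cstar_nonneg_star_mult)
    ultimately have "norm ((2 * t - t\<^sup>2 * P) *\<^sub>R (star q * q)) \<le> norm r"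
      using norm_mono_cstar by blast
    then show ?thesis using that by (simp add: cstar_identity)
  qed
  have "(norm q)\<^sup>2 \<le> P * norm r"
  proof (cases "P = 0")
    case True
    have "(norm q)\<^sup>2 = 0"
    proof (rule ccontr)
      assume "(norm q)\<^sup>2 \<noteq> 0"
      then have "(norm q)\<^sup>2 > 0" by simp
      \<comment> \<open>For P = 0 the left side of \<open>key\<close> is linear in t, and this t
        raises it to 2 (norm r + 1).\<close>
      moreover have "2 * ((norm r + 1) / (norm q)\<^sup>2) * (norm q)\<^sup>2 \<le> norm r"
        using key[of "(norm r + 1) / (norm q)\<^sup>2"] True by simp
      ultimately show False using norm_ge_zero[of r] by simp
    qed
    then show ?thesis using True by simp
  next
    case False
    then have "P > 0" by (simp add: P_def)
    then have "2 * (1 / P) - (1 / P)\<^sup>2 * P = 1 / P" by (simp add: power2_eq_square)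
    then have "1 / P * (norm q)\<^sup>2 \<le> norm r" using key[of "1 / P"] \<open>P > 0\<close> by simp
    then show ?thesis using \<open>P > 0\<close> by (simp add: field_simps)
  qed
  also have "\<dots> = (hnorm H x * hnorm H y)\<^sup>2"
    by (simp add: power_mult_distrib hnorm_square P_def p_def r_def)
  finally show ?thesis
    unfolding q_def by (rule power2_le_imp_le) simp
qed

lemma hnorm_add_le:
  assumes "x \<in> carrier H" "y \<in> carrier H"
  shows "hnorm H (add H x y) \<le> hnorm H x + hnorm H y"
proof (rule power2_le_imp_le)
  have "(hnorm H (add H x y))\<^sup>2 = norm ((inner H x x + inner H x y) + (inner H y x + inner H y y))"
    using assms by (simp add: hnorm_square inner_simps algebra_simps)
  also have "\<dots> \<le> (norm (inner H x x) + norm (inner H x y)) + (norm (inner H y x) + norm (inner H y y))"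
    by (intro norm_triangle_le add_mono order_refl)
  also have "\<dots> \<le> ((hnorm H x)\<^sup>2 + hnorm H x * hnorm H y) + (hnorm H y * hnorm H x + (hnorm H y)\<^sup>2)"
    unfolding hnorm_square by (intro add_mono cauchy_schwarz order_refl assms)
  finally show "(hnorm H (add H x y))\<^sup>2 \<le> (hnorm H x + hnorm H y)\<^sup>2"
    by (simp add: power2_sum algebra_simps)
qed simp

lemma hnorm_csc: "x \<in> carrier H \<Longrightarrow> hnorm H (csc H z x) = cmod z * hnorm H x"
  by (simp add: hnorm_def inner_simps norm_scaleC real_sqrt_mult mult.assoc[symmetric] scaleC_scaleC norm_mult)

lemma hnorm_zero [simp]: "hnorm H (zero H) = 0"
  by (simp add: hnorm_def inner_simps)

lemma hnorm_act_le: 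
  assumes "x \<in> carrier H"
  shows "hnorm H (act H x a) \<le> hnorm H x * norm a"
proof (rule power2_le_imp_le)
  have "(hnorm H (act H x a))\<^sup>2 = norm (inner H x x * (star a * a))"
    using assms by (simp add: hnorm_square inner_simps mult_ac)
  also have "\<dots> \<le> norm (inner H x x) * norm (star a * a)"
    by (rule norm_mult_ineq)
  finally show "(hnorm H (act H x a))\<^sup>2 \<le> (hnorm H x * norm a)\<^sup>2"
    by (simp add: hnorm_square cstar_identity power_mult_distrib)
qed simp

lemma hdist_self [simp]: "x \<in> carrier H \<Longrightarrow> hdist H x x = 0"
  by (simp add: hdist_def hnorm_def inner_simps)

lemma hdist_zero: "x \<in> carrier H \<Longrightarrow> hdist H x (zero H) = hnorm H x"
  by (simp add: hdist_def hnorm_def inner_simps)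

lemma hdist_commute: "x \<in> carrier H \<Longrightarrow> y \<in> carrier H \<Longrightarrow> hdist H x y = hdist H y x"
  by (simp add: hdist_def hnorm_def inner_simps algebra_simps)

lemma hdist_triangle:
  assumes "x \<in> carrier H" "y \<in> carrier H" "v \<in> carrier H"
  shows "hdist H x v \<le> hdist H x y + hdist H y v"
proof -
  have "hdist H x v = hnorm H (add H (hdiff H x y) (hdiff H y v))"
    using assms by (simp add: hdist_def hnorm_def inner_simps algebra_simps)
  also have "\<dots> \<le> hdist H x y + hdist H y v"
    unfolding hdist_def using assms by (intro hnorm_add_le) simp_all
  finally show ?thesis .
qed

lemma hdist_add_le:
  assumes "x \<in> carrier H" "y \<in> carrier H" "x' \<in> carrier H" "y' \<in> carrier H"
  shows "hdist H (add H x y) (add H x' y') \<le> hdist H x x' + hdist H y y'"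
proof -
  have "hdist H (add H x y) (add H x' y') = hnorm H (add H (hdiff H x x') (hdiff H y y'))"
    using assms by (simp add: hdist_def hnorm_def inner_simps algebra_simps)
  also have "\<dots> \<le> hdist H x x' + hdist H y y'"
    unfolding hdist_def using assms by (intro hnorm_add_le) simp_all
  finally show ?thesis .
qed

lemma hdist_csc:
  assumes "x \<in> carrier H" "y \<in> carrier H"
  shows "hdist H (csc H z x) (csc H z y) = cmod z * hdist H x y"
proof -
  have "hdist H (csc H z x) (csc H z y) = hnorm H (csc H z (hdiff H x y))"
    using assms by (simp add: hdist_def hnorm_def inner_simps scaleC_diff_right)
  then show ?thesis using assms by (simp add: hnorm_csc hdist_def)
qed

lemma hdist_act_le:
  assumes "x \<in> carrier H" "y \<in> carrier H"
  shows "hdist H (act H x a) (act H y a) \<le> hdist H x y * norm a"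
proof -
  have "hdist H (act H x a) (act H y a) = hnorm H (act H (hdiff H x y) a)"
    using assms by (simp add: hdist_def hnorm_def inner_simps algebra_simps)
  then show ?thesis using assms hnorm_act_le[of "hdiff H x y" a] by (simp add: hdist_def)
qed

lemma norm_inner_diff_le:
  assumes "x \<in> carrier H" "y \<in> carrier H" "x' \<in> carrier H" "y' \<in> carrier H"
  shows "norm (inner H x y - inner H x' y') \<le> hdist H x x' * hnorm H y + hnorm H x' * hdist H y y'"
proof -
  have "inner H x y - inner H x' y' = inner H (hdiff H x x') y + inner H x' (hdiff H y y')"
    using assms by (simp add: inner_simps)
  also have "norm \<dots> \<le> norm (inner H (hdiff H x x') y) + norm (inner H x' (hdiff H y y'))"
    by (rule norm_triangle_ineq)
  also have "\<dots> \<le> hdist H x x' * hnorm H y + hnorm H x' * hdist H y y'"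
    unfolding hdist_def using assms by (intro add_mono cauchy_schwarz) simp_all
  finally show ?thesis .
qed

lemma hdist_eq_0_iff:
  assumes "x \<in> carrier H" "y \<in> carrier H"
  shows "hdist H x y = 0 \<longleftrightarrow> (\<forall>v\<in>carrier H. inner H v x = inner H v y)"
proof
  assume 0: "hdist H x y = 0"
  show "\<forall>v\<in>carrier H. inner H v x = inner H v y"
  proof
    fix v assume "v \<in> carrier H"
    then show "inner H v x = inner H v y"
      using norm_inner_diff_le[of v x v y] assms 0 by simp
  qed
next
  assume "\<forall>v\<in>carrier H. inner H v x = inner H v y"
  then show "hdist H x y = 0" using assms by (simp add: hdist_def hnorm_def inner_simps)
qed

lemma abs_hnorm_diff_le:
  assumes "x \<in> carrier H" "y \<in> carrier H"
  shows "\<bar>hnorm H x - hnorm H y\<bar> \<le> hdist H x y"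
  using hdist_triangle[of x y "zero H"] hdist_triangle[of y x "zero H"] hdist_commute[of x y] assms
  by (simp add: hdist_zero)

text \<open>The two sides of each module axiom have equal inner products with every vector, hence
  distance zero. Separation turns this into equality, so the axioms never have to be checked on
  representatives.\<close>

lemma separated_complete_hilbert:
  assumes sep: "\<And>x y. x \<in> carrier H \<Longrightarrow> y \<in> carrier H \<Longrightarrow> hdist H x y = 0 \<Longrightarrow> x = y"
    and comp: "\<And>s. hCauchy H s \<Longrightarrow> \<exists>x\<in>carrier H. (\<lambda>n. hdist H (s n) x) \<longlonglongrightarrow> 0"
  shows "hilbert_module H"
proof -
  have eqI: "x = y" if "x \<in> carrier H" "y \<in> carrier H" "\<And>v. v \<in> carrier H \<Longrightarrow> inner H v x = inner H v y" for x y
    using that by (intro sep) (simp_all add: hdist_eq_0_iff)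
  show ?thesis
  proof
    show "inner H x x = 0 \<longleftrightarrow> x = zero H" if "x \<in> carrier H" for x
    proof
      assume "inner H x x = 0"
      then have "hdist H x (zero H) = 0" using that by (simp add: hdist_zero) (simp add: hnorm_def)
      then show "x = zero H" using that by (intro sep) simp_all
    qed (use that in \<open>simp add: inner_simps\<close>)
    show "\<exists>x\<in>carrier H. (\<lambda>n. hnorm H (hdiff H (s n) x)) \<longlonglongrightarrow> 0" if "hCauchy H s" for s
      using comp[OF that] by (simp add: hdist_def)
  qed (simp_all add: inner_conj inner_self_nonneg inner_add_right inner_csc_right inner_act_right,
      (rule eqI; simp add: inner_simps algebra_simps scaleC_add_right scaleC_add_left scaleC_scaleC
        mult_scaleC_left mult_scaleC_right)+)
qed

end

lemma hilbert_eqI: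
  fixes E :: "('c::comm_cstar_algebra, 'u) hmod"
  assumes E: "hilbert_module E" and xy: "x \<in> carrier E" "y \<in> carrier E" and "hdist E x y = 0"
  shows "x = y"
proof -
  interpret pre_hilbert E using E by (rule hilbert_pre_hilbert)
  have "hdiff E x y = zero E"
    using assms hilbert_module.inner_eq_zero[OF E, of "hdiff E x y"] by (simp add: hdist_def hnorm_def)
  then have "add E (hdiff E x y) y = add E (zero E) y" by simp
  moreover have "add E (hdiff E x y) y = x"
  proof -
    have "add E (csc E (-1) y) y = zero E"
      using hilbert_module.hdiff_self[OF E xy(2)] hilbert_module.add_commute[OF E, of y "csc E (-1) y"] xy
      by (simp add: hdiff_def)
    then show ?thesis
      using hilbert_module.add_assoc[OF E, of x "csc E (-1) y" y] xy hilbert_module.add_zero[OF E]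
      by (simp add: hdiff_def)
  qed
  moreover have "add E (zero E) y = y"
    using hilbert_module.add_commute[OF E, of "zero E" y] hilbert_module.add_zero[OF E] xy by simp
  ultimately show ?thesis by simp
qed

lemma hilbert_inner_eqI:
  fixes E :: "('c::comm_cstar_algebra, 'u) hmod"
  assumes "hilbert_module E" "x \<in> carrier E" "y \<in> carrier E"
    "\<And>v. v \<in> carrier E \<Longrightarrow> inner E v x = inner E v y"
  shows "x = y"
  using assms by (intro hilbert_eqI[of E]) (auto simp: pre_hilbert.hdist_eq_0_iff[OF hilbert_pre_hilbert])

section \<open>Completion\<close>

lemma rep_quotient:
  assumes "equiv A R" "X \<in> A // R"
  shows "rep X \<in> A" "R `` {rep X} = X"
proof -
  obtain a where a: "a \<in> A" "X = R `` {a}" using assms(2) by (auto elim: quotientE)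
  then have "a \<in> X" using assms(1) equiv_class_self by fast
  then have "rep X \<in> X" unfolding rep_def by (rule someI)
  then have aR: "(a, rep X) \<in> R" using a by simp
  then show "rep X \<in> A" using equiv_type[OF assms(1)] by blast
  show "R `` {rep X} = X" using equiv_class_eq[OF assms(1) aR] a(2) by simp
qed

lemma rep_class_rel:
  assumes "equiv A R" "a \<in> A"
  shows "(rep (R `` {a}), a) \<in> R"
  using rep_quotient[OF assms(1) quotientI[OF assms(2)]] assms eq_equiv_class_iff by fastforce

section \<open>Cauchy sequences and the separated completion\<close>

context pre_hilbert
begin

lemma hCauchy_iff:
  "hCauchy H s \<longleftrightarrow> (\<forall>n. s n \<in> carrier H) \<and> (\<forall>e>0. \<exists>N. \<forall>m\<ge>N. \<forall>n\<ge>N. hdist H (s m) (s n) < e)"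
  by (simp add: hCauchy_def hdist_def)

lemma hCauchy_in: "hCauchy H s \<Longrightarrow> s n \<in> carrier H"
  by (simp add: hCauchy_def)

lemma null_rel_iff:
  "(s, t) \<in> null_rel H \<longleftrightarrow> hCauchy H s \<and> hCauchy H t \<and> (\<lambda>n. hdist H (s n) (t n)) \<longlonglongrightarrow> 0"
  by (simp add: null_rel_def hdist_def)

text \<open>One estimate for all three operations; the unary ones use the same sequence for
  \<open>s\<close> and \<open>t\<close>. Dividing by \<open>\<bar>K\<bar> + 1\<close> keeps
  \<open>d\<close> positive when \<open>K\<close> is zero.\<close>

lemma hCauchy_lipschitz:
  assumes s: "hCauchy H s" and t: "hCauchy H t" and f: "\<And>n. f n \<in> carrier H"
    and le: "\<And>m n. hdist H (f m) (f n) \<le> K * (hdist H (s m) (s n) + hdist H (t m) (t n))"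
  shows "hCauchy H f"
  unfolding hCauchy_iff
proof (intro conjI allI impI)
  fix e :: real assume "e > 0"
  define d where "d = e / (2 * (\<bar>K\<bar> + 1))"
  have d: "d > 0" using \<open>e > 0\<close> by (simp add: d_def)
  obtain M N where MN: "\<forall>m\<ge>M. \<forall>n\<ge>M. hdist H (s m) (s n) < d" "\<forall>m\<ge>N. \<forall>n\<ge>N. hdist H (t m) (t n) < d"
    using s t d unfolding hCauchy_iff by blast
  show "\<exists>N. \<forall>m\<ge>N. \<forall>n\<ge>N. hdist H (f m) (f n) < e"
  proof (intro exI allI impI)
    fix m n assume "max M N \<le> m" "max M N \<le> n"
    then have "hdist H (s m) (s n) + hdist H (t m) (t n) < 2 * d" using MN by fastforce
    moreover have "hdist H (f m) (f n) \<le> (\<bar>K\<bar> + 1) * (hdist H (s m) (s n) + hdist H (t m) (t n))"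
      by (rule order_trans[OF le]) (intro mult_right_mono; simp)
    ultimately have "hdist H (f m) (f n) < (\<bar>K\<bar> + 1) * (2 * d)"
      by (meson abs_ge_zero add_nonneg_pos le_less_trans mult_strict_left_mono zero_less_one)
    moreover have "(\<bar>K\<bar> + 1) * (2 * d) = e"
      unfolding d_def using abs_ge_zero[of K] by (simp add: field_simps)
    ultimately show "hdist H (f m) (f n) < e" by simp
  qed
qed (rule f)

lemma hCauchy_add:
  assumes s: "hCauchy H s" and t: "hCauchy H t"
  shows "hCauchy H (\<lambda>n. add H (s n) (t n))"
  by (rule hCauchy_lipschitz[OF s t, where K = 1]) (simp_all add: hdist_add_le hCauchy_in[OF s] hCauchy_in[OF t])

lemma hCauchy_csc:
  assumes s: "hCauchy H s"
  shows "hCauchy H (\<lambda>n. csc H z (s n))"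
  by (rule hCauchy_lipschitz[OF s s, where K = "cmod z"]) (simp_all add: hdist_csc mult_left_mono hCauchy_in[OF s])

lemma hCauchy_act:
  assumes s: "hCauchy H s"
  shows "hCauchy H (\<lambda>n. act H (s n) a)"
  by (rule hCauchy_lipschitz[OF s s, where K = "norm a"])
     (auto intro!: order_trans[OF hdist_act_le] simp: mult_left_mono mult.commute hCauchy_in[OF s])

lemma hCauchy_const: "x \<in> carrier H \<Longrightarrow> hCauchy H (\<lambda>_. x)"
  by (simp add: hCauchy_iff)

lemma hCauchy_bounded:
  assumes "hCauchy H s"
  obtains K where "0 < K" "\<And>n. hnorm H (s n) \<le> K"
proof -
  have "Cauchy (\<lambda>n. hnorm H (s n))"
  proof (rule metric_CauchyI)
    fix e :: real assume "e > 0"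
    then obtain N where "\<forall>m\<ge>N. \<forall>n\<ge>N. hdist H (s m) (s n) < e" using assms hCauchy_iff by blast
    then show "\<exists>M. \<forall>m\<ge>M. \<forall>n\<ge>M. dist (hnorm H (s m)) (hnorm H (s n)) < e"
      unfolding dist_real_def using abs_hnorm_diff_le hCauchy_in[OF assms] le_less_trans by meson
  qed
  then have "Bseq (\<lambda>n. hnorm H (s n))" by (rule Cauchy_Bseq)
  then show thesis using that by (auto simp: Bseq_def)
qed

lemma inner_diff_tendsto_0:
  assumes "hCauchy H s" "hCauchy H t" "hCauchy H s'" "hCauchy H t'"
    and "(\<lambda>n. hdist H (s n) (s' n)) \<longlonglongrightarrow> 0" "(\<lambda>n. hdist H (t n) (t' n)) \<longlonglongrightarrow> 0"
  shows "(\<lambda>n. inner H (s n) (t n) - inner H (s' n) (t' n)) \<longlonglongrightarrow> 0"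
proof -
  obtain K where K: "\<And>n. hnorm H (t n) \<le> K"
    using hCauchy_bounded[OF assms(2)] by blast
  obtain K' where K': "\<And>n. hnorm H (s' n) \<le> K'"
    using hCauchy_bounded[OF assms(3)] by blast
  have le: "norm (inner H (s n) (t n) - inner H (s' n) (t' n)) \<le> hdist H (s n) (s' n) * K + K' * hdist H (t n) (t' n)" for n
    by (rule order_trans[OF norm_inner_diff_le])
       (use assms K K' in \<open>auto simp: hCauchy_in intro!: add_mono mult_left_mono mult_right_mono\<close>)
  have "(\<lambda>n. hdist H (s n) (s' n) * K + K' * hdist H (t n) (t' n)) \<longlonglongrightarrow> 0 * K + K' * 0"
    using assms by (intro tendsto_intros)
  then show ?thesis
    by (intro Lim_null_comparison[OF always_eventually[OF allI[OF le]]]) simp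
qed

text \<open>Cauchy sequences are bounded, so the inner products are Cauchy in the complete algebra.
  This gives the \<open>lim\<close> in the inner product of the completion its meaning.\<close>

lemma inner_convergent:
  assumes s: "hCauchy H s" and t: "hCauchy H t"
  shows "convergent (\<lambda>n. inner H (s n) (t n))"
proof (rule Cauchy_convergent, rule metric_CauchyI)
  fix e :: real assume "e > 0"
  obtain K where K: "0 < K" "\<And>n. hnorm H (t n) \<le> K"
    using hCauchy_bounded[OF t] by blast
  obtain L where L: "0 < L" "\<And>n. hnorm H (s n) \<le> L"
    using hCauchy_bounded[OF s] by blast
  have "e / (2 * K) > 0" "e / (2 * L) > 0" using \<open>e > 0\<close> K L by simp_all
  then obtain M N where MN: "\<forall>m\<ge>M. \<forall>n\<ge>M. hdist H (s m) (s n) < e / (2 * K)"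
      "\<forall>m\<ge>N. \<forall>n\<ge>N. hdist H (t m) (t n) < e / (2 * L)"
    using s t unfolding hCauchy_iff by meson
  show "\<exists>M. \<forall>m\<ge>M. \<forall>n\<ge>M. dist (inner H (s m) (t m)) (inner H (s n) (t n)) < e"
  proof (intro exI allI impI)
    fix m n assume mn: "max M N \<le> m" "max M N \<le> n"
    have "norm (inner H (s m) (t m) - inner H (s n) (t n))
        \<le> hdist H (s m) (s n) * hnorm H (t m) + hnorm H (s n) * hdist H (t m) (t n)"
      using s t by (intro norm_inner_diff_le) (auto simp: hCauchy_in)
    also have "\<dots> \<le> hdist H (s m) (s n) * K + L * hdist H (t m) (t n)"
      by (intro add_mono mult_left_mono mult_right_mono K L) auto
    also have "\<dots> < e / (2 * K) * K + L * (e / (2 * L))"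
      using MN mn K L by (intro add_strict_mono mult_strict_left_mono mult_strict_right_mono) auto
    also have "\<dots> = e" using K L by simp
    finally show "dist (inner H (s m) (t m)) (inner H (s n) (t n)) < e" by (simp add: dist_norm)
  qed
qed

lemma equiv_null_rel: "equiv {s. hCauchy H s} (null_rel H)"
proof (rule equivI)
  show "null_rel H \<subseteq> {s. hCauchy H s} \<times> {s. hCauchy H s}" by (auto simp: null_rel_iff)
  show "refl_on {s. hCauchy H s} (null_rel H)"
    by (auto simp: refl_on_def null_rel_iff hCauchy_in)
  show "sym (null_rel H)"
    by (rule symI) (auto simp: null_rel_iff hCauchy_in hdist_commute)
  show "trans (null_rel H)"
  proof (rule transI)
    fix s t u assume st: "(s, t) \<in> null_rel H" and tu: "(t, u) \<in> null_rel H"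
    have "(\<lambda>n. hdist H (s n) (t n) + hdist H (t n) (u n)) \<longlonglongrightarrow> 0"
      using st tu tendsto_add[of "\<lambda>n. hdist H (s n) (t n)" 0 sequentially] by (auto simp: null_rel_iff)
    then have "(\<lambda>n. hdist H (s n) (u n)) \<longlonglongrightarrow> 0"
      by (rule Lim_null_comparison[rotated])
         (use st tu in \<open>simp add: null_rel_iff hCauchy_in always_eventually hdist_triangle\<close>)
    then show "(s, u) \<in> null_rel H" using st tu by (simp add: null_rel_iff)
  qed
qed

abbreviation cls :: "(nat \<Rightarrow> 'u) \<Rightarrow> (nat \<Rightarrow> 'u) set" where
  "cls s \<equiv> null_rel H `` {s}"

lemma cls_eq_iff: "hCauchy H s \<Longrightarrow> hCauchy H t \<Longrightarrow> cls s = cls t \<longleftrightarrow> (\<lambda>n. hdist H (s n) (t n)) \<longlonglongrightarrow> 0"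
  using eq_equiv_class_iff[OF equiv_null_rel, of s t] by (simp add: null_rel_iff)

lemma completion_carrier: "carrier (completion H) = {cls s | s. hCauchy H s}"
  by (auto simp: completion_def Let_def quotient_def)

lemma cls_in_completion: "hCauchy H s \<Longrightarrow> cls s \<in> carrier (completion H)"
  by (auto simp: completion_carrier)

lemma rep_cls:
  assumes "hCauchy H s"
  shows "hCauchy H (rep (cls s))" "(\<lambda>n. hdist H (rep (cls s) n) (s n)) \<longlonglongrightarrow> 0"
  using rep_class_rel[OF equiv_null_rel, of s] assms by (auto simp: null_rel_iff)

lemma completion_zero: "zero (completion H) = cls (\<lambda>n. zero H)"
  by (simp add: completion_def Let_def)

lemma completion_add:
  assumes s: "hCauchy H s" and t: "hCauchy H t"
  shows "add (completion H) (cls s) (cls t) = cls (\<lambda>n. add H (s n) (t n))"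
proof -
  note r = rep_cls[OF s] rep_cls[OF t]
  have "(\<lambda>n. hdist H (add H (rep (cls s) n) (rep (cls t) n)) (add H (s n) (t n))) \<longlonglongrightarrow> 0"
    by (rule Lim_null_comparison[rotated, OF tendsto_add_zero[OF r(2) r(4)]])
       (use r s t in \<open>simp add: hCauchy_in always_eventually hdist_add_le\<close>)
  then show ?thesis using r s t by (simp add: completion_def Let_def cls_eq_iff hCauchy_add)
qed

lemma completion_csc:
  assumes s: "hCauchy H s"
  shows "csc (completion H) z (cls s) = cls (\<lambda>n. csc H z (s n))"
proof -
  note r = rep_cls[OF s]
  have "(\<lambda>n. hdist H (csc H z (rep (cls s) n)) (csc H z (s n))) \<longlonglongrightarrow> 0"
    using tendsto_mult_right_zero[OF r(2), of "cmod z"] r s by (simp add: hdist_csc hCauchy_in)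
  then show ?thesis using r s by (simp add: completion_def Let_def cls_eq_iff hCauchy_csc[OF s] hCauchy_csc[OF r(1)])
qed

lemma completion_act:
  assumes s: "hCauchy H s"
  shows "act (completion H) (cls s) a = cls (\<lambda>n. act H (s n) a)"
proof -
  note r = rep_cls[OF s]
  have "(\<lambda>n. hdist H (act H (rep (cls s) n) a) (act H (s n) a)) \<longlonglongrightarrow> 0"
    by (rule Lim_null_comparison[rotated, OF tendsto_mult_left_zero[OF r(2), of "norm a"]])
       (use r s in \<open>simp add: hCauchy_in always_eventually hdist_act_le\<close>)
  then show ?thesis using r s by (simp add: completion_def Let_def cls_eq_iff hCauchy_act[OF s] hCauchy_act[OF r(1)])
qed

text \<open>The representatives picked by \<open>rep\<close> differ from \<open>s\<close> and
  \<open>t\<close> by null sequences, so any representatives compute the same limit.\<close>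

lemma completion_inner_tendsto:
  assumes s: "hCauchy H s" and t: "hCauchy H t"
  shows "(\<lambda>n. inner H (s n) (t n)) \<longlonglongrightarrow> inner (completion H) (cls s) (cls t)"
proof -
  note r = rep_cls[OF s] rep_cls[OF t]
  have "(\<lambda>n. inner H (rep (cls s) n) (rep (cls t) n)) \<longlonglongrightarrow> inner (completion H) (cls s) (cls t)"
    using inner_convergent[OF r(1) r(3)] by (simp add: completion_def Let_def convergent_LIMSEQ_iff)
  moreover have "(\<lambda>n. inner H (rep (cls s) n) (rep (cls t) n) - inner H (s n) (t n)) \<longlonglongrightarrow> 0"
    by (rule inner_diff_tendsto_0[OF r(1,3) s t r(2,4)])
  ultimately show ?thesis using tendsto_diff by fastforce
qed

lemma completion_inner_eqI:
  assumes "hCauchy H s" "hCauchy H t" "(\<lambda>n. inner H (s n) (t n)) \<longlonglongrightarrow> a"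
  shows "inner (completion H) (cls s) (cls t) = a"
  using completion_inner_tendsto[OF assms(1,2)] assms(3) LIMSEQ_unique by blast

lemma pre_hilbert_completion: "pre_hilbert (completion H)"
proof
  show "zero (completion H) \<in> carrier (completion H)"
    by (simp add: completion_zero cls_in_completion hCauchy_const)
  fix X Y V z a
  assume X: "X \<in> carrier (completion H)"
  then obtain s where s: "hCauchy H s" "X = cls s" by (auto simp: completion_carrier)
  note si = hCauchy_in[OF s(1)]
  show "csc (completion H) z X \<in> carrier (completion H)" "act (completion H) X a \<in> carrier (completion H)"
    unfolding s(2) completion_csc[OF s(1)] completion_act[OF s(1)]
    by (intro cls_in_completion hCauchy_csc[OF s(1)] hCauchy_act[OF s(1)])+
  show "inner (completion H) X (zero (completion H)) = 0"
    unfolding s(2) completion_zero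
    by (rule completion_inner_eqI[OF s(1) hCauchy_const]) (simp_all add: si inner_simps)
  show "cstar_nonneg (inner (completion H) X X)"
    unfolding s(2) by (rule cstar_nonneg_LIMSEQ[OF completion_inner_tendsto[OF s(1) s(1)]])
      (simp add: si inner_self_nonneg)
  assume Y: "Y \<in> carrier (completion H)"
  then obtain t where t: "hCauchy H t" "Y = cls t" by (auto simp: completion_carrier)
  note ti = hCauchy_in[OF t(1)]
  show "add (completion H) X Y \<in> carrier (completion H)"
    unfolding s(2) t(2) completion_add[OF s(1) t(1)] by (intro cls_in_completion hCauchy_add s t)
  show "inner (completion H) X (csc (completion H) z Y) = z *\<^sub>C inner (completion H) X Y"
    unfolding s(2) t(2) completion_csc[OF t(1)]
    by (rule completion_inner_eqI[OF s(1) hCauchy_csc[OF t(1)]])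
       (simp add: si ti inner_simps tendsto_scaleC[OF completion_inner_tendsto[OF s(1) t(1)]])
  show "inner (completion H) X (act (completion H) Y a) = inner (completion H) X Y * a"
    unfolding s(2) t(2) completion_act[OF t(1)]
    by (rule completion_inner_eqI[OF s(1) hCauchy_act[OF t(1)]])
       (simp add: si ti inner_simps tendsto_mult_right[OF completion_inner_tendsto[OF s(1) t(1)]])
  show "star (inner (completion H) X Y) = inner (completion H) Y X"
    using tendsto_star[OF completion_inner_tendsto[OF s(1) t(1)]] si ti
    unfolding s(2) t(2) by (intro completion_inner_eqI[symmetric] s t) (simp add: inner_conj)
  assume V: "V \<in> carrier (completion H)"
  then obtain u where u: "hCauchy H u" "V = cls u" by (auto simp: completion_carrier)
  note ui = hCauchy_in[OF u(1)]
  show "inner (completion H) X (add (completion H) Y V)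
      = inner (completion H) X Y + inner (completion H) X V"
    unfolding s(2) t(2) u(2) completion_add[OF t(1) u(1)]
    by (rule completion_inner_eqI[OF s(1) hCauchy_add[OF t(1) u(1)]])
       (simp add: si ti ui inner_simps tendsto_add[OF completion_inner_tendsto[OF s(1) t(1)]
          completion_inner_tendsto[OF s(1) u(1)]])
qed

lemma completion_hdist_tendsto:
  assumes s: "hCauchy H s" and t: "hCauchy H t"
  shows "(\<lambda>n. hdist H (s n) (t n)) \<longlonglongrightarrow> hdist (completion H) (cls s) (cls t)"
proof -
  have c: "hCauchy H (\<lambda>n. hdiff H (s n) (t n))"
    unfolding hdiff_def by (intro hCauchy_add hCauchy_csc s t)
  have "hdiff (completion H) (cls s) (cls t) = cls (\<lambda>n. hdiff H (s n) (t n))"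
    unfolding hdiff_def by (simp add: completion_csc completion_add s t hCauchy_csc)
  then show ?thesis
    unfolding hdist_def hnorm_def
    using completion_inner_tendsto[OF c c] by (auto intro!: tendsto_intros)
qed

section \<open>The dense copy of a module in its completion\<close>

definition embed :: "'u \<Rightarrow> (nat \<Rightarrow> 'u) set" where
  "embed x = cls (\<lambda>_. x)"

lemma embed_in: "x \<in> carrier H \<Longrightarrow> embed x \<in> carrier (completion H)"
  by (simp add: embed_def cls_in_completion hCauchy_const)

lemma inner_embed: "x \<in> carrier H \<Longrightarrow> y \<in> carrier H \<Longrightarrow> inner (completion H) (embed x) (embed y) = inner H x y"
  unfolding embed_def by (rule completion_inner_eqI) (simp_all add: hCauchy_const)

lemma hdist_embed: "x \<in> carrier H \<Longrightarrow> y \<in> carrier H \<Longrightarrow> hdist (completion H) (embed x) (embed y) = hdist H x y"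
  using completion_hdist_tendsto[of "\<lambda>_. x" "\<lambda>_. y"] LIMSEQ_unique[OF tendsto_const]
  unfolding embed_def by (metis hCauchy_const)

lemma embed_dense:
  assumes s: "hCauchy H s" and "0 < e"
  shows "\<exists>N. \<forall>n\<ge>N. hdist (completion H) (cls s) (embed (s n)) \<le> e"
proof -
  obtain N where N: "\<forall>m\<ge>N. \<forall>n\<ge>N. hdist H (s m) (s n) < e" using assms hCauchy_iff by blast
  have "hdist (completion H) (cls s) (embed (s n)) \<le> e" if "n \<ge> N" for n
    unfolding embed_def
    by (rule LIMSEQ_le_const2[OF completion_hdist_tendsto[OF s hCauchy_const]])
       (use N that s in \<open>auto simp: hCauchy_in intro!: exI[of _ N] less_imp_le\<close>)
  then show ?thesis by blast
qed

text \<open>For a Cauchy sequence \<open>S\<close> of classes choose vectors \<open>t n\<close>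
  whose images lie within 1 / (n + 1) of \<open>S n\<close>. The sequence \<open>t\<close> is itself
  Cauchy, and its class is the limit of \<open>S\<close>.\<close>

theorem hilbert_completion: "hilbert_module (completion H)"
proof (rule pre_hilbert.separated_complete_hilbert[OF pre_hilbert_completion])
  fix X Y assume "X \<in> carrier (completion H)" "Y \<in> carrier (completion H)" "hdist (completion H) X Y = 0"
  then obtain s t where st: "hCauchy H s" "hCauchy H t" "X = cls s" "Y = cls t"
      "hdist (completion H) (cls s) (cls t) = 0"
    unfolding completion_carrier by auto
  show "X = Y"
    using completion_hdist_tendsto[OF st(1,2)] unfolding st(3,4,5) cls_eq_iff[OF st(1,2)] .
next
  interpret C: pre_hilbert "completion H" by (rule pre_hilbert_completion)
  fix S assume S: "hCauchy (completion H) S"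
  have Sin: "S n \<in> carrier (completion H)" for n using S by (rule C.hCauchy_in)
  have "\<exists>x\<in>carrier H. hdist (completion H) (S n) (embed x) \<le> inverse (Suc n)" for n
  proof -
    obtain s where s: "hCauchy H s" "S n = cls s" using Sin[of n] by (auto simp: completion_carrier)
    obtain N where "hdist (completion H) (S n) (embed (s N)) \<le> inverse (Suc n)"
      using embed_dense[OF s(1), of "inverse (Suc n)"] s(2) by auto
    then show ?thesis using hCauchy_in[OF s(1)] by blast
  qed
  then obtain t where t: "\<And>n. t n \<in> carrier H" "\<And>n. hdist (completion H) (S n) (embed (t n)) \<le> inverse (Suc n)"
    by metis
  have lim: "(\<lambda>n. hdist (completion H) (S n) (embed (t n))) \<longlonglongrightarrow> 0"
    by (rule Lim_null_comparison[OF always_eventually LIMSEQ_inverse_real_of_nat]) (use t(2) in simp)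
  have tC: "hCauchy H t"
    unfolding hCauchy_iff
  proof (intro conjI allI impI t(1))
    fix e :: real assume e: "e > 0"
    obtain M where M: "\<forall>m\<ge>M. \<forall>n\<ge>M. hdist (completion H) (S m) (S n) < e / 3"
      using S e unfolding C.hCauchy_iff by (meson divide_pos_pos zero_less_numeral)
    obtain N where N: "\<forall>n\<ge>N. hdist (completion H) (S n) (embed (t n)) < e / 3"
      using lim e unfolding LIMSEQ_iff by (auto dest!: spec[of _ "e/3"])
    have "hdist H (t m) (t n) < e" if "m \<ge> max M N" "n \<ge> max M N" for m n
    proof -
      have "hdist H (t m) (t n) = hdist (completion H) (embed (t m)) (embed (t n))"
        by (simp add: hdist_embed t)
      also have "\<dots> \<le> hdist (completion H) (embed (t m)) (S m) + (hdist (completion H) (S m) (S n)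
           + hdist (completion H) (S n) (embed (t n)))"
        by (intro order_trans[OF C.hdist_triangle[of _ "S m"]] add_left_mono C.hdist_triangle)
          (auto simp: embed_in t Sin)
      also have "\<dots> < e / 3 + (e / 3 + e / 3)"
        using M N that C.hdist_commute[OF embed_in[OF t(1)] Sin, of m m] by (intro add_strict_mono) auto
      finally show ?thesis by simp
    qed
    then show "\<exists>N. \<forall>m\<ge>N. \<forall>n\<ge>N. hdist H (t m) (t n) < e" by blast
  qed
  have "(\<lambda>n. hdist (completion H) (embed (t n)) (cls t)) \<longlonglongrightarrow> 0"
  proof (rule LIMSEQ_I)
    fix e :: real assume "e > 0"
    then obtain N where "\<forall>n\<ge>N. hdist (completion H) (cls t) (embed (t n)) \<le> e / 2"
      using embed_dense[OF tC, of "e/2"] by auto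
    then show "\<exists>N. \<forall>n\<ge>N. norm (hdist (completion H) (embed (t n)) (cls t) - 0) < e"
      using \<open>e > 0\<close> C.hdist_commute[OF embed_in[OF t(1)] cls_in_completion[OF tC]]
      by (intro exI[of _ N]) fastforce
  qed
  with lim have "(\<lambda>n. hdist (completion H) (S n) (embed (t n)) + hdist (completion H) (embed (t n)) (cls t)) \<longlonglongrightarrow> 0"
    by (rule tendsto_add_zero)
  then have "(\<lambda>n. hdist (completion H) (S n) (cls t)) \<longlonglongrightarrow> 0"
    by (rule Lim_null_comparison[rotated])
       (simp add: always_eventually C.hdist_triangle Sin embed_in t(1) cls_in_completion tC)
  then show "\<exists>X\<in>carrier (completion H). (\<lambda>n. hdist (completion H) (S n) X) \<longlonglongrightarrow> 0"
    using cls_in_completion[OF tC] by blast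
qed

end

section \<open>Formal linear combinations\<close>

text \<open>The linear extension of \<open>h\<close> from basis pairs to formal sums.\<close>

definition lincomb :: "('k \<Rightarrow> 'c::cstar_algebra) \<Rightarrow> ('k \<Rightarrow>\<^sub>0 complex) \<Rightarrow> 'c" where
  "lincomb h f = (\<Sum>k\<in>Poly_Mapping.keys f. Poly_Mapping.lookup f k *\<^sub>C h k)"

lemma lookup_map_scale: "Poly_Mapping.lookup (Poly_Mapping.map ((*) z) f) k = z * Poly_Mapping.lookup f k"
  for z :: complex
  by (simp add: Poly_Mapping.map.rep_eq when_def)

lemma lincomb_zero [simp]: "lincomb h 0 = 0"
  by (simp add: lincomb_def)

lemma lincomb_superset:
  assumes "finite K" "Poly_Mapping.keys f \<subseteq> K"
  shows "lincomb h f = (\<Sum>k\<in>K. Poly_Mapping.lookup f k *\<^sub>C h k)"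
  unfolding lincomb_def using assms by (intro sum.mono_neutral_left) (auto simp: in_keys_iff)

lemma lincomb_add: "lincomb h (f + g) = lincomb h f + lincomb h g"
  unfolding lincomb_def
  by (rule setsum_keys_plus_distrib[where f = "\<lambda>k z. z *\<^sub>C h k"]) (auto simp: scaleC_add_left)

lemma lincomb_scale: "lincomb h (Poly_Mapping.map ((*) z) f) = z *\<^sub>C lincomb h f"
proof -
  have "Poly_Mapping.keys (Poly_Mapping.map ((*) z) f) \<subseteq> Poly_Mapping.keys f"
    by (auto simp: in_keys_iff lookup_map_scale)
  then show ?thesis
    by (simp add: lincomb_superset[where K = "Poly_Mapping.keys f" and f = "Poly_Mapping.map _ _"])
       (simp add: lincomb_def lookup_map_scale scaleC_scaleC scaleC_sum_right)
qed

lemma lincomb_single [simp]: "lincomb h (Poly_Mapping.single k z) = z *\<^sub>C h k"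
  by (simp add: lincomb_def)

lemma lincomb_diff: "lincomb h (f - g) = lincomb h f - lincomb h g"
  using lincomb_add[of h "f - g" g] by simp

lemma lincomb_sum: "lincomb h (\<Sum>i\<in>I. f i) = (\<Sum>i\<in>I. lincomb h (f i))"
  by (induction I rule: infinite_finite_induct) (auto simp: lincomb_add)

lemma formal_sum_induct [consumes 1, case_names zero add]:
  fixes f :: "'k \<Rightarrow>\<^sub>0 complex"
  assumes "Poly_Mapping.keys f \<subseteq> S" and P0: "P 0"
    and step: "\<And>f k z. Poly_Mapping.keys f \<subseteq> S \<Longrightarrow> k \<in> S \<Longrightarrow> P f \<Longrightarrow> P (f + Poly_Mapping.single k z)"
  shows "P f"
  using assms(1)
proof (induction f rule: Poly_Mapping.update_induct)
  case (update f a b)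
  have eq: "Poly_Mapping.update a b f = f + Poly_Mapping.single a b"
    using update.hyps by (intro poly_mapping_eqI)
      (auto simp: lookup_update lookup_add lookup_single in_keys_iff when_def)
  have "Poly_Mapping.keys f \<subseteq> S" "a \<in> S"
    using update.prems update.hyps by (auto simp: keys_update)
  then show ?case unfolding eq by (intro step update.IH)
qed (rule P0)

section \<open>The algebraic tensor product\<close>

definition module_map :: "('c, 'u) hmod \<Rightarrow> ('c::cstar_algebra, 'v) hmod \<Rightarrow> ('u \<Rightarrow> 'v) \<Rightarrow> bool" where
  "module_map E F f \<longleftrightarrow> (\<forall>x\<in>carrier E. f x \<in> carrier F) \<and>
     (\<forall>x\<in>carrier E. \<forall>y\<in>carrier E. f (add E x y) = add F (f x) (f y)) \<and>
     (\<forall>x\<in>carrier E. \<forall>z. f (csc E z x) = csc F z (f x)) \<and>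
     (\<forall>x\<in>carrier E. \<forall>a. f (act E x a) = act F (f x) a)"

lemma module_mapD:
  assumes "module_map E F f" "x \<in> carrier E"
  shows "f x \<in> carrier F" "f (csc E z x) = csc F z (f x)" "f (act E x a) = act F (f x) a"
    "y \<in> carrier E \<Longrightarrow> f (add E x y) = add F (f x) (f y)"
  using assms by (auto simp: module_map_def)

lemma module_map_id: "module_map E E (\<lambda>x. x)"
  by (simp add: module_map_def)

text \<open>The vector \<open>v\<close> stands for \<open>\<Sum>i. y i \<cdot> a i\<close>; the action of the algebra alone cannot express it, since the
  coefficients lie in the unitization.\<close>

lemma unitization_combination:
  assumes E: "pre_hilbert E" and F: "pre_hilbert F" and f: "module_map E F f"
    and "finite I" "\<And>i. i \<in> I \<Longrightarrow> y i \<in> carrier E"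
  shows "\<exists>v\<in>carrier E. (\<forall>w\<in>carrier E. unz (inner E w v) = (\<Sum>i\<in>I. unz (inner E w (y i)) * a i)) \<and>
    (\<forall>w\<in>carrier F. unz (inner F w (f v)) = (\<Sum>i\<in>I. unz (inner F w (f (y i))) * a i))"
  using assms(4,5)
proof (induction I rule: finite_induct)
  case empty
  interpret E: pre_hilbert E by fact
  interpret F: pre_hilbert F by fact
  show ?case
    \<comment> \<open>A module map between semi-inner-product modules is not known to preserve
      \<open>zero\<close>. The factor 0 commutes with \<open>f\<close> and makes the inner products
      vanish on both sides.\<close>
    by (rule bexI[of _ "csc E 0 (zero E)"])
       (auto simp: E.inner_csc_right F.inner_csc_right module_mapD[OF f] unz_simps)
next
  case (insert k I)
  interpret E: pre_hilbert E by fact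
  interpret F: pre_hilbert F by fact
  obtain v where v: "v \<in> carrier E"
    "\<forall>w\<in>carrier E. unz (inner E w v) = (\<Sum>i\<in>I. unz (inner E w (y i)) * a i)"
    "\<forall>w\<in>carrier F. unz (inner F w (f v)) = (\<Sum>i\<in>I. unz (inner F w (f (y i))) * a i)"
    using insert by auto
  have yk: "y k \<in> carrier E" using insert.prems by simp
  \<comment> \<open>A coefficient in the unitization acts on a vector through its two parts: the
    scalar part by \<open>csc\<close>, the algebra part by \<open>act\<close>.\<close>
  have u: "unz c * a k = unz (scalar_part (a k) *\<^sub>C c + c * alg_part (a k))" for c
    by (simp add: unitization.expand)
  define v' where "v' = add E (add E (csc E (scalar_part (a k)) (y k)) (act E (y k) (alg_part (a k)))) v"
  have "v' \<in> carrier E" by (simp add: v'_def yk v(1))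
  moreover have "unz (inner E w v') = (\<Sum>i\<in>insert k I. unz (inner E w (y i)) * a i)" if "w \<in> carrier E" for w
    using that yk v insert.hyps by (simp add: v'_def E.inner_simps u unz_simps)
  moreover have "unz (inner F w (f v')) = (\<Sum>i\<in>insert k I. unz (inner F w (f (y i))) * a i)" if "w \<in> carrier F" for w
    using that yk v insert.hyps by (simp add: v'_def F.inner_simps module_mapD[OF f] u unz_simps)
  ultimately show ?case by blast
qed

text \<open>Summing over \<open>j\<close> replaces the right vectors by \<open>v\<close>; after
  conjugation the sum over \<open>i\<close> does the same on the left. Positivity of Gram matrices
  is thereby reduced to that of <v|v>.\<close>

lemma gram_form:
  assumes F: "pre_hilbert F" and v: "v \<in> carrier F" "\<And>i. i \<in> I \<Longrightarrow> y i \<in> carrier F"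
    and comb: "\<And>w. w \<in> carrier F \<Longrightarrow> unz (inner F w v) = (\<Sum>i\<in>I. unz (inner F w (y i)) * a i)"
  shows "(\<Sum>i\<in>I. \<Sum>j\<in>I. star (a i) * unz (inner F (y i) (y j)) * a j) = unz (inner F v v)"
proof -
  interpret F: pre_hilbert F by fact
  have "(\<Sum>i\<in>I. \<Sum>j\<in>I. star (a i) * unz (inner F (y i) (y j)) * a j)
      = (\<Sum>i\<in>I. star (a i) * unz (inner F (y i) v))"
    using v by (simp add: comb sum_distrib_left mult.assoc)
  also have "\<dots> = star (\<Sum>i\<in>I. unz (inner F v (y i)) * a i)"
    using v by (simp add: star_sum star_mult unz_simps(6)[symmetric] F.inner_conj)
  also have "\<dots> = unz (inner F v v)"
    using v by (simp add: comb[symmetric] unz_simps(6)[symmetric] F.inner_conj)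
  finally show ?thesis .
qed

lemma psd_gram:
  assumes F: "pre_hilbert F" and "finite I" and y: "\<And>i. i \<in> I \<Longrightarrow> y i \<in> carrier F"
  shows "psd I (\<lambda>i j. unz (inner F (y i) (y j)))"
proof -
  interpret F: pre_hilbert F by fact
  have "cstar_nonneg (\<Sum>i\<in>I. \<Sum>j\<in>I. star (a i) * unz (inner F (y i) (y j)) * a j)" for a
  proof -
    obtain v where v: "v \<in> carrier F"
      "\<forall>w\<in>carrier F. unz (inner F w v) = (\<Sum>i\<in>I. unz (inner F w (y i)) * a i)"
      using unitization_combination[OF F F module_map_id \<open>finite I\<close>, of y a] y by blast
    have "(\<Sum>i\<in>I. \<Sum>j\<in>I. star (a i) * unz (inner F (y i) (y j)) * a j) = unz (inner F v v)"
      by (rule gram_form[OF F v(1)]) (use v y in auto)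
    then show ?thesis using v(1) by (simp only: cstar_nonneg_unz_iff F.inner_self_nonneg)
  qed
  then show ?thesis using y by (simp add: psd_def F.inner_conj flip: unz_simps(6))
qed

text \<open>The scalars \<open>c i\<close> are absorbed into the test coefficients.\<close>

lemma psd_scale:
  assumes "psd I (P :: 'i \<Rightarrow> 'i \<Rightarrow> 'a::comm_cstar_algebra)"
  shows "psd I (\<lambda>i j. (cnj (c i) * c j) *\<^sub>C P i j)"
  unfolding psd_def
proof (intro conjI ballI allI)
  fix a
  have "cstar_nonneg (\<Sum>i\<in>I. \<Sum>j\<in>I. star (c i *\<^sub>C a i) * P i j * (c j *\<^sub>C a j))"
    by (rule assms[unfolded psd_def, THEN conjunct2, THEN spec[of _ "\<lambda>i. c i *\<^sub>C a i"]])
  then show "cstar_nonneg (\<Sum>i\<in>I. \<Sum>j\<in>I. star (a i) * ((cnj (c i) * c j) *\<^sub>C P i j) * a j)"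
    by (simp add: star_scaleC mult_scaleC_left mult_scaleC_right scaleC_scaleC mult.commute mult.left_commute)
qed (use assms in \<open>simp add: psd_def star_scaleC mult.commute\<close>)

section \<open>The sesquilinear form on formal sums and its descent to the quotient\<close>

definition formal_inner ::
  "('c::cstar_algebra, 'u) hmod \<Rightarrow> ('c, 'v) hmod \<Rightarrow> ('u \<times> 'v \<Rightarrow>\<^sub>0 complex) \<Rightarrow> ('u \<times> 'v \<Rightarrow>\<^sub>0 complex) \<Rightarrow> 'c" where
  "formal_inner E F f g = (\<Sum>(x\<^sub>1, y\<^sub>1) \<in> Poly_Mapping.keys f. \<Sum>(x\<^sub>2, y\<^sub>2) \<in> Poly_Mapping.keys g.
     (cnj (Poly_Mapping.lookup f (x\<^sub>1, y\<^sub>1)) * Poly_Mapping.lookup g (x\<^sub>2, y\<^sub>2))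
       *\<^sub>C (inner E x\<^sub>1 x\<^sub>2 * inner F y\<^sub>1 y\<^sub>2))"

definition pair_inner :: "('c::cstar_algebra, 'u) hmod \<Rightarrow> ('c, 'v) hmod \<Rightarrow> 'u \<times> 'v \<Rightarrow> 'u \<times> 'v \<Rightarrow> 'c" where
  "pair_inner E F p q = inner E (fst p) (fst q) * inner F (snd p) (snd q)"

text \<open>The form with its first argument fixed, as a function on basis pairs. Its extension by
  \<open>lincomb\<close> is the whole form, so linearity in the second argument is
  immediate.\<close>

definition formal_functional ::
  "('c::cstar_algebra, 'u) hmod \<Rightarrow> ('c, 'v) hmod \<Rightarrow> ('u \<times> 'v \<Rightarrow>\<^sub>0 complex) \<Rightarrow> 'u \<times> 'v \<Rightarrow> 'c" where
  "formal_functional E F f q = (\<Sum>p\<in>Poly_Mapping.keys f. cnj (Poly_Mapping.lookup f p) *\<^sub>C pair_inner E F p q)"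

lemma formal_inner_lincomb: "formal_inner E F f g = lincomb (formal_functional E F f) g"
proof -
  have "formal_inner E F f g = (\<Sum>p\<in>Poly_Mapping.keys f. \<Sum>q\<in>Poly_Mapping.keys g.
      (cnj (Poly_Mapping.lookup f p) * Poly_Mapping.lookup g q) *\<^sub>C pair_inner E F p q)"
    unfolding formal_inner_def pair_inner_def by (intro sum.cong refl) (auto simp: case_prod_unfold)
  also have "\<dots> = lincomb (formal_functional E F f) g"
    unfolding lincomb_def formal_functional_def
    by (subst sum.swap) (simp add: scaleC_sum_right scaleC_scaleC mult.commute)
  finally show ?thesis .
qed

definition formal_act :: "('c, 'v) hmod \<Rightarrow> ('u \<times> 'v \<Rightarrow>\<^sub>0 complex) \<Rightarrow> 'c \<Rightarrow> ('u \<times> 'v \<Rightarrow>\<^sub>0 complex)" where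
  "formal_act F f a = (\<Sum>(x, y) \<in> Poly_Mapping.keys f.
     Poly_Mapping.single (x, act F y a) (Poly_Mapping.lookup f (x, y)))"

locale pre_hilbert_pair =
  E: pre_hilbert E + F: pre_hilbert F
  for E :: "('c::comm_cstar_algebra, 'u) hmod" and F :: "('c, 'v) hmod"
begin

abbreviation "FS \<equiv> formal_sums E F"
abbreviation "fi \<equiv> formal_inner E F"

lemma FS_keys: "f \<in> FS \<Longrightarrow> p \<in> Poly_Mapping.keys f \<Longrightarrow> fst p \<in> carrier E \<and> snd p \<in> carrier F"
  by (auto simp: formal_sums_def)

lemma FS_simps [simp]:
  "0 \<in> FS"
  "f \<in> FS \<Longrightarrow> g \<in> FS \<Longrightarrow> f + g \<in> FS"
  "f \<in> FS \<Longrightarrow> g \<in> FS \<Longrightarrow> f - g \<in> FS"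
  "f \<in> FS \<Longrightarrow> Poly_Mapping.map ((*) z) f \<in> FS"
  "x \<in> carrier E \<Longrightarrow> y \<in> carrier F \<Longrightarrow> Poly_Mapping.single (x, y) z \<in> FS"
proof -
  show "f + g \<in> FS" "f - g \<in> FS" if "f \<in> FS" "g \<in> FS"
    using that keys_add[of f g] keys_diff[of f g] unfolding formal_sums_def by blast+
  show "Poly_Mapping.map ((*) z) f \<in> FS" if "f \<in> FS"
    using that by (auto simp: formal_sums_def in_keys_iff lookup_map_scale subset_iff)
qed (auto simp: formal_sums_def)

lemma FS_sum: "(\<And>i. i \<in> I \<Longrightarrow> f i \<in> FS) \<Longrightarrow> (\<Sum>i\<in>I. f i) \<in> FS"
  by (induction I rule: infinite_finite_induct) auto

lemma FS_act: "f \<in> FS \<Longrightarrow> formal_act F f a \<in> FS"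
  unfolding formal_act_def by (rule FS_sum) (auto simp: formal_sums_def split: if_splits)

lemma fi_linear:
  "fi f (g + g') = fi f g + fi f g'" "fi f (g - g') = fi f g - fi f g'"
  "fi f (Poly_Mapping.map ((*) z) g) = z *\<^sub>C fi f g" "fi f 0 = 0"
  by (simp_all add: formal_inner_lincomb lincomb_add lincomb_diff lincomb_scale)

lemma fi_act:
  assumes "f \<in> FS" "g \<in> FS"
  shows "fi f (formal_act F g a) = fi f g * a"
proof -
  have "fi f (formal_act F g a) = (\<Sum>q\<in>Poly_Mapping.keys g.
      Poly_Mapping.lookup g q *\<^sub>C formal_functional E F f (fst q, act F (snd q) a))"
    unfolding formal_inner_lincomb formal_act_def lincomb_sum by (intro sum.cong refl) (auto simp: case_prod_unfold)
  also have "\<dots> = (\<Sum>q\<in>Poly_Mapping.keys g. (Poly_Mapping.lookup g q *\<^sub>C formal_functional E F f q) * a)"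
  proof (intro sum.cong refl)
    fix q assume q: "q \<in> Poly_Mapping.keys g"
    have "formal_functional E F f (fst q, act F (snd q) a) = formal_functional E F f q * a"
      unfolding formal_functional_def pair_inner_def sum_distrib_right
      by (intro sum.cong refl)
         (use FS_keys[OF assms(1)] FS_keys[OF assms(2) q] in \<open>simp add: F.inner_act_right mult_scaleC_left mult.assoc\<close>)
    then show "Poly_Mapping.lookup g q *\<^sub>C formal_functional E F f (fst q, act F (snd q) a)
        = (Poly_Mapping.lookup g q *\<^sub>C formal_functional E F f q) * a"
      by (simp add: mult_scaleC_left)
  qed
  finally show ?thesis by (simp add: formal_inner_lincomb lincomb_def sum_distrib_right)
qed

lemma fi_star:
  assumes "f \<in> FS" "g \<in> FS"
  shows "star (fi f g) = fi g f"
proof -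
  have "star (fi f g) = (\<Sum>q\<in>Poly_Mapping.keys g. \<Sum>p\<in>Poly_Mapping.keys f.
      (cnj (Poly_Mapping.lookup g q) * Poly_Mapping.lookup f p) *\<^sub>C star (pair_inner E F p q))"
    unfolding formal_inner_lincomb lincomb_def formal_functional_def
    by (simp add: star_sum star_scaleC scaleC_sum_right scaleC_scaleC mult.commute)
  also have "\<dots> = (\<Sum>q\<in>Poly_Mapping.keys g. \<Sum>p\<in>Poly_Mapping.keys f.
      (cnj (Poly_Mapping.lookup g q) * Poly_Mapping.lookup f p) *\<^sub>C pair_inner E F q p)"
    by (intro sum.cong refl arg_cong2[where f = scaleC])
       (use FS_keys[OF assms(1)] FS_keys[OF assms(2)] in
         \<open>simp add: pair_inner_def star_mult E.inner_conj F.inner_conj mult.commute\<close>)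
  also have "\<dots> = fi g f"
    unfolding formal_inner_def pair_inner_def by (intro sum.cong refl) (auto simp: case_prod_unfold)
  finally show ?thesis .
qed

lemma fi_left:
  assumes "f \<in> FS" "f' \<in> FS" "g \<in> FS"
  shows "fi (f + f') g = fi f g + fi f' g" "fi (f - f') g = fi f g - fi f' g"
    "fi (Poly_Mapping.map ((*) z) f) g = cnj z *\<^sub>C fi f g"
  using assms by (simp_all flip: fi_star[of g] add: fi_linear star_add star_diff star_scaleC)

lemma fi_single:
  assumes "x \<in> carrier E" "y \<in> carrier F" "x' \<in> carrier E" "y' \<in> carrier F"
  shows "fi (Poly_Mapping.single (x, y) 1) (Poly_Mapping.single (x', y') 1) = inner E x x' * inner F y y'"
  by (simp add: formal_inner_def)

text \<open>The double sum is that of the entrywise product of two Gram matrices, where the matrix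
  of the first components carries the complex coefficients.\<close>

lemma fi_nonneg:
  assumes "f \<in> FS"
  shows "cstar_nonneg (fi f f)"
proof -
  let ?K = "Poly_Mapping.keys f"
  have "unz (fi f f) = (\<Sum>p\<in>?K. \<Sum>q\<in>?K.
      ((cnj (Poly_Mapping.lookup f p) * Poly_Mapping.lookup f q) *\<^sub>C unz (inner E (fst p) (fst q)))
        * unz (inner F (snd p) (snd q)))"
    unfolding formal_inner_def unz_sum
    by (intro sum.cong refl) (auto simp: case_prod_unfold unz_sum unz_simps mult_scaleC_left)
  moreover have "cstar_nonneg \<dots>"
    by (intro schur_product_nonneg psd_scale psd_gram finite_keys E.pre_hilbert_axioms F.pre_hilbert_axioms)
       (use FS_keys[OF assms] in auto)
  ultimately have "cstar_nonneg (unz (fi f f))" by simp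
  then show ?thesis by simp
qed

lemma lincomb_bilinearity_span:
  assumes "g \<in> bilinearity_span E F"
    and "\<And>x x' y. x \<in> carrier E \<Longrightarrow> x' \<in> carrier E \<Longrightarrow> y \<in> carrier F \<Longrightarrow> h (add E x x', y) = h (x, y) + h (x', y)"
    and "\<And>x y y'. x \<in> carrier E \<Longrightarrow> y \<in> carrier F \<Longrightarrow> y' \<in> carrier F \<Longrightarrow> h (x, add F y y') = h (x, y) + h (x, y')"
    and "\<And>x y z. x \<in> carrier E \<Longrightarrow> y \<in> carrier F \<Longrightarrow> h (csc E z x, y) = z *\<^sub>C h (x, y)"
    and "\<And>x y z. x \<in> carrier E \<Longrightarrow> y \<in> carrier F \<Longrightarrow> h (x, csc F z y) = z *\<^sub>C h (x, y)"
  shows "lincomb h g = 0"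
  using assms(1) by induction (simp_all add: lincomb_add lincomb_diff lincomb_scale assms(2-))

text \<open>For fixed \<open>f\<close> the functional is bilinear in the pair, so its linear
  extension kills every bilinearity relation. This makes the form well defined on classes.\<close>

lemma fi_bilinearity_span:
  assumes f: "f \<in> FS" and g: "g \<in> bilinearity_span E F"
  shows "fi f g = 0"
  unfolding formal_inner_lincomb
  by (rule lincomb_bilinearity_span[OF g]; unfold formal_functional_def sum.distrib[symmetric] scaleC_sum_right;
      intro sum.cong refl; use FS_keys[OF f] in \<open>simp add: pair_inner_def E.inner_simps F.inner_simps distrib_left
        distrib_right scaleC_add_right mult_scaleC_left mult_scaleC_right scaleC_scaleC mult.commute\<close>)

lemma equiv_bilinearity_rel: "equiv FS (bilinearity_rel E F)"
proof (rule equivI)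
  show "bilinearity_rel E F \<subseteq> FS \<times> FS" by (auto simp: bilinearity_rel_def)
  show "refl_on FS (bilinearity_rel E F)"
    by (auto simp: refl_on_def bilinearity_rel_def bilinearity_span.span_zero)
  show "sym (bilinearity_rel E F)"
  proof (rule symI)
    fix f g assume "(f, g) \<in> bilinearity_rel E F"
    moreover have "g - f = Poly_Mapping.map ((*) (-1)) (f - g)"
      by (rule poly_mapping_eqI) (simp add: lookup_map_scale lookup_minus)
    ultimately show "(g, f) \<in> bilinearity_rel E F"
      by (auto simp: bilinearity_rel_def simp del: mult_minus1 intro: bilinearity_span.span_csc)
  qed
  show "trans (bilinearity_rel E F)"
  proof (rule transI)
    fix f g h assume "(f, g) \<in> bilinearity_rel E F" "(g, h) \<in> bilinearity_rel E F"
    then show "(f, h) \<in> bilinearity_rel E F"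
      using bilinearity_span.span_add[of "f - g" E F "g - h"] by (auto simp: bilinearity_rel_def)
  qed
qed

abbreviation "bcls f \<equiv> bilinearity_rel E F `` {f}"

lemma fi_rel:
  assumes "(f, f') \<in> bilinearity_rel E F" "(g, g') \<in> bilinearity_rel E F"
  shows "fi f g = fi f' g'"
proof -
  have in': "f \<in> FS" "f' \<in> FS" "g \<in> FS" "g' \<in> FS" using assms by (auto simp: bilinearity_rel_def)
  have eq: "fi h g1 = fi h g2" if "h \<in> FS" "(g1, g2) \<in> bilinearity_rel E F" for h g1 g2
    using fi_bilinearity_span[OF that(1), of "g1 - g2"] that by (simp add: bilinearity_rel_def fi_linear)
  have "fi f g = fi f g'" by (rule eq) (use assms in' in auto)
  also have "\<dots> = star (fi g' f)" using in' by (simp add: fi_star)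
  also have "\<dots> = star (fi g' f')" using eq[of g' f f'] assms in' by simp
  finally show ?thesis using in' by (simp add: fi_star)
qed

lemma rep_bcls: "f \<in> FS \<Longrightarrow> (rep (bcls f), f) \<in> bilinearity_rel E F"
  by (rule rep_class_rel[OF equiv_bilinearity_rel])

lemma alg_tensor_carrier: "carrier (alg_tensor E F) = FS // bilinearity_rel E F"
  by (simp add: alg_tensor_def Let_def)

lemma bcls_in: "f \<in> FS \<Longrightarrow> bcls f \<in> carrier (alg_tensor E F)"
  by (simp add: alg_tensor_carrier quotientI)

lemma rep_alg_tensor:
  assumes "X \<in> carrier (alg_tensor E F)"
  shows "rep X \<in> FS" "bcls (rep X) = X"
  using rep_quotient[OF equiv_bilinearity_rel, of X] assms by (simp_all add: alg_tensor_carrier)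

lemma alg_tensor_ops:
  "zero (alg_tensor E F) = bcls 0" "add (alg_tensor E F) X Y = bcls (rep X + rep Y)"
  "csc (alg_tensor E F) z X = bcls (Poly_Mapping.map ((*) z) (rep X))"
  "act (alg_tensor E F) X a = bcls (formal_act F (rep X) a)"
  "inner (alg_tensor E F) X Y = fi (rep X) (rep Y)"
  by (simp_all add: alg_tensor_def Let_def formal_act_def formal_inner_def)

lemma inner_bcls: "f \<in> FS \<Longrightarrow> g \<in> FS \<Longrightarrow> inner (alg_tensor E F) (bcls f) (bcls g) = fi f g"
  unfolding alg_tensor_ops by (intro fi_rel rep_bcls)

lemma pre_hilbert_alg_tensor: "pre_hilbert (alg_tensor E F)"
proof
  let ?T = "alg_tensor E F"
  show "zero ?T \<in> carrier ?T" by (simp add: alg_tensor_ops bcls_in)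
  fix X Y V z a
  assume X: "X \<in> carrier ?T"
  note [simp] = rep_alg_tensor[OF X]
  have X': "(rep X, rep X) \<in> bilinearity_rel E F"
    using equiv_bilinearity_rel by (auto simp: bilinearity_rel_def bilinearity_span.span_zero)
  have right: "fi (rep X) (rep (bcls g)) = fi (rep X) g" if "g \<in> FS" for g
    by (rule fi_rel[OF X' rep_bcls[OF that]])
  show "csc ?T z X \<in> carrier ?T" "act ?T X a \<in> carrier ?T"
    by (simp_all add: alg_tensor_ops bcls_in FS_act)
  show "inner ?T X (zero ?T) = 0" by (simp add: alg_tensor_ops right fi_linear)
  show "cstar_nonneg (inner ?T X X)" by (simp add: alg_tensor_ops fi_nonneg)
  assume Y: "Y \<in> carrier ?T"
  note [simp] = rep_alg_tensor[OF Y]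
  show "add ?T X Y \<in> carrier ?T" by (simp add: alg_tensor_ops bcls_in)
  show "inner ?T X (csc ?T z Y) = z *\<^sub>C inner ?T X Y" by (simp add: alg_tensor_ops right fi_linear)
  show "inner ?T X (act ?T Y a) = inner ?T X Y * a" by (simp add: alg_tensor_ops right fi_act FS_act)
  show "star (inner ?T X Y) = inner ?T Y X" by (simp add: alg_tensor_ops fi_star)
  assume V: "V \<in> carrier ?T"
  note [simp] = rep_alg_tensor[OF V]
  show "inner ?T X (add ?T Y V) = inner ?T X Y + inner ?T X V"
    by (simp add: alg_tensor_ops right fi_linear)
qed

end

section \<open>The completed tensor product in the universe\<close>

lemma transport_carrier [simp]: "carrier (transport h E) = h ` carrier E"
  by (simp add: transport_def Let_def)

lemma transport_ops:
  assumes "inj_on h (carrier E)"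
  shows "zero (transport h E) = h (zero E)"
    "x \<in> carrier E \<Longrightarrow> y \<in> carrier E \<Longrightarrow> add (transport h E) (h x) (h y) = h (add E x y)"
    "x \<in> carrier E \<Longrightarrow> csc (transport h E) z (h x) = h (csc E z x)"
    "x \<in> carrier E \<Longrightarrow> act (transport h E) (h x) a = h (act E x a)"
    "x \<in> carrier E \<Longrightarrow> y \<in> carrier E \<Longrightarrow> inner (transport h E) (h x) (h y) = inner E x y"
  using assms by (simp_all add: transport_def Let_def)

lemma hilbert_transport:
  fixes E :: "('c::comm_cstar_algebra, 'u) hmod"
  assumes E: "hilbert_module E" and h: "inj_on h (carrier E)"
  shows "hilbert_module (transport h E)"
    and "x \<in> carrier E \<Longrightarrow> y \<in> carrier E \<Longrightarrow> hdist (transport h E) (h x) (h y) = hdist E x y"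
proof -
  interpret pre_hilbert E by (rule hilbert_pre_hilbert[OF E])
  note ops = transport_ops[OF h]
  have T: "pre_hilbert (transport h E)"
    by unfold_locales (auto simp: ops inner_simps inner_conj inner_self_nonneg)
  have hd: "hdist (transport h E) (h x) (h y) = hdist E x y" if "x \<in> carrier E" "y \<in> carrier E" for x y
    using that by (simp add: hdist_def hnorm_def hdiff_def ops)
  then show "x \<in> carrier E \<Longrightarrow> y \<in> carrier E \<Longrightarrow> hdist (transport h E) (h x) (h y) = hdist E x y" .
  show "hilbert_module (transport h E)"
  proof (rule pre_hilbert.separated_complete_hilbert[OF T])
    fix u v assume "u \<in> carrier (transport h E)" "v \<in> carrier (transport h E)" "hdist (transport h E) u v = 0"
    then show "u = v" by (auto simp: hd intro!: arg_cong[where f = h] hilbert_eqI[OF E])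
  next
    fix s assume s: "hCauchy (transport h E) s"
    then have "\<forall>n. \<exists>x\<in>carrier E. s n = h x"
      using pre_hilbert.hCauchy_in[OF T s] by auto
    then obtain t where t: "\<And>n. t n \<in> carrier E" "\<And>n. s n = h (t n)" by metis
    have "hCauchy E t"
      using s unfolding pre_hilbert.hCauchy_iff[OF T] hCauchy_iff by (simp add: t hd)
    then obtain x where "x \<in> carrier E" "(\<lambda>n. hdist E (t n) x) \<longlonglongrightarrow> 0"
      using hilbert_module.complete[OF E] unfolding hdist_def by blast
    then show "\<exists>x\<in>carrier (transport h E). (\<lambda>n. hdist (transport h E) (s n) x) \<longlonglongrightarrow> 0"
      by (auto simp: t hd)
  qed
qed

text \<open>The constructor \<open>Limit\<close> stores lists, so a formal sum is written as a list
  of its terms. The order and possible repetitions of the chosen list are harmless: the set of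
  entries already determines the sum.\<close>

definition formal_code ::
  "(('c, 'x) univ \<times> ('c, 'x) univ \<Rightarrow>\<^sub>0 complex) \<Rightarrow> (complex \<times> ('c, 'x) univ \<times> ('c, 'x) univ) list" where
  "formal_code f = map (\<lambda>p. (Poly_Mapping.lookup f p, p)) (SOME ps. set ps = Poly_Mapping.keys f)"

lemma inj_formal_code: "inj formal_code"
proof (rule injI)
  fix f g :: "('c, 'x) univ \<times> ('c, 'x) univ \<Rightarrow>\<^sub>0 complex"
  assume eq: "formal_code f = formal_code g"
  have s: "set (formal_code f) = {(Poly_Mapping.lookup f p, p) | p. p \<in> Poly_Mapping.keys f}"
    for f :: "('c, 'x) univ \<times> ('c, 'x) univ \<Rightarrow>\<^sub>0 complex"
    unfolding formal_code_def using someI_ex[OF finite_list[OF finite_keys[of f]]] by auto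
  have "Poly_Mapping.lookup f p = z \<longleftrightarrow> (if z = 0 then \<forall>w. (w, p) \<notin> set (formal_code f) else (z, p) \<in> set (formal_code f))"
    for f :: "('c, 'x) univ \<times> ('c, 'x) univ \<Rightarrow>\<^sub>0 complex" and p z
    unfolding s by (cases p) (auto simp: in_keys_iff)
  then show "f = g" using eq by (intro poly_mapping_eqI) metis
qed

section \<open>The tensor product of two Hilbert modules, approached through formal sums\<close>

locale tensor_pair =
  fixes E F :: "('c::comm_cstar_algebra, 'x) umod"
  assumes E: "hilbert_module E" and F: "hilbert_module F"
begin

sublocale pre_hilbert_pair E F
  using E F by (simp add: pre_hilbert_pair_def hilbert_pre_hilbert)

sublocale A: pre_hilbert "alg_tensor E F"
  by (rule pre_hilbert_alg_tensor)

abbreviation "T \<equiv> tensor E F"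

text \<open>It suffices to exhibit one injection: a class is coded by representatives of the terms
  of a representing sequence, and these determine the class again.\<close>

lemma inj_tensor_code: "inj_on (tensor_code E F) (carrier (completion (alg_tensor E F)))"
proof -
  define h :: "(nat \<Rightarrow> (('c, 'x) univ \<times> ('c, 'x) univ \<Rightarrow>\<^sub>0 complex) set) set \<Rightarrow> ('c, 'x) univ"
    where "h X = Limit (\<lambda>n. formal_code (rep (rep X n)))" for X
  have "inj_on h (carrier (completion (alg_tensor E F)))"
  proof (rule inj_onI)
    fix X Y assume X: "X \<in> carrier (completion (alg_tensor E F))"
      and Y: "Y \<in> carrier (completion (alg_tensor E F))" and eq: "h X = h Y"
    have "rep (rep X n) = rep (rep Y n)" for n
      using eq inj_formal_code unfolding h_def by (metis injD univ.inject(3))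
    moreover have "hCauchy (alg_tensor E F) (rep Z)" "null_rel (alg_tensor E F) `` {rep Z} = Z"
      if "Z \<in> carrier (completion (alg_tensor E F))" for Z
      using rep_quotient[OF A.equiv_null_rel, of Z] that by (simp_all add: completion_def Let_def)
    ultimately show "X = Y"
      using X Y A.hCauchy_in rep_alg_tensor(2) by (metis (no_types, lifting) ext)
  qed
  then show ?thesis unfolding tensor_code_def
    by (rule someI[where P = "\<lambda>h. inj_on h (carrier (completion (alg_tensor E F)))"])
qed

lemma hilbert_tensor: "hilbert_module T"
  unfolding tensor_def by (rule hilbert_transport[OF A.hilbert_completion inj_tensor_code])

sublocale T: pre_hilbert T
  by (rule hilbert_pre_hilbert[OF hilbert_tensor])

definition of_formal :: "(('c, 'x) univ \<times> ('c, 'x) univ \<Rightarrow>\<^sub>0 complex) \<Rightarrow> ('c, 'x) univ" where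
  "of_formal f = tensor_code E F (A.embed (bcls f))"

lemma elem_tensor_of_formal: "elem_tensor E F x y = of_formal (Poly_Mapping.single (x, y) 1)"
  by (simp add: elem_tensor_def of_formal_def A.embed_def)

lemma of_formal_in: "f \<in> FS \<Longrightarrow> of_formal f \<in> carrier T"
  by (simp add: of_formal_def tensor_def A.embed_in bcls_in)

lemma inner_of_formal: "f \<in> FS \<Longrightarrow> g \<in> FS \<Longrightarrow> inner T (of_formal f) (of_formal g) = fi f g"
  by (simp add: of_formal_def tensor_def transport_ops[OF inj_tensor_code] A.embed_in bcls_in
      A.inner_embed inner_bcls)

lemma of_formal_dense:
  assumes "v \<in> carrier T" "0 < e"
  shows "\<exists>f\<in>FS. hdist T v (of_formal f) < e"
proof -
  obtain X where X: "X \<in> carrier (completion (alg_tensor E F))" "v = tensor_code E F X"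
    using assms(1) by (auto simp: tensor_def)
  then obtain s where s: "hCauchy (alg_tensor E F) s" "X = A.cls s" by (auto simp: A.completion_carrier)
  obtain n where n: "hdist (completion (alg_tensor E F)) X (A.embed (s n)) \<le> e / 2"
    using A.embed_dense[OF s(1), of "e / 2"] assms(2) s(2) by auto
  have "s n \<in> carrier (alg_tensor E F)" by (rule A.hCauchy_in[OF s(1)])
  then have "hdist T v (of_formal (rep (s n))) \<le> e / 2" "rep (s n) \<in> FS"
    using n X hilbert_transport(2)[OF A.hilbert_completion inj_tensor_code X(1) A.embed_in]
    by (simp_all add: of_formal_def tensor_def rep_alg_tensor)
  then show ?thesis using assms(2) by force
qed

text \<open>Expanding the squared norm of the difference gives four terms, all equal to
  \<open>fi f f\<close> up to sign. The operations of the completed tensor product can thus be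
  computed from inner products, without unfolding quotient, completion and transport.\<close>

lemma of_formal_eqI:
  assumes "f \<in> FS" "v \<in> carrier T" "inner T v v = fi f f" "inner T v (of_formal f) = fi f f"
  shows "v = of_formal f"
proof (rule hilbert_eqI[OF hilbert_tensor assms(2) of_formal_in[OF assms(1)]])
  have "inner T (of_formal f) v = fi f f"
    using T.inner_conj[OF assms(2) of_formal_in[OF assms(1)]] assms fi_star[of f f] by simp
  then show "hdist T v (of_formal f) = 0"
    using assms by (simp add: hdist_def hnorm_def T.inner_simps of_formal_in inner_of_formal)
qed

lemma of_formal_add:
  "f \<in> FS \<Longrightarrow> g \<in> FS \<Longrightarrow> add T (of_formal f) (of_formal g) = of_formal (f + g)"
  by (rule of_formal_eqI) (simp_all add: T.inner_simps of_formal_in inner_of_formal fi_left fi_linear)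

lemma of_formal_csc:
  "f \<in> FS \<Longrightarrow> csc T z (of_formal f) = of_formal (Poly_Mapping.map ((*) z) f)"
  by (rule of_formal_eqI) (simp_all add: T.inner_simps of_formal_in inner_of_formal fi_left fi_linear scaleC_scaleC mult.commute)

lemma of_formal_zero: "zero T = of_formal 0"
  by (rule of_formal_eqI) (simp_all add: T.inner_simps of_formal_in fi_linear)

lemma elem_in [simp]:
  "x \<in> carrier E \<Longrightarrow> y \<in> carrier F \<Longrightarrow> elem_tensor E F x y \<in> carrier T"
  by (simp add: elem_tensor_of_formal of_formal_in)

lemma inner_elem:
  assumes "x \<in> carrier E" "y \<in> carrier F" "x' \<in> carrier E" "y' \<in> carrier F"
  shows "inner T (elem_tensor E F x y) (elem_tensor E F x' y') = inner E x x' * inner F y y'"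
  using assms by (simp add: elem_tensor_of_formal inner_of_formal fi_single)

end

section \<open>Total sets and extension of maps\<close>

inductive_set hspan :: "('c, 'u) hmod \<Rightarrow> 'u set \<Rightarrow> 'u set" for H S where
  hspan_zero: "zero H \<in> hspan H S"
| hspan_add: "u \<in> hspan H S \<Longrightarrow> v \<in> hspan H S \<Longrightarrow> add H u v \<in> hspan H S"
| hspan_csc: "u \<in> hspan H S \<Longrightarrow> csc H z u \<in> hspan H S"
| hspan_base: "s \<in> S \<Longrightarrow> s \<in> hspan H S"

definition total :: "('c::cstar_algebra, 'u) hmod \<Rightarrow> 'u set \<Rightarrow> bool" where
  "total H S \<longleftrightarrow> S \<subseteq> carrier H \<and> (\<forall>v\<in>carrier H. \<forall>e>0. \<exists>u\<in>hspan H S. hdist H v u < e)"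

lemma (in pre_hilbert) hspan_in: "u \<in> hspan H S \<Longrightarrow> S \<subseteq> carrier H \<Longrightarrow> u \<in> carrier H"
  by (induction rule: hspan.induct) auto

text \<open>Transitivity of density: an induction over the span carries the approximation of the
  generators through sums and multiples, splitting the error at each step.\<close>

lemma (in pre_hilbert) total_approx:
  assumes T: "total H T" and S: "S \<subseteq> carrier H"
    and approx: "\<And>t e. t \<in> T \<Longrightarrow> 0 < e \<Longrightarrow> \<exists>u\<in>hspan H S. hdist H t u < e"
  shows "total H S"
proof -
  have Tin: "T \<subseteq> carrier H" using T by (simp add: total_def)
  have span: "\<exists>u\<in>hspan H S. hdist H v u < e" if "v \<in> hspan H T" "0 < e" for v e
    using that
  proof (induction arbitrary: e rule: hspan.induct)
    case hspan_zero
    then show ?case by (auto intro!: bexI[of _ "zero H"] hspan.hspan_zero)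
  next
    case (hspan_add v v')
    obtain u u' where u: "u \<in> hspan H S" "hdist H v u < e / 2" "u' \<in> hspan H S" "hdist H v' u' < e / 2"
      using hspan_add.IH[of "e / 2"] hspan_add.prems by auto
    have "hdist H (add H v v') (add H u u') < e"
      using u hspan_add.hyps by (intro le_less_trans[OF hdist_add_le]) (auto intro: hspan_in[OF _ S] hspan_in[OF _ Tin])
    then show ?case using u by (auto intro: hspan.hspan_add)
  next
    case (hspan_csc v z)
    obtain u where u: "u \<in> hspan H S" "hdist H v u < e / (cmod z + 1)"
      using hspan_csc.IH[of "e / (cmod z + 1)"] hspan_csc.prems by (auto simp: add_nonneg_pos)
    have "hdist H (csc H z v) (csc H z u) = cmod z * hdist H v u"
      using u hspan_csc.hyps by (intro hdist_csc) (auto intro: hspan_in[OF _ S] hspan_in[OF _ Tin])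
    also have "\<dots> \<le> (cmod z + 1) * hdist H v u" by (simp add: distrib_right)
    also have "\<dots> < (cmod z + 1) * (e / (cmod z + 1))"
      using u by (intro mult_strict_left_mono) (auto simp: add_nonneg_pos)
    also have "\<dots> = e" using norm_ge_zero[of z] by (simp add: add_nonneg_eq_0_iff)
    finally show ?case using u by (auto intro: hspan.hspan_csc)
  qed (auto intro: approx)
  show ?thesis
    unfolding total_def
  proof (intro conjI S ballI allI impI)
    fix v and e :: real assume v: "v \<in> carrier H" and "0 < e"
    then have "0 < e / 2" by simp
    then obtain t where t: "t \<in> hspan H T" "hdist H v t < e / 2" using T v unfolding total_def by meson
    obtain u where u: "u \<in> hspan H S" "hdist H t u < e / 2" using span[OF t(1) \<open>0 < e / 2\<close>] by blast
    have "hdist H v u < e"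
      using hdist_triangle[OF v hspan_in[OF t(1) Tin] hspan_in[OF u(1) S]] t u by simp
    then show "\<exists>u\<in>hspan H S. hdist H v u < e" using u by blast
  qed
qed

lemma (in pre_hilbert) total_carrier: "total H (carrier H)"
  unfolding total_def by (force intro: hspan_base)

text \<open>Here \<open>v\<close> is orthogonal to the whole span. If its norm were nonzero, a
  vector u of the span closer to v than this norm would give <v|v> = <v - u|v>, against
  Cauchy-Schwarz.\<close>

lemma (in pre_hilbert) total_inner_eq_0:
  assumes S: "total H S" and v: "v \<in> carrier H" and 0: "\<And>s. s \<in> S \<Longrightarrow> inner H s v = 0"
  shows "hnorm H v = 0"
proof (rule ccontr)
  assume "hnorm H v \<noteq> 0"
  then have pos: "hnorm H v > 0" using hnorm_nonneg[of v] by linarith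
  have Sin: "S \<subseteq> carrier H" using S by (simp add: total_def)
  have span: "inner H u v = 0" if "u \<in> hspan H S" for u
    using that by induction (simp_all add: inner_left v hspan_in[OF _ Sin] 0)
  obtain u where u: "u \<in> hspan H S" "hdist H v u < hnorm H v" using S v pos unfolding total_def by blast
  have "inner H v v = inner H (hdiff H v u) v"
    using u v hspan_in[OF u(1) Sin] by (simp add: inner_hdiff span)
  then have "norm (inner H v v) \<le> hdist H v u * hnorm H v"
    using cauchy_schwarz[of "hdiff H v u" v] u v hspan_in[OF u(1) Sin] by (simp add: hdist_def)
  then have "hnorm H v * hnorm H v \<le> hdist H v u * hnorm H v"
    using hnorm_square[of v] by (simp add: power2_eq_square)
  then show False using u pos by simp
qed

lemma total_inner_eqI:
  fixes H :: "('c::comm_cstar_algebra, 'u) hmod"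
  assumes H: "hilbert_module H" and S: "total H S" and v: "v \<in> carrier H" "w \<in> carrier H"
    and eq: "\<And>s. s \<in> S \<Longrightarrow> inner H s v = inner H s w"
  shows "v = w"
proof (rule hilbert_eqI[OF H v])
  interpret pre_hilbert H by (rule hilbert_pre_hilbert[OF H])
  have "S \<subseteq> carrier H" using S by (simp add: total_def)
  then show "hdist H v w = 0"
    unfolding hdist_def by (intro total_inner_eq_0[OF S]) (auto simp: v inner_hdiff eq)
qed

section \<open>Bounded module maps are determined on a total set\<close>

definition bounded_map :: "('c, 'u) hmod \<Rightarrow> ('c::cstar_algebra, 'v) hmod \<Rightarrow> ('u \<Rightarrow> 'v) \<Rightarrow> real \<Rightarrow> bool" where
  "bounded_map H K f M \<longleftrightarrow> module_map H K f \<and> (\<forall>x\<in>carrier H. hnorm K (f x) \<le> M * hnorm H x)"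

lemma module_map_zero:
  fixes H :: "('c::comm_cstar_algebra, 'u) hmod"
  assumes H: "hilbert_module H" and K: "hilbert_module K" and f: "module_map H K f"
  shows "f (zero H) = zero K"
proof -
  interpret H: pre_hilbert H by (rule hilbert_pre_hilbert[OF H])
  interpret K: pre_hilbert K by (rule hilbert_pre_hilbert[OF K])
  have "csc H 0 (zero H) = zero H" by (rule hilbert_inner_eqI[OF H]) (simp_all add: H.inner_simps)
  then have "f (zero H) = csc K 0 (f (zero H))" using module_mapD(2)[OF f, of "zero H" 0] by simp
  also have "\<dots> = zero K"
    by (rule hilbert_inner_eqI[OF K]) (simp_all add: K.inner_simps module_mapD(1)[OF f])
  finally show ?thesis .
qed

lemma bounded_map_hdist:
  fixes H :: "('c::comm_cstar_algebra, 'u) hmod"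
  assumes "pre_hilbert H" "bounded_map H K f M" "x \<in> carrier H" "y \<in> carrier H"
  shows "hdist K (f x) (f y) \<le> M * hdist H x y"
proof -
  interpret H: pre_hilbert H by fact
  have "hdiff K (f x) (f y) = f (hdiff H x y)"
    using assms by (auto simp: bounded_map_def module_map_def hdiff_def)
  then show ?thesis using assms by (simp add: bounded_map_def hdist_def)
qed

lemma bounded_map_eqI:
  fixes H :: "('c::comm_cstar_algebra, 'u) hmod" and K :: "('c, 'v) hmod"
  assumes H: "hilbert_module H" and K: "hilbert_module K"
    and f: "bounded_map H K f M" and g: "bounded_map H K g N"
    and S: "total H S" and eq: "\<And>s. s \<in> S \<Longrightarrow> f s = g s" and v: "v \<in> carrier H"
  shows "f v = g v"
proof -
  interpret H: pre_hilbert H by (rule hilbert_pre_hilbert[OF H])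
  interpret K: pre_hilbert K by (rule hilbert_pre_hilbert[OF K])
  have mf: "module_map H K f" and mg: "module_map H K g" using f g by (simp_all add: bounded_map_def)
  note [simp] = module_mapD[OF mf] module_mapD[OF mg]
  have Sin: "S \<subseteq> carrier H" using S by (simp add: total_def)
  have span: "f u = g u" if "u \<in> hspan H S" for u
    using that
    by induction (simp_all add: H.hspan_in[OF _ Sin] module_map_zero[OF H K mf] module_map_zero[OF H K mg] eq)
  have le: "hdist K (f v) (g v) \<le> (\<bar>M\<bar> + \<bar>N\<bar>) * hdist H v u" if u: "u \<in> hspan H S" for u
  proof -
    have uin: "u \<in> carrier H" using H.hspan_in[OF u Sin] .
    have "hdist K (f v) (g v) \<le> hdist K (f v) (f u) + hdist K (g v) (g u)"
      using K.hdist_triangle[of "f v" "f u" "g v"] K.hdist_commute[of "g v" "g u"] span[OF u] v uin by simp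
    also have "\<dots> \<le> M * hdist H v u + N * hdist H v u"
      using bounded_map_hdist[OF H.pre_hilbert_axioms f v uin] bounded_map_hdist[OF H.pre_hilbert_axioms g v uin]
      by simp
    also have "\<dots> \<le> (\<bar>M\<bar> + \<bar>N\<bar>) * hdist H v u"
      by (simp add: distrib_right mult_right_mono add_mono)
    finally show ?thesis .
  qed
  have "hdist K (f v) (g v) = 0"
  proof (rule ccontr)
    assume "hdist K (f v) (g v) \<noteq> 0"
    then have pos: "hdist K (f v) (g v) > 0" using K.hdist_nonneg[of "f v" "g v"] by linarith
    \<comment> \<open>The summand 1 makes the denominator positive and leaves
      \<open>(\<bar>M\<bar> + \<bar>N\<bar>) * e\<close> strictly below the distance.\<close>
    define e where "e = hdist K (f v) (g v) / (\<bar>M\<bar> + \<bar>N\<bar> + 1)"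
    have e: "e > 0" using pos by (simp add: e_def add_nonneg_pos)
    then obtain u where u: "u \<in> hspan H S" "hdist H v u < e" using S v unfolding total_def by blast
    have "hdist K (f v) (g v) \<le> (\<bar>M\<bar> + \<bar>N\<bar>) * e"
      using le[OF u(1)] u(2) by (smt (verit) abs_ge_zero mult_left_mono)
    also have "\<dots> < (\<bar>M\<bar> + \<bar>N\<bar> + 1) * e" using e by simp
    also have "\<dots> = hdist K (f v) (g v)"
      using abs_ge_zero[of M] abs_ge_zero[of N] by (simp add: e_def)
    finally show False by simp
  qed
  then show ?thesis using v by (intro hilbert_eqI[OF K]) simp_all
qed

text \<open>The extension is the closure of the graph of the map given on the generators.\<close>

inductive_set lgraph ::
  "('c, 'u) hmod \<Rightarrow> ('c, 'v) hmod \<Rightarrow> 'i set \<Rightarrow> ('i \<Rightarrow> 'u) \<Rightarrow> ('i \<Rightarrow> 'v) \<Rightarrow> ('u \<times> 'v) set" for H K I e \<phi> where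
  lgraph_zero: "(zero H, zero K) \<in> lgraph H K I e \<phi>"
| lgraph_add: "(u, w) \<in> lgraph H K I e \<phi> \<Longrightarrow> (u', w') \<in> lgraph H K I e \<phi>
    \<Longrightarrow> (add H u u', add K w w') \<in> lgraph H K I e \<phi>"
| lgraph_csc: "(u, w) \<in> lgraph H K I e \<phi> \<Longrightarrow> (csc H z u, csc K z w) \<in> lgraph H K I e \<phi>"
| lgraph_base: "i \<in> I \<Longrightarrow> (e i, \<phi> i) \<in> lgraph H K I e \<phi>"

text \<open>The hypothesis \<open>rep\<close> says weakly that \<open>u\<close> is the combination
  of the \<open>e i\<close> with coefficients \<open>p\<close>; phrasing this through inner products
  avoids iterated \<open>add\<close>.\<close>

lemma (in pre_hilbert) inner_quadratic:
  assumes u: "u \<in> carrier H" and e: "\<And>i. i \<in> Poly_Mapping.keys p \<Longrightarrow> e i \<in> carrier H"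
    and rep: "\<And>v. v \<in> carrier H \<Longrightarrow> inner H v u = lincomb (\<lambda>i. inner H v (e i)) p"
  shows "inner H u u = (\<Sum>i\<in>Poly_Mapping.keys p. \<Sum>j\<in>Poly_Mapping.keys p.
    (cnj (Poly_Mapping.lookup p i) * Poly_Mapping.lookup p j) *\<^sub>C inner H (e i) (e j))"
proof -
  have "inner H u u = star (inner H u u)" using u by (simp add: inner_conj)
  also have "\<dots> = (\<Sum>i\<in>Poly_Mapping.keys p. cnj (Poly_Mapping.lookup p i) *\<^sub>C inner H (e i) u)"
    by (subst rep[OF u]) (auto simp: lincomb_def star_sum star_scaleC inner_conj u e intro!: sum.cong)
  also have "\<dots> = (\<Sum>i\<in>Poly_Mapping.keys p. \<Sum>j\<in>Poly_Mapping.keys p.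
    (cnj (Poly_Mapping.lookup p i) * Poly_Mapping.lookup p j) *\<^sub>C inner H (e i) (e j))"
    by (intro sum.cong refl) (simp add: rep e lincomb_def scaleC_sum_right scaleC_scaleC)
  finally show ?thesis .
qed

text \<open>The condition \<open>pos\<close> is the algebra-valued form of the estimate that a
  combination of the \<open>\<phi> i\<close> has norm at most M times that of the same combination
  of the \<open>e i\<close>; it makes the linear extension well defined and bounded. By
  \<open>act_compat\<close> the generators are stable under the action, so a complex linear
  extension is automatically a module map.\<close>

locale extension_data =
  fixes H :: "('c::comm_cstar_algebra, 'u) hmod" and K :: "('c, 'v) hmod"
    and I :: "'i set" and e :: "'i \<Rightarrow> 'u" and \<phi> :: "'i \<Rightarrow> 'v" and M :: real
  assumes H: "hilbert_module H" and K: "hilbert_module K"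
    and total_e: "total H (e ` I)" and \<phi>_in: "\<And>i. i \<in> I \<Longrightarrow> \<phi> i \<in> carrier K"
    and M0: "0 \<le> M"
    and act_compat: "\<And>i a. i \<in> I \<Longrightarrow> \<exists>j\<in>I. e j = act H (e i) a \<and> \<phi> j = act K (\<phi> i) a"
    and pos: "\<And>p. Poly_Mapping.keys p \<subseteq> I \<Longrightarrow>
      cstar_nonneg (\<Sum>i\<in>Poly_Mapping.keys p. \<Sum>j\<in>Poly_Mapping.keys p.
        (cnj (Poly_Mapping.lookup p i) * Poly_Mapping.lookup p j)
          *\<^sub>C (M\<^sup>2 *\<^sub>R inner H (e i) (e j) - inner K (\<phi> i) (\<phi> j)))"
begin

sublocale H: pre_hilbert H by (rule hilbert_pre_hilbert[OF H])
sublocale K: pre_hilbert K by (rule hilbert_pre_hilbert[OF K])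

abbreviation "G \<equiv> lgraph H K I e \<phi>"

lemma e_in: "i \<in> I \<Longrightarrow> e i \<in> carrier H"
  using total_e by (auto simp: total_def)

lemma G_in: "(u, w) \<in> G \<Longrightarrow> u \<in> carrier H \<and> w \<in> carrier K"
  by (induction rule: lgraph.induct) (simp_all add: e_in \<phi>_in)

lemma G_act: "(u, w) \<in> G \<Longrightarrow> (act H u a, act K w a) \<in> G"
proof (induction rule: lgraph.induct)
  case lgraph_zero
  have "act H (zero H) a = zero H" by (rule hilbert_inner_eqI[OF H]) (simp_all add: H.inner_simps)
  moreover have "act K (zero K) a = zero K" by (rule hilbert_inner_eqI[OF K]) (simp_all add: K.inner_simps)
  ultimately show ?case using lgraph.lgraph_zero[of H K I e \<phi>] by simp
next
  case (lgraph_add u w u' w')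
  then show ?case
    using G_in[OF lgraph_add.hyps(1)] G_in[OF lgraph_add.hyps(2)] lgraph.lgraph_add[OF lgraph_add.IH]
    by (simp add: hilbert_module.act_add_left[OF H] hilbert_module.act_add_left[OF K])
next
  case (lgraph_csc u w z)
  then show ?case
    using G_in[OF lgraph_csc.hyps] lgraph.lgraph_csc[OF lgraph_csc.IH]
    by (simp add: hilbert_module.act_csc[OF H] hilbert_module.act_csc[OF K])
next
  case (lgraph_base i)
  then show ?case using act_compat[OF lgraph_base] lgraph.lgraph_base by metis
qed

lemma G_rep:
  "(u, w) \<in> G \<Longrightarrow> \<exists>p. Poly_Mapping.keys p \<subseteq> I \<and> (\<forall>v\<in>carrier H. inner H v u = lincomb (\<lambda>i. inner H v (e i)) p)
     \<and> (\<forall>v\<in>carrier K. inner K v w = lincomb (\<lambda>i. inner K v (\<phi> i)) p)"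
proof (induction rule: lgraph.induct)
  case lgraph_zero
  show ?case by (rule exI[of _ 0]) (simp add: H.inner_simps K.inner_simps)
next
  case (lgraph_add u w u' w')
  then obtain p q where "Poly_Mapping.keys p \<subseteq> I" "Poly_Mapping.keys q \<subseteq> I"
    and pq: "\<forall>v\<in>carrier H. inner H v u = lincomb (\<lambda>i. inner H v (e i)) p"
    "\<forall>v\<in>carrier K. inner K v w = lincomb (\<lambda>i. inner K v (\<phi> i)) p"
    "\<forall>v\<in>carrier H. inner H v u' = lincomb (\<lambda>i. inner H v (e i)) q"
    "\<forall>v\<in>carrier K. inner K v w' = lincomb (\<lambda>i. inner K v (\<phi> i)) q" by blast
  then have "Poly_Mapping.keys (p + q) \<subseteq> I" using keys_add[of p q] by blast
  then show ?case
    using G_in[OF lgraph_add(1)] G_in[OF lgraph_add(2)] pq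
    by (intro exI[of _ "p + q"]) (simp add: H.inner_simps K.inner_simps lincomb_add)
next
  case (lgraph_csc u w z)
  then obtain p where p: "Poly_Mapping.keys p \<subseteq> I"
    "\<forall>v\<in>carrier H. inner H v u = lincomb (\<lambda>i. inner H v (e i)) p"
    "\<forall>v\<in>carrier K. inner K v w = lincomb (\<lambda>i. inner K v (\<phi> i)) p" by blast
  moreover have "Poly_Mapping.keys (Poly_Mapping.map ((*) z) p) \<subseteq> I"
    using p(1) by (auto simp: in_keys_iff lookup_map_scale subset_iff)
  ultimately show ?case
    using G_in[OF lgraph_csc(1)]
    by (intro exI[of _ "Poly_Mapping.map ((*) z) p"]) (simp add: H.inner_simps K.inner_simps lincomb_scale)
next
  case (lgraph_base i)
  then show ?case by (intro exI[of _ "Poly_Mapping.single i 1"]) simp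
qed

lemma G_bound:
  assumes G: "(u, w) \<in> G"
  shows "hnorm K w \<le> M * hnorm H u"
proof -
  have in': "u \<in> carrier H" "w \<in> carrier K" using G_in[OF G] by auto
  obtain p where p: "Poly_Mapping.keys p \<subseteq> I"
    "\<forall>v\<in>carrier H. inner H v u = lincomb (\<lambda>i. inner H v (e i)) p"
    "\<forall>v\<in>carrier K. inner K v w = lincomb (\<lambda>i. inner K v (\<phi> i)) p"
    using G_rep[OF G] by blast
  have "inner H u u = (\<Sum>i\<in>Poly_Mapping.keys p. \<Sum>j\<in>Poly_Mapping.keys p.
    (cnj (Poly_Mapping.lookup p i) * Poly_Mapping.lookup p j) *\<^sub>C inner H (e i) (e j))"
    using p e_in in' by (intro H.inner_quadratic) auto
  moreover have "inner K w w = (\<Sum>i\<in>Poly_Mapping.keys p. \<Sum>j\<in>Poly_Mapping.keys p.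
    (cnj (Poly_Mapping.lookup p i) * Poly_Mapping.lookup p j) *\<^sub>C inner K (\<phi> i) (\<phi> j))"
    using p \<phi>_in in' by (intro K.inner_quadratic) auto
  moreover have "z *\<^sub>C (M\<^sup>2 *\<^sub>R x - y) = M\<^sup>2 *\<^sub>R (z *\<^sub>C x) - z *\<^sub>C y" for z and x y :: 'c
    by (simp add: scaleC_diff_right scaleR_scaleC scaleC_scaleC mult.commute)
  ultimately have "cstar_nonneg (M\<^sup>2 *\<^sub>R inner H u u - inner K w w)"
    using pos[OF p(1)] by (simp add: sum_subtractf scaleR_sum_right)
  then have "norm (inner K w w) \<le> norm (M\<^sup>2 *\<^sub>R inner H u u)"
    using norm_mono_cstar K.inner_self_nonneg in' by blast
  then have "(hnorm K w)\<^sup>2 \<le> (M * hnorm H u)\<^sup>2"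
    by (simp add: H.hnorm_square K.hnorm_square power_mult_distrib)
  then show ?thesis by (rule power2_le_imp_le) (simp add: M0)
qed

definition cl_graph :: "('u \<times> 'v) set" where
  "cl_graph = {(u, w). u \<in> carrier H \<and> w \<in> carrier K \<and>
     (\<forall>r>0. \<exists>(u', w')\<in>G. hdist H u u' < r \<and> hdist K w w' < r)}"

text \<open>A constant factor \<open>C\<close> is absorbed by passing to
  \<open>r / (\<bar>C\<bar> + 1)\<close>, so closure under an operation only needs its Lipschitz
  constant.\<close>

lemma cl_graphI:
  assumes "u \<in> carrier H" "w \<in> carrier K"
    "\<And>r. 0 < r \<Longrightarrow> \<exists>u' w'. (u', w') \<in> G \<and> hdist H u u' \<le> C * r \<and> hdist K w w' \<le> C * r"
  shows "(u, w) \<in> cl_graph"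
  unfolding cl_graph_def
proof (clarify, intro conjI assms(1,2) allI impI)
  fix r :: real assume r: "r > 0"
  then have s: "r / (\<bar>C\<bar> + 1) > 0" by (simp add: add_nonneg_pos)
  have "C * (r / (\<bar>C\<bar> + 1)) < r"
  proof -
    have "C * (r / (\<bar>C\<bar> + 1)) \<le> \<bar>C\<bar> * (r / (\<bar>C\<bar> + 1))"
      using s by (intro mult_right_mono) auto
    also have "\<dots> < (\<bar>C\<bar> + 1) * (r / (\<bar>C\<bar> + 1))" using s by (intro mult_strict_right_mono) auto
    also have "\<dots> = r" using abs_ge_zero[of C] by simp
    finally show ?thesis .
  qed
  then show "\<exists>(u', w')\<in>G. hdist H u u' < r \<and> hdist K w w' < r"
    using assms(3)[OF s] by force
qed

lemma cl_graph_approx: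
  assumes "(u, w) \<in> cl_graph" "0 < r"
  obtains u' w' where "(u', w') \<in> G" "u' \<in> carrier H" "w' \<in> carrier K" "hdist H u u' < r" "hdist K w w' < r"
  using assms G_in unfolding cl_graph_def by blast

lemma cl_graph_in: "(u, w) \<in> cl_graph \<Longrightarrow> u \<in> carrier H \<and> w \<in> carrier K"
  by (auto simp: cl_graph_def)

lemma cl_graph_add:
  assumes "(u, w) \<in> cl_graph" "(u', w') \<in> cl_graph"
  shows "(add H u u', add K w w') \<in> cl_graph"
proof (rule cl_graphI[where C = 2])
  fix r :: real assume r: "r > 0"
  obtain v x where 1: "(v, x) \<in> G" "v \<in> carrier H" "x \<in> carrier K" "hdist H u v < r" "hdist K w x < r"
    using cl_graph_approx[OF assms(1) r] .
  obtain v' x' where 2: "(v', x') \<in> G" "v' \<in> carrier H" "x' \<in> carrier K" "hdist H u' v' < r" "hdist K w' x' < r"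
    using cl_graph_approx[OF assms(2) r] .
  have "hdist H (add H u u') (add H v v') \<le> 2 * r" "hdist K (add K w w') (add K x x') \<le> 2 * r"
    using 1 2 assms[THEN cl_graph_in] H.hdist_add_le[of u u' v v'] K.hdist_add_le[of w w' x x'] by auto
  then show "\<exists>u'' w''. (u'', w'') \<in> G \<and> hdist H (add H u u') u'' \<le> 2 * r \<and> hdist K (add K w w') w'' \<le> 2 * r"
    using lgraph_add[OF 1(1) 2(1)] by blast
qed (use assms[THEN cl_graph_in] in auto)

lemma cl_graph_csc:
  assumes "(u, w) \<in> cl_graph"
  shows "(csc H z u, csc K z w) \<in> cl_graph"
proof (rule cl_graphI[where C = "cmod z"])
  fix r :: real assume r: "r > 0"
  obtain v x where 1: "(v, x) \<in> G" "v \<in> carrier H" "x \<in> carrier K" "hdist H u v < r" "hdist K w x < r"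
    using cl_graph_approx[OF assms(1) r] .
  have "hdist H (csc H z u) (csc H z v) \<le> cmod z * r" "hdist K (csc K z w) (csc K z x) \<le> cmod z * r"
    using 1 assms[THEN cl_graph_in] by (auto simp: H.hdist_csc K.hdist_csc intro: mult_left_mono)
  then show "\<exists>u'' w''. (u'', w'') \<in> G \<and> hdist H (csc H z u) u'' \<le> cmod z * r \<and> hdist K (csc K z w) w'' \<le> cmod z * r"
    using lgraph_csc[OF 1(1)] by blast
qed (use assms[THEN cl_graph_in] in auto)

lemma cl_graph_act:
  assumes "(u, w) \<in> cl_graph"
  shows "(act H u a, act K w a) \<in> cl_graph"
proof (rule cl_graphI[where C = "norm a"])
  fix r :: real assume r: "r > 0"
  obtain v x where 1: "(v, x) \<in> G" "v \<in> carrier H" "x \<in> carrier K" "hdist H u v < r" "hdist K w x < r"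
    using cl_graph_approx[OF assms(1) r] .
  have "hdist H (act H u a) (act H v a) \<le> hdist H u v * norm a" "hdist K (act K w a) (act K x a) \<le> hdist K w x * norm a"
    using 1 assms[THEN cl_graph_in] by (auto intro: H.hdist_act_le K.hdist_act_le)
  moreover have "hdist H u v * norm a \<le> norm a * r" "hdist K w x * norm a \<le> norm a * r"
    using 1 by (simp_all add: mult.commute[of _ "norm a"] mult_left_mono)
  ultimately show "\<exists>u'' w''. (u'', w'') \<in> G \<and> hdist H (act H u a) u'' \<le> norm a * r \<and> hdist K (act K w a) w'' \<le> norm a * r"
    using G_act[OF 1(1)] by (meson order_trans)
qed (use assms[THEN cl_graph_in] in auto)

lemma cl_graph_bound:
  assumes "(u, w) \<in> cl_graph"
  shows "hnorm K w \<le> M * hnorm H u"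
proof (rule field_le_epsilon)
  fix s :: real assume "s > 0"
  define r where "r = s / (M + 1)"
  have r: "r > 0" using \<open>s > 0\<close> M0 by (simp add: r_def)
  obtain v x where 1: "(v, x) \<in> G" "v \<in> carrier H" "x \<in> carrier K" "hdist H u v < r" "hdist K w x < r"
    using cl_graph_approx[OF assms(1) r] .
  have "hnorm K w \<le> hnorm K x + r"
    using K.abs_hnorm_diff_le[of w x] 1 cl_graph_in[OF assms] by auto
  also have "\<dots> \<le> M * hnorm H v + r" using G_bound[OF 1(1)] by simp
  also have "\<dots> \<le> M * (hnorm H u + r) + r"
    using H.abs_hnorm_diff_le[of u v] 1 cl_graph_in[OF assms] M0 by (auto intro!: mult_left_mono)
  also have "\<dots> = M * hnorm H u + (M + 1) * r" by (simp add: algebra_simps)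
  also have "(M + 1) * r = s" using M0 by (simp add: r_def)
  finally show "hnorm K w \<le> M * hnorm H u + s" .
qed

text \<open>The difference of two pairs over \<open>u\<close> is a pair over a vector of norm zero,
  and the bound M forces its second component to have norm zero as well.\<close>

lemma cl_graph_unique:
  assumes "(u, w) \<in> cl_graph" "(u, w') \<in> cl_graph"
  shows "w = w'"
proof (rule hilbert_eqI[OF K])
  have "(hdiff H u u, hdiff K w w') \<in> cl_graph"
    unfolding hdiff_def by (intro cl_graph_add cl_graph_csc assms)
  then have "hdist K w w' \<le> M * hdist H u u" unfolding hdist_def by (rule cl_graph_bound)
  then show "hdist K w w' = 0"
    using cl_graph_in[OF assms(1)] K.hdist_nonneg[of w w'] by simp
qed (use assms[THEN cl_graph_in] in auto)

text \<open>Approximate \<open>u\<close> from the span and pick partners in the graph. Differences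
  stay in the graph, so its bound makes the partners Cauchy; their limit is the value at
  \<open>u\<close>.\<close>

lemma cl_graph_total:
  assumes u: "u \<in> carrier H"
  shows "\<exists>w. (u, w) \<in> cl_graph"
proof -
  have span: "\<exists>w. (v, w) \<in> G" if "v \<in> hspan H (e ` I)" for v
    using that by induction (blast intro: lgraph.intros)+
  have "\<exists>v w. (v, w) \<in> G \<and> hdist H u v < inverse (real (Suc n))" for n
  proof -
    have "inverse (real (Suc n)) > 0" by simp
    then obtain v where "v \<in> hspan H (e ` I)" "hdist H u v < inverse (real (Suc n))"
      using total_e u unfolding total_def by blast
    then show ?thesis using span by blast
  qed
  then obtain v w where vw: "\<And>n. (v n, w n) \<in> G" "\<And>n. hdist H u (v n) < inverse (real (Suc n))" by metis
  have in': "v n \<in> carrier H" "w n \<in> carrier K" for n using G_in[OF vw(1)] by auto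
  have wd: "hdist K (w m) (w n) \<le> M * (inverse (real (Suc m)) + inverse (real (Suc n)))" for m n
  proof -
    have "(hdiff H (v m) (v n), hdiff K (w m) (w n)) \<in> G"
      unfolding hdiff_def by (intro lgraph_add lgraph_csc vw(1))
    then have "hdist K (w m) (w n) \<le> M * hdist H (v m) (v n)" unfolding hdist_def by (rule G_bound)
    also have "hdist H (v m) (v n) \<le> hdist H u (v m) + hdist H u (v n)"
      using H.hdist_triangle[of "v m" u "v n"] H.hdist_commute[of u "v m"] u in' by simp
    then have "M * hdist H (v m) (v n) \<le> M * (inverse (real (Suc m)) + inverse (real (Suc n)))"
      using vw(2)[of m] vw(2)[of n] M0 by (intro mult_left_mono) auto
    finally show ?thesis .
  qed
  have "hCauchy K w"
    unfolding K.hCauchy_iff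
  proof (intro conjI allI impI in')
    fix r :: real assume "r > 0"
    define s where "s = r / (2 * (M + 1))"
    have s: "s > 0" using \<open>r > 0\<close> M0 by (simp add: s_def)
    obtain N where N: "\<forall>n\<ge>N. inverse (real (Suc n)) < s"
      using LIMSEQ_D[OF LIMSEQ_inverse_real_of_nat s] by auto
    have "hdist K (w m) (w n) < r" if "m \<ge> N" "n \<ge> N" for m n
    proof -
      have "M * (inverse (real (Suc m)) + inverse (real (Suc n))) \<le> M * (2 * s)"
        using N[rule_format, OF that(1)] N[rule_format, OF that(2)] M0 by (intro mult_left_mono) linarith+
      also have "\<dots> < (M + 1) * (2 * s)" using s by simp
      also have "\<dots> = r" using M0 by (simp add: s_def field_simps)
      finally show ?thesis using wd[of m n] by simp
    qed
    then show "\<exists>N. \<forall>m\<ge>N. \<forall>n\<ge>N. hdist K (w m) (w n) < r" by blast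
  qed
  then obtain x where x: "x \<in> carrier K" "(\<lambda>n. hdist K (w n) x) \<longlonglongrightarrow> 0"
    using hilbert_module.complete[OF K] unfolding hdist_def by blast
  have "(u, x) \<in> cl_graph"
  proof (rule cl_graphI[where C = 1, OF u x(1)])
    fix r :: real assume r: "r > 0"
    obtain N where N: "\<forall>n\<ge>N. inverse (real (Suc n)) < r"
      using LIMSEQ_D[OF LIMSEQ_inverse_real_of_nat r] by auto
    obtain N' where N': "\<forall>n\<ge>N'. hdist K (w n) x < r" using LIMSEQ_D[OF x(2) r] by auto
    define n where "n = max N N'"
    have "hdist H u (v n) \<le> 1 * r" "hdist K x (w n) \<le> 1 * r"
      using N[rule_format, of n] N'[rule_format, of n] vw(2)[of n] K.hdist_commute[OF x(1) in'(2)]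
      by (auto simp: n_def)
    then show "\<exists>u' w'. (u', w') \<in> G \<and> hdist H u u' \<le> 1 * r \<and> hdist K x w' \<le> 1 * r"
      using vw(1) by blast
  qed
  then show ?thesis by blast
qed

theorem extension_exists:
  "\<exists>f. bounded_map H K f M \<and> (\<forall>i\<in>I. f (e i) = \<phi> i)"
proof -
  obtain f where f: "\<And>u. u \<in> carrier H \<Longrightarrow> (u, f u) \<in> cl_graph"
    using cl_graph_total by metis
  have uniq: "f u = w" if "(u, w) \<in> cl_graph" for u w
    using cl_graph_unique[OF f that] cl_graph_in[OF that] by blast
  have "module_map H K f"
    unfolding module_map_def
    using f[THEN cl_graph_in] by (auto intro!: uniq cl_graph_add cl_graph_csc cl_graph_act f)
  moreover have "f (e i) = \<phi> i" if "i \<in> I" for i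
    \<comment> \<open>On generators the pair lies in the graph itself, at distance zero.\<close>
    by (rule uniq, rule cl_graphI[where C = 0])
       (use that e_in \<phi>_in in \<open>auto intro!: exI lgraph_base\<close>)
  ultimately show ?thesis
    using cl_graph_bound[OF f] by (auto simp: bounded_map_def)
qed

end

section \<open>Adjoints and unitary extensions\<close>

lemma algebra_module_simps [simp]:
  "carrier algebra_module = UNIV" "zero algebra_module = 0" "add algebra_module = (+)"
  "csc algebra_module = (*\<^sub>C)" "act algebra_module = (*)" "inner algebra_module = (\<lambda>a b. star a * b)"
  by (simp_all add: algebra_module_def)

lemma hnorm_algebra_module: "hnorm algebra_module (a::'c::cstar_algebra) = norm a"
  by (simp add: hnorm_def cstar_identity)

lemma hdist_algebra_module: "hdist algebra_module a b = norm (a - b :: 'c::cstar_algebra)"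
  by (simp add: hdist_def hdiff_def hnorm_algebra_module)

lemma hilbert_algebra_module: "hilbert_module (algebra_module :: ('c::comm_cstar_algebra, 'c) hmod)"
proof -
  have nonneg: "cstar_nonneg (a * star a)" for a :: 'c
    using cstar_nonneg_star_mult[of a] by (simp add: mult.commute)
  interpret pre_hilbert "algebra_module :: ('c, 'c) hmod"
    by unfold_locales (auto simp: algebra_simps mult_scaleC_right star_mult star_star nonneg)
  show ?thesis
  proof (rule separated_complete_hilbert)
    fix s :: "nat \<Rightarrow> 'c" assume "hCauchy algebra_module s"
    then have "Cauchy s" by (simp add: hCauchy_iff hdist_algebra_module Cauchy_def dist_norm)
    then obtain l where "s \<longlonglongrightarrow> l" using Cauchy_convergent convergent_def by blast
    then show "\<exists>x\<in>carrier algebra_module. (\<lambda>n. hdist algebra_module (s n) x) \<longlonglongrightarrow> 0"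
      by (auto simp: hdist_algebra_module intro!: exI[of _ l] tendsto_norm_zero LIM_zero)
  qed (simp add: hdist_algebra_module)
qed

lemma (in pre_hilbert) bounded_map_inner:
  "x \<in> carrier H \<Longrightarrow> bounded_map H algebra_module (\<lambda>y. inner H x y) (hnorm H x)"
  by (simp add: bounded_map_def module_map_def inner_simps hnorm_algebra_module cauchy_schwarz)

lemma bounded_map_comp:
  assumes f: "bounded_map H K f M" and g: "bounded_map K L g N" and N: "0 \<le> N"
  shows "bounded_map H L (\<lambda>x. g (f x)) (N * M)"
proof -
  have mf: "module_map H K f" and mg: "module_map K L g" using f g by (simp_all add: bounded_map_def)
  have "hnorm L (g (f x)) \<le> N * M * hnorm H x" if "x \<in> carrier H" for x
  proof -
    have "hnorm L (g (f x)) \<le> N * hnorm K (f x)"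
      using g module_mapD(1)[OF mf that] by (simp add: bounded_map_def)
    also have "\<dots> \<le> N * (M * hnorm H x)"
      using f that N by (intro mult_left_mono) (simp_all add: bounded_map_def)
    finally show ?thesis by (simp add: mult.assoc)
  qed
  then show ?thesis
    using mf mg by (simp add: bounded_map_def module_map_def)
qed

lemma bounded_map_id: "bounded_map H H (\<lambda>x. x) 1"
  by (simp add: bounded_map_def module_map_id)

text \<open>Both sides are bounded maps into the algebra, in \<open>y\<close> and, after applying \<open>star\<close>, in \<open>x\<close>.\<close>

lemma adjoint_on_total:
  fixes H :: "('c::comm_cstar_algebra, 'u) hmod" and K :: "('c, 'v) hmod"
  assumes H: "hilbert_module H" and K: "hilbert_module K"
    and f: "bounded_map H K f M" and g: "bounded_map K H g N" and MN: "0 \<le> M" "0 \<le> N"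
    and S: "total H S" and R: "total K R"
    and eq: "\<And>s r. s \<in> S \<Longrightarrow> r \<in> R \<Longrightarrow> inner K (f s) r = inner H s (g r)"
    and x: "x \<in> carrier H" and y: "y \<in> carrier K"
  shows "inner K (f x) y = inner H x (g y)"
proof -
  interpret H: pre_hilbert H by (rule hilbert_pre_hilbert[OF H])
  interpret K: pre_hilbert K by (rule hilbert_pre_hilbert[OF K])
  have fin: "f u \<in> carrier K" if "u \<in> carrier H" for u
    using f that by (simp add: bounded_map_def module_map_def)
  have gin: "g u \<in> carrier H" if "u \<in> carrier K" for u
    using g that by (simp add: bounded_map_def module_map_def)
  have Sin: "S \<subseteq> carrier H" using S by (simp add: total_def)
  have 1: "inner K (f s) y = inner H s (g y)" if s: "s \<in> S" for s
  proof -
    have s': "s \<in> carrier H" using s Sin by blast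
    show ?thesis
      by (rule bounded_map_eqI[OF K hilbert_algebra_module K.bounded_map_inner[OF fin[OF s']]
            bounded_map_comp[OF g H.bounded_map_inner[OF s']] R eq[OF s] y]) simp_all
  qed
  have "inner K y (f x) = inner H (g y) x"
  proof (rule bounded_map_eqI[OF H hilbert_algebra_module bounded_map_comp[OF f K.bounded_map_inner[OF y]]
        H.bounded_map_inner[OF gin[OF y]] S _ x])
    fix s assume s: "s \<in> S"
    then have "s \<in> carrier H" using Sin by blast
    then show "inner K y (f s) = inner H (g y) s"
      using arg_cong[OF 1[OF s], of star] by (simp add: K.inner_conj H.inner_conj fin gin y)
  qed simp
  then show ?thesis
    by (metis H.inner_conj K.inner_conj fin gin x y)
qed

text \<open>Equal inner products of generators make the matrix in \<open>pos\<close> vanish for M =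
  1, in both directions. The two contractive extensions are inverse and adjoint to each other
  because they are so on generators.\<close>

theorem unitary_extension:
  fixes H :: "('c::comm_cstar_algebra, 'u) hmod" and K :: "('c, 'v) hmod"
  assumes H: "hilbert_module H" and K: "hilbert_module K"
    and e: "total H (e ` I)" and \<phi>: "total K (\<phi> ` I)"
    and isom: "\<And>i j. i \<in> I \<Longrightarrow> j \<in> I \<Longrightarrow> inner K (\<phi> i) (\<phi> j) = inner H (e i) (e j)"
    and act: "\<And>i a. i \<in> I \<Longrightarrow> \<exists>j\<in>I. e j = act H (e i) a \<and> \<phi> j = act K (\<phi> i) a"
  shows "\<exists>f g. bounded_map H K f 1 \<and> bounded_map K H g 1 \<and> (\<forall>i\<in>I. f (e i) = \<phi> i) \<and>
    (\<forall>x\<in>carrier H. g (f x) = x) \<and> (\<forall>y\<in>carrier K. f (g y) = y) \<and>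
    (\<forall>x\<in>carrier H. \<forall>y\<in>carrier K. inner K (f x) y = inner H x (g y))"
proof -
  have in': "e i \<in> carrier H" "\<phi> i \<in> carrier K" if "i \<in> I" for i
    using e \<phi> that by (auto simp: total_def)
  have act': "\<exists>j\<in>I. \<phi> j = act K (\<phi> i) a \<and> e j = act H (e i) a" if "i \<in> I" for i a
    using act[OF that] by blast
  interpret HK: extension_data H K I e \<phi> 1
    by (rule extension_data.intro[OF H K e])
       (use in' act isom in \<open>auto simp: subset_iff intro!: sum.neutral\<close>)
  interpret KH: extension_data K H I \<phi> e 1
    by (rule extension_data.intro[OF K H \<phi>])
       (use in' act' isom in \<open>auto simp: subset_iff intro!: sum.neutral\<close>)
  obtain f where f: "bounded_map H K f 1" "\<forall>i\<in>I. f (e i) = \<phi> i" using HK.extension_exists by blast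
  obtain g where g: "bounded_map K H g 1" "\<forall>i\<in>I. g (\<phi> i) = e i" using KH.extension_exists by blast
  have "g (f x) = x" if "x \<in> carrier H" for x
    by (rule bounded_map_eqI[OF H H bounded_map_comp[OF f(1) g(1)] bounded_map_id e _ that]) (use f g in auto)
  moreover have "f (g y) = y" if "y \<in> carrier K" for y
    by (rule bounded_map_eqI[OF K K bounded_map_comp[OF g(1) f(1)] bounded_map_id \<phi> _ that]) (use f g in auto)
  moreover have "inner K (f x) y = inner H x (g y)" if "x \<in> carrier H" "y \<in> carrier K" for x y
    by (rule adjoint_on_total[OF H K f(1) g(1) _ _ e \<phi> _ that]) (use f g isom in auto)
  ultimately show ?thesis using f g by blast
qed

section \<open>Bounded maps contract the algebra-valued inner product\<close>

text \<open>Apply the norm bound to \<open>x (\<langle>x|x\<rangle> + \<epsilon>)\<^bsup>-1/2\<^esup>\<close>, which has norm at most one.\<close>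

lemma bounded_map_inner_le:
  fixes E :: "('c::comm_cstar_algebra, 'u) hmod" and F :: "('c, 'v) hmod"
  assumes E: "pre_hilbert E" and F: "pre_hilbert F" and f: "bounded_map E F f M" and M: "0 \<le> M"
    and v: "v \<in> carrier E"
  shows "cstar_nonneg (M\<^sup>2 *\<^sub>R inner E v v - inner F (f v) (f v))"
proof -
  interpret E: pre_hilbert E by fact
  interpret F: pre_hilbert F by fact
  have mf: "module_map E F f" using f by (simp add: bounded_map_def)
  define p d where "p = unz (inner E v v)" and "d = unz (inner F (f v) (f v))"
  have fv: "f v \<in> carrier F" using module_mapD(1)[OF mf v] .
  have p: "cstar_nonneg p" and d: "cstar_nonneg d"
    using E.inner_self_nonneg[OF v] F.inner_self_nonneg[OF fv] by (simp_all add: p_def d_def)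
  have eps: "cstar_nonneg (M\<^sup>2 *\<^sub>R (p + \<epsilon> *\<^sub>R 1) - d)" if \<epsilon>: "0 < \<epsilon>" for \<epsilon>
  proof -
    obtain g where g: "cstar_nonneg g" "g * (p + \<epsilon> *\<^sub>R 1) = 1"
      using cstar_inverse_exists[of "p + \<epsilon> *\<^sub>R 1" \<epsilon>] p \<epsilon> by auto
    \<comment> \<open>As \<open>b\<close> is (p + \<epsilon>)^{-1/2}, the vector \<open>w\<close>
      below plays the role of v b and satisfies <w|w> = g p.\<close>
    obtain b where b: "star b = b" "b * b = g" using cstar_nonneg_sqrt[OF g(1)] .
    obtain w where w: "w \<in> carrier E" "\<And>x. x \<in> carrier E \<Longrightarrow> unz (inner E x w) = unz (inner E x v) * b"
      "\<And>x. x \<in> carrier F \<Longrightarrow> unz (inner F x (f w)) = unz (inner F x (f v)) * b"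
      using unitization_combination[OF E F mf, of "{()}" "\<lambda>_. v" "\<lambda>_. b"] v by auto
    have fw: "f w \<in> carrier F" using module_mapD(1)[OF mf w(1)] .
    have ww: "unz (inner E w w) = g * p"
    proof -
      have "unz (inner E w v) = star (unz (inner E v w))" using v w(1) by (simp add: unz_simps(6)[symmetric] E.inner_conj)
      also have "\<dots> = b * p" using v cstar_nonneg_star[OF p] by (simp add: w(2) star_mult b p_def)
      finally show ?thesis using w(1) by (simp add: w(2) b(2)[symmetric] mult_ac)
    qed
    have fww: "unz (inner F (f w) (f w)) = g * d"
    proof -
      have "unz (inner F (f w) (f v)) = star (unz (inner F (f v) (f w)))"
        using fv fw by (simp add: unz_simps(6)[symmetric] F.inner_conj)
      also have "\<dots> = b * d" using fv cstar_nonneg_star[OF d] by (simp add: w(3) star_mult b d_def)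
      finally show ?thesis using fw by (simp add: w(3) b(2)[symmetric] mult_ac)
    qed
    \<comment> \<open>Positivity of 1 - g p puts \<open>w\<close> in the unit ball, so
      \<open>f w\<close> has norm at most M, that is, g d has norm at most M^2.\<close>
    have "1 - g * p = \<epsilon> *\<^sub>R g" using g(2) by (simp add: distrib_left diff_eq_eq add.commute)
    then have "cstar_nonneg (1 - g * p)" using g(1) \<epsilon> by (simp add: cstar_nonneg_scaleR)
    then have "norm (g * p) \<le> norm (1 :: 'c unitization)" by (rule norm_mono_unital[OF cstar_nonneg_mult[OF g(1) p]])
    then have "(hnorm E w)\<^sup>2 \<le> 1" using ww norm_Unz_alg[of "inner E w w"] by (simp add: E.hnorm_square)
    then have "hnorm E w \<le> 1" by (simp add: abs_square_le_1)
    then have "M * hnorm E w \<le> M * 1" using M by (intro mult_left_mono)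
    then have "hnorm F (f w) \<le> M" using f w(1) by (force simp: bounded_map_def)
    then have "(hnorm F (f w))\<^sup>2 \<le> M\<^sup>2" by (simp add: power_mono)
    then have le: "norm (g * d) \<le> M\<^sup>2" 
      using fww norm_Unz_alg[of "inner F (f w) (f w)"] by (simp add: F.hnorm_square)
    have "cstar_nonneg (norm (g * d) *\<^sub>R 1 - g * d + (M\<^sup>2 - norm (g * d)) *\<^sub>R 1)"
      using le cstar_nonneg_star[OF cstar_nonneg_mult[OF g(1) d]]
      by (intro cstar_nonneg_add cstar_nonneg_norm_minus_selfadjoint cstar_nonneg_scaleR) auto
    then have "cstar_nonneg (M\<^sup>2 *\<^sub>R 1 - g * d)" by (simp add: scaleR_diff_left)
    moreover have "cstar_nonneg (p + \<epsilon> *\<^sub>R 1)"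
      using p \<epsilon> by (intro cstar_nonneg_add cstar_nonneg_scaleR) auto
    \<comment> \<open>Multiplication by p + \<epsilon> cancels \<open>g\<close> and leaves M^2 (p +
      \<epsilon>) - d.\<close>
    ultimately have "cstar_nonneg ((M\<^sup>2 *\<^sub>R 1 - g * d) * (p + \<epsilon> *\<^sub>R 1))" by (rule cstar_nonneg_mult)
    moreover have "(g * d) * (p + \<epsilon> *\<^sub>R 1) = d" using g(2) by (metis mult.assoc mult.commute mult.left_neutral)
    ultimately show ?thesis by (simp add: left_diff_distrib)
  qed
  have "cstar_nonneg (M\<^sup>2 *\<^sub>R (p + 0 *\<^sub>R 1) - d)"
  proof (rule cstar_nonneg_LIMSEQ)
    show "(\<lambda>n. M\<^sup>2 *\<^sub>R (p + inverse (real (Suc n)) *\<^sub>R 1) - d) \<longlonglongrightarrow> M\<^sup>2 *\<^sub>R (p + 0 *\<^sub>R 1) - d"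
      by (intro tendsto_intros LIMSEQ_inverse_real_of_nat)
  qed (simp add: eps)
  then have "cstar_nonneg (unz (M\<^sup>2 *\<^sub>R inner E v v - inner F (f v) (f v)))"
    by (simp add: p_def d_def unz_simps)
  then show ?thesis by (simp only: cstar_nonneg_unz_iff)
qed

text \<open>One vector \<open>v\<close> represents the combination of the \<open>y i\<close>, while
  \<open>f v\<close> represents that of the \<open>f (y i)\<close> with the same coefficients. The
  form therefore collapses to M^2 <v|v> - <f v|f v>.\<close>

lemma psd_bounded_map:
  fixes E :: "('c::comm_cstar_algebra, 'u) hmod" and F :: "('c, 'v) hmod"
  assumes E: "pre_hilbert E" and F: "pre_hilbert F" and f: "bounded_map E F f M" and M: "0 \<le> M"
    and I: "finite I" and y: "\<And>i. i \<in> I \<Longrightarrow> y i \<in> carrier E"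
  shows "psd I (\<lambda>i j. unz (M\<^sup>2 *\<^sub>R inner E (y i) (y j) - inner F (f (y i)) (f (y j))))"
  unfolding psd_def
proof (intro conjI ballI allI)
  interpret E: pre_hilbert E by fact
  interpret F: pre_hilbert F by fact
  have mf: "module_map E F f" using f by (simp add: bounded_map_def)
  have fy: "f (y i) \<in> carrier F" if "i \<in> I" for i using module_mapD(1)[OF mf y[OF that]] .
  show "star (unz (M\<^sup>2 *\<^sub>R inner E (y i) (y j) - inner F (f (y i)) (f (y j))))
      = unz (M\<^sup>2 *\<^sub>R inner E (y j) (y i) - inner F (f (y j)) (f (y i)))" if "i \<in> I" "j \<in> I" for i j
    using that y fy by (simp add: unz_simps(6)[symmetric] star_diff star_scaleR E.inner_conj F.inner_conj)
  fix a
  obtain v where v: "v \<in> carrier E"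
    "\<forall>w\<in>carrier E. unz (inner E w v) = (\<Sum>i\<in>I. unz (inner E w (y i)) * a i)"
    "\<forall>w\<in>carrier F. unz (inner F w (f v)) = (\<Sum>i\<in>I. unz (inner F w (f (y i))) * a i)"
    using unitization_combination[OF E F mf I, of y a] y by blast
  have 1: "(\<Sum>i\<in>I. \<Sum>j\<in>I. star (a i) * unz (inner E (y i) (y j)) * a j) = unz (inner E v v)"
    by (rule gram_form[OF E v(1)]) (use v y in auto)
  have 2: "(\<Sum>i\<in>I. \<Sum>j\<in>I. star (a i) * unz (inner F (f (y i)) (f (y j))) * a j) = unz (inner F (f v) (f v))"
    by (rule gram_form[OF F module_mapD(1)[OF mf v(1)]]) (use v fy in auto)
  have "(\<Sum>i\<in>I. \<Sum>j\<in>I. star (a i) * unz (M\<^sup>2 *\<^sub>R inner E (y i) (y j) - inner F (f (y i)) (f (y j))) * a j)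
      = unz (M\<^sup>2 *\<^sub>R inner E v v - inner F (f v) (f v))"
    unfolding unz_simps 1[symmetric] 2[symmetric]
    by (simp add: right_diff_distrib left_diff_distrib sum_subtractf scaleR_sum_right)
  then show "cstar_nonneg (\<Sum>i\<in>I. \<Sum>j\<in>I. star (a i) *
      unz (M\<^sup>2 *\<^sub>R inner E (y i) (y j) - inner F (f (y i)) (f (y j))) * a j)"
    using bounded_map_inner_le[OF E F f M v(1)] by (simp only: cstar_nonneg_unz_iff)
qed

section \<open>Elementary tensors\<close>

text \<open>Applied to an elementary tensor with one factor held fixed: a Lipschitz linear map
  carries approximations from the span of \<open>X\<close> to approximations from the span of
  \<open>R\<close>.\<close>

lemma (in pre_hilbert) linear_image_approx:
  assumes h: "h (zero H) = zero K"
    "\<And>u v. u \<in> carrier H \<Longrightarrow> v \<in> carrier H \<Longrightarrow> h (add H u v) = add K (h u) (h v)"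
    "\<And>u z. u \<in> carrier H \<Longrightarrow> h (csc H z u) = csc K z (h u)"
    and lip: "\<And>x u. x \<in> carrier H \<Longrightarrow> u \<in> carrier H \<Longrightarrow> hdist K (h x) (h u) \<le> C * hdist H x u"
    and C: "0 \<le> C" and X: "total H X" and R: "\<And>x. x \<in> X \<Longrightarrow> h x \<in> R" and x: "x \<in> carrier H" and r: "0 < r"
  shows "\<exists>u\<in>hspan K R. hdist K (h x) u < r"
proof -
  have Xin: "X \<subseteq> carrier H" using X by (simp add: total_def)
  have "r / (C + 1) > 0" using r C by simp
  then obtain u where u: "u \<in> hspan H X" "hdist H x u < r / (C + 1)" using X x unfolding total_def by blast
  have "h u \<in> hspan K R"
    using u(1) by induction (simp_all add: h hspan_in[OF _ Xin] R hspan.intros)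
  moreover have "hdist K (h x) (h u) < r"
  proof -
    have "hdist K (h x) (h u) \<le> C * hdist H x u" by (rule lip[OF x hspan_in[OF u(1) Xin]])
    also have "\<dots> \<le> C * (r / (C + 1))" using u C by (intro mult_left_mono) auto
    also have "\<dots> < r" using r C by (simp add: pos_divide_less_eq algebra_simps)
    finally show ?thesis .
  qed
  ultimately show ?thesis by blast
qed

context tensor_pair
begin

abbreviation "et p \<equiv> elem_tensor E F (fst p) (snd p)"

lemma of_formal_hspan:
  assumes "f \<in> FS"
  shows "of_formal f \<in> hspan T (et ` (carrier E \<times> carrier F))"
proof -
  have "Poly_Mapping.keys f \<subseteq> carrier E \<times> carrier F" using assms by (simp add: formal_sums_def)
  then show ?thesis
  proof (induction f rule: formal_sum_induct)
    case zero
    then show ?case using hspan_zero[of T] by (simp add: of_formal_zero)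
  next
    case (add f k z)
    have k: "fst k \<in> carrier E" "snd k \<in> carrier F" "Poly_Mapping.single k 1 \<in> FS" "Poly_Mapping.single k z \<in> FS"
      using add.hyps by (auto simp: formal_sums_def)
    have fFS: "f \<in> FS" using add.hyps by (simp add: formal_sums_def)
    have "Poly_Mapping.single k z = Poly_Mapping.map ((*) z) (Poly_Mapping.single k 1)"
      by (rule poly_mapping_eqI) (simp add: lookup_map_scale lookup_single when_def)
    then have "of_formal (Poly_Mapping.single k z) = csc T z (et k)"
      using of_formal_csc[OF k(3), of z] by (simp add: elem_tensor_of_formal)
    then have eq: "of_formal (f + Poly_Mapping.single k z) = add T (of_formal f) (csc T z (et k))"
      using of_formal_add[OF fFS k(4)] by simp
    have "et k \<in> et ` (carrier E \<times> carrier F)" using add.hyps by blast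
    then show ?case unfolding eq by (intro hspan_add hspan_csc hspan_base add.IH)
  qed
qed

lemma total_elem: "total T (et ` (carrier E \<times> carrier F))"
  unfolding total_def using of_formal_dense of_formal_hspan by (fastforce intro: elem_in)

lemma elem_eqI:
  assumes "v \<in> carrier T" "w \<in> carrier T"
    and "\<And>x y. x \<in> carrier E \<Longrightarrow> y \<in> carrier F \<Longrightarrow> inner T (elem_tensor E F x y) v = inner T (elem_tensor E F x y) w"
  shows "v = w"
  by (rule total_inner_eqI[OF hilbert_tensor total_elem assms(1,2)]) (auto intro: assms(3))

text \<open>Both sides have the same inner products with all elementary tensors. For the action on
  the left factor this uses commutativity, since the tensor product is defined with the action on
  the right factor.\<close>

lemma elem_linear:
  assumes "x \<in> carrier E" "y \<in> carrier F"
  shows "x' \<in> carrier E \<Longrightarrow> elem_tensor E F (add E x x') y = add T (elem_tensor E F x y) (elem_tensor E F x' y)"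
    "y' \<in> carrier F \<Longrightarrow> elem_tensor E F x (add F y y') = add T (elem_tensor E F x y) (elem_tensor E F x y')"
    "elem_tensor E F (csc E z x) y = csc T z (elem_tensor E F x y)"
    "elem_tensor E F x (csc F z y) = csc T z (elem_tensor E F x y)"
    "elem_tensor E F (act E x a) y = act T (elem_tensor E F x y) a"
    "elem_tensor E F x (act F y a) = act T (elem_tensor E F x y) a"
    "elem_tensor E F (zero E) y = zero T"
    "elem_tensor E F x (zero F) = zero T"
  using assms
  by (auto intro!: elem_eqI simp: T.inner_simps E.inner_simps F.inner_simps inner_elem algebra_simps
      mult_scaleC_left mult_scaleC_right)

lemma hnorm_elem_le:
  assumes "x \<in> carrier E" "y \<in> carrier F"
  shows "hnorm T (elem_tensor E F x y) \<le> hnorm E x * hnorm F y"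
proof (rule power2_le_imp_le)
  show "(hnorm T (elem_tensor E F x y))\<^sup>2 \<le> (hnorm E x * hnorm F y)\<^sup>2"
    using assms norm_mult_ineq[of "inner E x x" "inner F y y"]
    by (simp add: T.hnorm_square inner_elem power_mult_distrib E.hnorm_square F.hnorm_square)
qed simp

lemma hdist_elem_le:
  assumes "x \<in> carrier E" "x' \<in> carrier E" "y \<in> carrier F" "y' \<in> carrier F"
  shows "hdist T (elem_tensor E F x y) (elem_tensor E F x' y) \<le> hdist E x x' * hnorm F y"
    "hdist T (elem_tensor E F x y) (elem_tensor E F x y') \<le> hnorm E x * hdist F y y'"
proof -
  have "hdiff T (elem_tensor E F x y) (elem_tensor E F x' y) = elem_tensor E F (hdiff E x x') y"
    "hdiff T (elem_tensor E F x y) (elem_tensor E F x y') = elem_tensor E F x (hdiff F y y')"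
    using assms by (simp_all add: hdiff_def elem_linear)
  then show "hdist T (elem_tensor E F x y) (elem_tensor E F x' y) \<le> hdist E x x' * hnorm F y"
    "hdist T (elem_tensor E F x y) (elem_tensor E F x y') \<le> hnorm E x * hdist F y y'"
    using assms by (simp_all add: hdist_def hnorm_elem_le)
qed

text \<open>The factors are replaced one at a time, through the intermediate family with
  \<open>X\<close> on the left and all of \<open>F\<close> on the right.\<close>

lemma total_elem_pair:
  assumes X: "total E X" and Y: "total F Y"
  shows "total T (et ` (X \<times> Y))"
proof (rule T.total_approx)
  have in': "X \<subseteq> carrier E" "Y \<subseteq> carrier F" using X Y by (simp_all add: total_def)
  show "total T (et ` (X \<times> carrier F))"
  proof (rule T.total_approx[OF total_elem])
    fix t and r :: real assume "t \<in> et ` (carrier E \<times> carrier F)" and r: "0 < r"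
    then obtain x y where xy: "x \<in> carrier E" "y \<in> carrier F" "t = elem_tensor E F x y" by auto
    show "\<exists>u\<in>hspan T (et ` (X \<times> carrier F)). hdist T t u < r"
      unfolding xy(3)
    proof (rule E.linear_image_approx[where h = "\<lambda>x. elem_tensor E F x y", OF _ _ _ _ F.hnorm_nonneg X _ xy(1) r])
      show "hdist T (elem_tensor E F x y) (elem_tensor E F u y) \<le> hnorm F y * hdist E x u"
        if "x \<in> carrier E" "u \<in> carrier E" for x u
        using hdist_elem_le(1)[OF that xy(2,2)] by (simp add: mult.commute)
    qed (use xy in \<open>auto simp: elem_linear intro!: image_eqI[of _ et "(_, y)"]\<close>)
  qed (use X in \<open>auto simp: total_def\<close>)
  show "et ` (X \<times> Y) \<subseteq> carrier T" using in' by (auto intro!: elem_in)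
  fix t and r :: real assume "t \<in> et ` (X \<times> carrier F)" and r: "0 < r"
  then obtain x y where xy: "x \<in> X" "x \<in> carrier E" "y \<in> carrier F" "t = elem_tensor E F x y" using in' by auto
  show "\<exists>u\<in>hspan T (et ` (X \<times> Y)). hdist T t u < r"
    unfolding xy(4)
    by (rule F.linear_image_approx[where h = "elem_tensor E F x", OF _ _ _ hdist_elem_le(2) E.hnorm_nonneg Y _ xy(3) r])
      (use xy in \<open>auto simp: elem_linear intro!: image_eqI[of _ et "(x, _)"]\<close>)
qed

end

text \<open>The positivity required for the extension comes from splitting the defect as N^2 PE
  <y|y'> + QF <f x|f x'>, where PE and QF are the defect matrices of f and g. Both terms are
  entrywise products of positive matrices.\<close>

lemma tensor_map_exists:
  fixes E F E' F' :: "('c::comm_cstar_algebra, 'x) umod"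
  assumes E: "hilbert_module E" and F: "hilbert_module F" and E': "hilbert_module E'" and F': "hilbert_module F'"
    and f: "bounded_map E E' f M" and g: "bounded_map F F' g N" and M: "0 \<le> M" and N: "0 \<le> N"
  shows "\<exists>h. bounded_map (tensor E F) (tensor E' F') h (M * N) \<and>
    (\<forall>x\<in>carrier E. \<forall>y\<in>carrier F. h (elem_tensor E F x y) = elem_tensor E' F' (f x) (g y))"
proof -
  interpret S: tensor_pair E F by (rule tensor_pair.intro) fact+
  interpret T: tensor_pair E' F' by (rule tensor_pair.intro) fact+
  note mf = f[unfolded bounded_map_def, THEN conjunct1] and mg = g[unfolded bounded_map_def, THEN conjunct1]
  define e where "e p = elem_tensor E F (fst p) (snd p)" for p
  define \<phi> where "\<phi> p = elem_tensor E' F' (f (fst p)) (g (snd p))" for p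
  interpret extension_data "tensor E F" "tensor E' F'" "carrier E \<times> carrier F" e \<phi> "M * N"
  proof (rule extension_data.intro)
    show "total (tensor E F) (e ` (carrier E \<times> carrier F))" using S.total_elem unfolding e_def .
    show "\<phi> p \<in> carrier (tensor E' F')" if "p \<in> carrier E \<times> carrier F" for p
      using that by (auto simp: \<phi>_def module_mapD[OF mf] module_mapD[OF mg])
    show "0 \<le> M * N" using M N by simp
    show "\<exists>q\<in>carrier E \<times> carrier F. e q = act (tensor E F) (e p) a \<and> \<phi> q = act (tensor E' F') (\<phi> p) a"
      if "p \<in> carrier E \<times> carrier F" for p a
      using that by (intro bexI[of _ "(fst p, act F (snd p) a)"])
        (auto simp: e_def \<phi>_def S.elem_linear T.elem_linear module_mapD[OF mf] module_mapD[OF mg])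
    fix p :: "('c, 'x) univ \<times> ('c, 'x) univ \<Rightarrow>\<^sub>0 complex"
    assume "Poly_Mapping.keys p \<subseteq> carrier E \<times> carrier F"
    then have keys: "fst k \<in> carrier E" "snd k \<in> carrier F" if "k \<in> Poly_Mapping.keys p" for k
      using that by auto
    let ?I = "Poly_Mapping.keys p"
    let ?c = "\<lambda>i j. cnj (Poly_Mapping.lookup p i) * Poly_Mapping.lookup p j"
    define PE where "PE i j = M\<^sup>2 *\<^sub>R inner E (fst i) (fst j) - inner E' (f (fst i)) (f (fst j))"
      for i j :: "('c, 'x) univ \<times> ('c, 'x) univ"
    define QF where "QF i j = N\<^sup>2 *\<^sub>R inner F (snd i) (snd j) - inner F' (g (snd i)) (g (snd j))"
      for i j :: "('c, 'x) univ \<times> ('c, 'x) univ"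
    have "cstar_nonneg (\<Sum>i\<in>?I. \<Sum>j\<in>?I. (?c i j *\<^sub>C unz (PE i j)) * unz (inner F (snd i) (snd j)))"
      unfolding PE_def
      by (intro schur_product_nonneg psd_scale psd_bounded_map psd_gram finite_keys keys
          S.E.pre_hilbert_axioms T.E.pre_hilbert_axioms S.F.pre_hilbert_axioms f M)
    then have 1: "cstar_nonneg (N\<^sup>2 *\<^sub>R (\<Sum>i\<in>?I. \<Sum>j\<in>?I. (?c i j *\<^sub>C unz (PE i j)) * unz (inner F (snd i) (snd j))))"
      by (intro cstar_nonneg_scaleR) auto
    have 2: "cstar_nonneg (\<Sum>i\<in>?I. \<Sum>j\<in>?I. (?c i j *\<^sub>C unz (QF i j)) * unz (inner E' (f (fst i)) (f (fst j))))"
      unfolding QF_def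
      by (intro schur_product_nonneg psd_scale psd_bounded_map psd_gram[where y = "\<lambda>i. f (fst i)"] finite_keys keys
          S.F.pre_hilbert_axioms T.F.pre_hilbert_axioms T.E.pre_hilbert_axioms g N module_mapD(1)[OF mf])
    have eq: "?c i j *\<^sub>C ((M * N)\<^sup>2 *\<^sub>R inner (tensor E F) (e i) (e j) - inner (tensor E' F') (\<phi> i) (\<phi> j))
       = N\<^sup>2 *\<^sub>R (?c i j *\<^sub>C PE i j * inner F (snd i) (snd j)) + ?c i j *\<^sub>C QF i j * inner E' (f (fst i)) (f (fst j))"
      if "i \<in> ?I" "j \<in> ?I" for i j
    proof -
      have "(M * N)\<^sup>2 *\<^sub>R inner (tensor E F) (e i) (e j) - inner (tensor E' F') (\<phi> i) (\<phi> j)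
        = N\<^sup>2 *\<^sub>R (PE i j * inner F (snd i) (snd j)) + QF i j * inner E' (f (fst i)) (f (fst j))"
        using that keys by (simp add: e_def \<phi>_def S.inner_elem T.inner_elem PE_def QF_def module_mapD[OF mf] module_mapD[OF mg]
            power_mult_distrib algebra_simps)
      moreover have "z *\<^sub>C (r *\<^sub>R (a * b) + c * d) = r *\<^sub>R (z *\<^sub>C a * b) + z *\<^sub>C c * d" for z r and a b c d :: 'c
        by (simp add: scaleC_add_right scaleR_scaleC scaleC_scaleC mult_scaleC_left mult.commute[of z])
      ultimately show ?thesis by (simp only:)
    qed
    have "unz (\<Sum>i\<in>?I. \<Sum>j\<in>?I. ?c i j *\<^sub>C ((M * N)\<^sup>2 *\<^sub>R inner (tensor E F) (e i) (e j) - inner (tensor E' F') (\<phi> i) (\<phi> j)))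
      = N\<^sup>2 *\<^sub>R (\<Sum>i\<in>?I. \<Sum>j\<in>?I. (?c i j *\<^sub>C unz (PE i j)) * unz (inner F (snd i) (snd j)))
       + (\<Sum>i\<in>?I. \<Sum>j\<in>?I. (?c i j *\<^sub>C unz (QF i j)) * unz (inner E' (f (fst i)) (f (fst j))))"
      unfolding unz_sum scaleR_sum_right sum.distrib[symmetric]
      by (intro sum.cong refl) (simp add: eq unz_simps)
    then have "cstar_nonneg (unz (\<Sum>i\<in>?I. \<Sum>j\<in>?I. ?c i j *\<^sub>C ((M * N)\<^sup>2 *\<^sub>R inner (tensor E F) (e i) (e j) - inner (tensor E' F') (\<phi> i) (\<phi> j))))"
      using cstar_nonneg_add[OF 1 2] by (simp only:)
    then show "cstar_nonneg (\<Sum>i\<in>?I. \<Sum>j\<in>?I. ?c i j *\<^sub>C ((M * N)\<^sup>2 *\<^sub>R inner (tensor E F) (e i) (e j) - inner (tensor E' F') (\<phi> i) (\<phi> j)))"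
      by (simp only: cstar_nonneg_unz_iff)
  qed (rule S.hilbert_tensor T.hilbert_tensor)+
  show ?thesis using extension_exists by (auto simp: e_def \<phi>_def)
qed

section \<open>Adjointable maps are bounded\<close>

text \<open>The uniform boundedness principle, by the elementary argument of Sokal: for one of the two
  signs, moving \<open>x\<close> by \<open>\<plusminus>r z / \<parallel>z\<parallel>\<close> makes \<open>\<langle>z|x\<rangle>\<close> at least \<open>r \<parallel>z\<parallel>\<close> in norm.\<close>

lemma (in pre_hilbert) functional_large_nearby:
  assumes z: "z \<in> carrier H" and x: "x \<in> carrier H" and r: "0 \<le> r"
  shows "\<exists>x'\<in>carrier H. hdist H x x' \<le> r \<and> r * hnorm H z \<le> norm (inner H z x')"
proof (cases "hnorm H z = 0")
  case True
  then show ?thesis using x r by (intro bexI[of _ x]) auto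
next
  case False
  define u where "u = csc H (of_real (r / hnorm H z)) z"
  have u: "u \<in> carrier H" using z by (simp add: u_def)
  have nu: "hnorm H u = r" using z False r by (simp add: u_def hnorm_csc norm_divide)
  have zu: "norm (inner H z u) = r * hnorm H z"
    using z r False by (simp add: u_def inner_simps norm_scaleC norm_divide hnorm_square[symmetric] power2_eq_square)
  define a b where "a = inner H z (add H x u)" and "b = inner H z (add H x (csc H (-1) u))"
  have "2 *\<^sub>R inner H z u = a - b" using x u z by (simp add: a_def b_def inner_simps scaleR_2)
  then have "2 * norm (inner H z u) \<le> norm a + norm b"
    using norm_triangle_ineq4[of a b] by (metis abs_numeral norm_scaleR)
  then have "r * hnorm H z \<le> norm a \<or> r * hnorm H z \<le> norm b" using zu by linarith
  moreover have "hdist H x (add H x u) = r" "hdist H x (add H x (csc H (-1) u)) = r"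
    using x u nu by (simp_all add: hdist_def hnorm_def inner_simps)
  moreover have "add H x u \<in> carrier H" "add H x (csc H (-1) u) \<in> carrier H" using x u by simp_all
  ultimately show ?thesis unfolding a_def b_def by (metis order_refl)
qed

text \<open>The functionals given by z = g y / norm y are bounded at each x by the norm of f x. If g
  were unbounded, there would be z_n of norm at least 4^n. Steps of length at most (1/3)^n then lead
  to a point x where the n-th functional has norm at least (1/2) (4/3)^n, for all n.\<close>

lemma adjoint_bounded:
  fixes E :: "('c::comm_cstar_algebra, 'u) hmod" and F :: "('c, 'v) hmod"
  assumes E: "hilbert_module E" and F: "hilbert_module F"
    and f: "\<And>x. x \<in> carrier E \<Longrightarrow> f x \<in> carrier F" and g: "\<And>y. y \<in> carrier F \<Longrightarrow> g y \<in> carrier E"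
    and adj: "\<And>x y. x \<in> carrier E \<Longrightarrow> y \<in> carrier F \<Longrightarrow> inner F (f x) y = inner E x (g y)"
  shows "\<exists>K\<ge>0. \<forall>y\<in>carrier F. hnorm E (g y) \<le> K * hnorm F y"
proof (rule ccontr)
  interpret E: pre_hilbert E by (rule hilbert_pre_hilbert[OF E])
  interpret F: pre_hilbert F by (rule hilbert_pre_hilbert[OF F])
  assume unbounded: "\<not> ?thesis"
  have ex: "\<exists>y\<in>carrier F. hnorm E (g y) > 4 ^ n * hnorm F y" for n :: nat
  proof (rule ccontr)
    assume "\<not> ?thesis"
    then have "\<forall>y\<in>carrier F. hnorm E (g y) \<le> 4 ^ n * hnorm F y" by (simp add: not_less)
    moreover have "(0::real) \<le> 4 ^ n" by simp
    ultimately show False using unbounded by blast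
  qed
  have "\<exists>z\<in>carrier E. 4 ^ n \<le> hnorm E z \<and> (\<forall>x\<in>carrier E. norm (inner E z x) \<le> hnorm F (f x))" for n :: nat
  proof -
    obtain y where y: "y \<in> carrier F" "hnorm E (g y) > 4 ^ n * hnorm F y" using ex by blast
    have gy: "g y \<in> carrier E" using g y by blast
    have bound: "norm (inner E (g y) x) \<le> hnorm F y * hnorm F (f x)" if x: "x \<in> carrier E" for x
    proof -
      have "norm (inner E (g y) x) = norm (star (inner E (g y) x))" by simp
      also have "star (inner E (g y) x) = inner F (f x) y" using adj[OF x y(1)] by (simp add: E.inner_conj gy x)
      also have "norm \<dots> \<le> hnorm F (f x) * hnorm F y" by (rule F.cauchy_schwarz[OF f[OF x] y(1)])
      finally show ?thesis by (simp add: mult.commute)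
    qed
    \<comment> \<open>Needed to normalize: if \<open>y\<close> had norm zero, \<open>bound\<close>
      at \<open>g y\<close> would make \<open>g y\<close> have norm zero too, against the choice of
      \<open>y\<close>.\<close>
    have "hnorm F y \<noteq> 0"
    proof
      assume "hnorm F y = 0"
      then have "norm (inner E (g y) (g y)) \<le> 0" using bound[OF gy] by simp
      then have "hnorm E (g y) = 0" by (simp add: hnorm_def)
      then show False using y \<open>hnorm F y = 0\<close> by simp
    qed
    then have ny: "hnorm F y > 0" using F.hnorm_nonneg[of y] by linarith
    define z where "z = csc E (of_real (1 / hnorm F y)) (g y)"
    have "4 ^ n \<le> hnorm E z"
      using y(2) ny gy by (simp add: z_def E.hnorm_csc norm_divide field_simps)
    moreover have "norm (inner E z x) \<le> hnorm F (f x)" if x: "x \<in> carrier E" for x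
      using bound[OF x] ny gy x by (simp add: z_def E.inner_simps norm_scaleC norm_divide field_simps)
    ultimately show ?thesis using gy by (intro bexI[of _ z]) (auto simp: z_def)
  qed
  then obtain z where z: "\<And>n. z n \<in> carrier E" "\<And>n. 4 ^ n \<le> hnorm E (z n)"
    "\<And>n x. x \<in> carrier E \<Longrightarrow> norm (inner E (z n) x) \<le> hnorm F (f x)" by metis
  define Q where "Q n x x' \<longleftrightarrow> x' \<in> carrier E \<and> hdist E x x' \<le> (1/3) ^ n \<and>
      (1/3) ^ n * hnorm E (z n) \<le> norm (inner E (z n) x')" for n x x'
  define s where "s n x = (SOME x'. Q n x x')" for n x
  have "Q n x (s n x)" if "x \<in> carrier E" for n x
  proof -
    have "(0::real) \<le> (1/3) ^ n" by simp
    from E.functional_large_nearby[OF z(1) that this, of n] have "\<exists>x'. Q n x x'"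
      unfolding Q_def by blast
    then show ?thesis unfolding s_def by (rule someI_ex)
  qed
  then have s: "s n x \<in> carrier E" "hdist E x (s n x) \<le> (1/3) ^ n"
    "(1/3) ^ n * hnorm E (z n) \<le> norm (inner E (z n) (s n x))" if "x \<in> carrier E" for n x
    using that unfolding Q_def by blast+
  define X where "X = rec_nat (zero E) s"
  have X: "X 0 = zero E" "X (Suc n) = s n (X n)" for n by (simp_all add: X_def)
  have Xin: "X n \<in> carrier E" for n by (induction n) (simp_all add: X s)
  have step: "hdist E (X n) (X (Suc n)) \<le> (1/3) ^ n" for n using s(2)[OF Xin] by (simp add: X)
  have far: "hdist E (X n) (X (n + k)) \<le> (3/2) * (1/3) ^ n" for n k
  proof -
    \<comment> \<open>The partial geometric sum in closed form; without the last factor the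
      induction would not close.\<close>
    have "hdist E (X n) (X (n + k)) \<le> (3/2) * (1/3) ^ n * (1 - (1/3) ^ k)"
    proof (induction k)
      case (Suc k)
      have "hdist E (X n) (X (n + Suc k)) \<le> hdist E (X n) (X (n + k)) + hdist E (X (n + k)) (X (Suc (n + k)))"
        using E.hdist_triangle[OF Xin Xin Xin] by simp
      also have "\<dots> \<le> (3/2) * (1/3) ^ n * (1 - (1/3) ^ k) + (1/3) ^ (n + k)"
        by (intro add_mono Suc step)
      also have "\<dots> = (3/2) * (1/3) ^ n * (1 - (1/3) ^ Suc k)"
      proof -
        have "(3/2) * p * (1 - q) + p * q = (3/2) * p * (1 - 1/3 * q)" for p q :: real
          by (simp add: field_simps)
        then show ?thesis by (simp only: power_add power_Suc)
      qed
      finally show ?case .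
    qed (simp add: Xin)
    also have "\<dots> \<le> (3/2) * (1/3) ^ n * 1" by (intro mult_left_mono) auto
    finally show ?thesis by simp
  qed
  have "hCauchy E X"
    unfolding E.hCauchy_iff
  proof (intro conjI allI impI Xin)
    fix r :: real assume r: "r > 0"
    have "(\<lambda>n. (3/2) * (1/3::real) ^ n) \<longlonglongrightarrow> (3/2) * 0" by (intro tendsto_intros LIMSEQ_realpow_zero) auto
    from LIMSEQ_D[OF this r] obtain N where N: "\<forall>n\<ge>N. (3/2) * (1/3::real) ^ n < r" by auto
    have "hdist E (X m) (X n) < r" if "m \<ge> N" "n \<ge> N" for m n
    proof (cases "m \<le> n")
      case True
      then show ?thesis using far[of m "n - m"] N that by fastforce
    next
      case False
      then show ?thesis using far[of n "m - n"] N that E.hdist_commute[OF Xin Xin, of m n] by fastforce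
    qed
    then show "\<exists>N. \<forall>m\<ge>N. \<forall>n\<ge>N. hdist E (X m) (X n) < r" by blast
  qed
  then obtain x where x: "x \<in> carrier E" "(\<lambda>n. hdist E (X n) x) \<longlonglongrightarrow> 0"
    using hilbert_module.complete[OF E] unfolding hdist_def by blast
  have near: "hdist E (X n) x \<le> (3/2) * (1/3) ^ n" for n
  proof (rule field_le_epsilon)
    fix r :: real assume r: "r > 0"
    then obtain N where N: "\<forall>m\<ge>N. hdist E (X m) x < r" using LIMSEQ_D[OF x(2) r] by auto
    have "hdist E (X n) x \<le> hdist E (X n) (X (n + N)) + hdist E (X (n + N)) x"
      by (rule E.hdist_triangle[OF Xin Xin x(1)])
    also have "\<dots> \<le> (3/2) * (1/3) ^ n + r" using far[of n N] N by (intro add_mono) (auto intro: less_imp_le)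
    finally show "hdist E (X n) x \<le> (3/2) * (1/3) ^ n + r" .
  qed
  have big: "(1/2) * (4/3) ^ n \<le> hnorm F (f x)" for n
  proof -
    have "(1/3) ^ n * hnorm E (z n) \<le> norm (inner E (z n) (X (Suc n)))" using s(3)[OF Xin] by (simp add: X)
    also have "\<dots> \<le> norm (inner E (z n) x) + norm (inner E (z n) (X (Suc n)) - inner E (z n) x)"
      using norm_triangle_ineq[of "inner E (z n) x" "inner E (z n) (X (Suc n)) - inner E (z n) x"] by simp
    also have "norm (inner E (z n) (X (Suc n)) - inner E (z n) x) \<le> hnorm E (z n) * hdist E (X (Suc n)) x"
      using E.norm_inner_diff_le[of "z n" "X (Suc n)" "z n" x] z(1) Xin x by simp
    \<comment> \<open>The distance bound at n + 1 is (3/2) (1/3)^(n+1) = (1/2) (1/3)^n, so half of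
      the lower bound at \<open>X (Suc n)\<close> survives at \<open>x\<close>.\<close>
    also have "\<dots> \<le> hnorm E (z n) * ((1/2) * (1/3) ^ n)" using near[of "Suc n"] by (intro mult_left_mono) auto
    finally have "(1/2) * (1/3) ^ n * hnorm E (z n) \<le> norm (inner E (z n) x)" by (simp add: mult.commute)
    moreover have "(1/2) * (1/3) ^ n * 4 ^ n \<le> (1/2) * (1/3) ^ n * hnorm E (z n)" using z(2) by (intro mult_left_mono) auto
    moreover have "(1/3) ^ n * 4 ^ n = (4/3 :: real) ^ n" by (simp add: power_mult_distrib[symmetric])
    ultimately show ?thesis using z(3)[OF x(1), of n] by (simp add: mult.assoc)
  qed
  obtain n where "2 * hnorm F (f x) < (4/3) ^ n" using real_arch_pow[of "4/3"] by auto
  then show False using big[of n] by simp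
qed

text \<open>Linearity of \<open>g\<close> is read off from <x|g y> = <f x|y>, where \<open>y\<close>
  enters linearly.\<close>

lemma adjoint_bounded_map:
  fixes E :: "('c::comm_cstar_algebra, 'u) hmod" and F :: "('c, 'v) hmod"
  assumes E: "hilbert_module E" and F: "hilbert_module F"
    and f: "\<And>x. x \<in> carrier E \<Longrightarrow> f x \<in> carrier F" and g: "\<And>y. y \<in> carrier F \<Longrightarrow> g y \<in> carrier E"
    and adj: "\<And>x y. x \<in> carrier E \<Longrightarrow> y \<in> carrier F \<Longrightarrow> inner F (f x) y = inner E x (g y)"
  shows "\<exists>K\<ge>0. bounded_map F E g K"
proof -
  interpret E: pre_hilbert E by (rule hilbert_pre_hilbert[OF E])
  interpret F: pre_hilbert F by (rule hilbert_pre_hilbert[OF F])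
  have "module_map F E g"
    unfolding module_map_def
    by (auto intro!: hilbert_inner_eqI[OF E] simp: f g E.inner_simps F.inner_simps adj[symmetric])
  then show ?thesis using adjoint_bounded[OF E F f g adj] by (auto simp: bounded_map_def)
qed

section \<open>Coherence isomorphisms\<close>

lemma hilbert_tensor_unit: "hilbert_module (tensor_unit :: ('c::comm_cstar_algebra, 'x) umod)"
  unfolding tensor_unit_def by (rule hilbert_transport[OF hilbert_algebra_module]) (simp add: inj_on_def)

lemma tensor_unit_simps [simp]:
  fixes a b :: "'c::comm_cstar_algebra"
  shows "carrier (tensor_unit :: ('c, 'x) umod) = range Scalar"
    "act (tensor_unit :: ('c, 'x) umod) (Scalar a) b = Scalar (a * b)"
    "inner (tensor_unit :: ('c, 'x) umod) (Scalar a) (Scalar b) = star a * b"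
proof -
  have inj: "inj_on (Scalar :: 'c \<Rightarrow> ('c, 'x) univ) (carrier algebra_module)" by (simp add: inj_on_def)
  show "carrier (tensor_unit :: ('c, 'x) umod) = range Scalar"
    "act (tensor_unit :: ('c, 'x) umod) (Scalar a) b = Scalar (a * b)"
    "inner (tensor_unit :: ('c, 'x) umod) (Scalar a) (Scalar b) = star a * b"
    using transport_ops[OF inj] by (simp_all add: tensor_unit_def)
qed

text \<open>\<open>p (p + \<epsilon>)\<^bsup>-1\<^esup>\<close> with \<open>p = \<langle>v|v\<rangle>\<close> is an approximate unit for \<open>v\<close>.\<close>

lemma (in pre_hilbert) approximate_unit:
  assumes v: "v \<in> carrier H" and r: "0 < r"
  shows "\<exists>c. hdist H v (act H v c) < r"
proof -
  \<comment> \<open>The squared distance will be \<epsilon> times the norm of (p g) (\<epsilon> g),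
    and both factors are at most 1.\<close>
  define \<epsilon> where "\<epsilon> = (r / 2)\<^sup>2"
  have \<epsilon>: "\<epsilon> > 0" using r by (simp add: \<epsilon>_def)
  define p where "p = unz (inner H v v)"
  have p: "cstar_nonneg p" using inner_self_nonneg[OF v] by (simp add: p_def)
  obtain g where g: "cstar_nonneg g" "g * (p + \<epsilon> *\<^sub>R 1) = 1"
    using cstar_inverse_exists[of "p + \<epsilon> *\<^sub>R 1" \<epsilon>] p \<epsilon> by auto
  \<comment> \<open>The scalar part of \<open>p\<close> is zero, hence so is that of p g, and
    \<open>c\<close> is this product as an element of the algebra.\<close>
  define c where "c = alg_part (p * g)"
  have c: "unz c = p * g" by (simp add: c_def p_def unitization.expand)
  have gp: "1 - p * g = \<epsilon> *\<^sub>R g" using g(2) by (simp add: distrib_left diff_eq_eq add.commute mult.commute)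
  have pg: "cstar_nonneg (p * g)" and eg: "cstar_nonneg (\<epsilon> *\<^sub>R g)"
    using p g \<epsilon> by (auto intro: cstar_nonneg_mult cstar_nonneg_scaleR)
  have "norm (p * g) \<le> norm (1 :: 'c unitization)" by (rule norm_mono_unital[OF pg]) (simp add: gp eg)
  moreover have "1 - \<epsilon> *\<^sub>R g = p * g" using gp by (simp add: algebra_simps)
  then have "norm (\<epsilon> *\<^sub>R g) \<le> norm (1 :: 'c unitization)" by (intro norm_mono_unital[OF eg]) (simp add: pg)
  ultimately have le: "norm (p * g) * norm (\<epsilon> *\<^sub>R g) \<le> 1 * 1" by (intro mult_mono) auto
  have "unz (inner H (hdiff H v (act H v c)) (hdiff H v (act H v c))) = star (1 - unz c) * (1 - unz c) * p"
    using v by (simp add: inner_simps p_def unz_simps star_diff algebra_simps)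
  also have "star (1 - unz c) = \<epsilon> *\<^sub>R g" using cstar_nonneg_star[OF eg] by (simp add: c gp)
  finally have "unz (inner H (hdiff H v (act H v c)) (hdiff H v (act H v c))) = \<epsilon> *\<^sub>R ((p * g) * (\<epsilon> *\<^sub>R g))"
    by (simp only: c gp) (simp add: mult_ac)
  then have "norm (inner H (hdiff H v (act H v c)) (hdiff H v (act H v c))) = \<epsilon> * norm ((p * g) * (\<epsilon> *\<^sub>R g))"
    using norm_Unz_alg[of "inner H (hdiff H v (act H v c)) (hdiff H v (act H v c))"] \<epsilon>
    by (metis abs_of_pos norm_scaleR)
  also have "\<dots> \<le> \<epsilon> * (1 * 1)"
    by (rule mult_left_mono[OF order_trans[OF norm_mult_ineq le] less_imp_le[OF \<epsilon>]])
  finally have "(hdist H v (act H v c))\<^sup>2 \<le> (r / 2)\<^sup>2" by (simp add: hdist_def hnorm_square \<epsilon>_def)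
  then have "hdist H v (act H v c) \<le> r / 2" by (rule power2_le_imp_le) (use r in simp)
  then show ?thesis using r by (intro exI[of _ c]) simp
qed

text \<open>The vectors x c are the values of the unitors on elementary tensors, so this is the
  density of their range.\<close>

lemma (in pre_hilbert) total_act: "total H ((\<lambda>(x, c). act H x c) ` (carrier H \<times> UNIV))"
  unfolding total_def
proof (intro conjI ballI allI impI)
  fix v and r :: real assume v: "v \<in> carrier H" and r: "0 < r"
  obtain c where c: "hdist H v (act H v c) < r" using approximate_unit[OF v r] by blast
  have "act H v c \<in> (\<lambda>(x, c). act H x c) ` (carrier H \<times> UNIV)" using v by force
  then have "act H v c \<in> hspan H ((\<lambda>(x, c). act H x c) ` (carrier H \<times> UNIV))"
    by (rule hspan_base)
  with c show "\<exists>u\<in>hspan H ((\<lambda>(x, c). act H x c) ` (carrier H \<times> UNIV)). hdist H v u < r"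
    by (rule bexI[of "\<lambda>u. hdist H v u < r"])
qed auto

definition unitary_map :: "('c, 'u) hmod \<Rightarrow> ('c::cstar_algebra, 'v) hmod \<Rightarrow> ('u \<Rightarrow> 'v) \<Rightarrow> bool" where
  "unitary_map H K f \<longleftrightarrow> bounded_map H K f 1 \<and> (\<exists>g. bounded_map K H g 1 \<and>
    (\<forall>x\<in>carrier H. g (f x) = x) \<and> (\<forall>y\<in>carrier K. f (g y) = y) \<and>
    (\<forall>x\<in>carrier H. \<forall>y\<in>carrier K. inner K (f x) y = inner H x (g y)))"

lemma unitary_map_exists:
  fixes H :: "('c::comm_cstar_algebra, 'u) hmod" and K :: "('c, 'v) hmod"
  assumes "hilbert_module H" "hilbert_module K" "total H (e ` I)" "total K (\<phi> ` I)"
    and "\<And>i j. i \<in> I \<Longrightarrow> j \<in> I \<Longrightarrow> inner K (\<phi> i) (\<phi> j) = inner H (e i) (e j)"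
    and "\<And>i a. i \<in> I \<Longrightarrow> \<exists>j\<in>I. e j = act H (e i) a \<and> \<phi> j = act K (\<phi> i) a"
  shows "\<exists>f. unitary_map H K f \<and> (\<forall>i\<in>I. f (e i) = \<phi> i)"
  using unitary_extension[OF assms] unfolding unitary_map_def by blast

section \<open>Elementary tensors in iterated tensor products\<close>

lemma tensor_pairI: "hilbert_module E \<Longrightarrow> hilbert_module F \<Longrightarrow> tensor_pair E F"
  by (simp add: tensor_pair_def)

lemma hilbert_tensor [simp]:
  fixes E F :: "('c::comm_cstar_algebra, 'x) umod"
  shows "hilbert_module E \<Longrightarrow> hilbert_module F \<Longrightarrow> hilbert_module (tensor E F)"
  by (rule tensor_pair.hilbert_tensor[OF tensor_pairI])

lemma elem_tensor_in [simp]: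
  fixes E F :: "('c::comm_cstar_algebra, 'x) umod"
  shows "hilbert_module E \<Longrightarrow> hilbert_module F \<Longrightarrow> x \<in> carrier E \<Longrightarrow> y \<in> carrier F
    \<Longrightarrow> elem_tensor E F x y \<in> carrier (tensor E F)"
  by (rule tensor_pair.elem_in[OF tensor_pairI])

lemma inner_elem_tensor [simp]:
  fixes E F :: "('c::comm_cstar_algebra, 'x) umod"
  shows "hilbert_module E \<Longrightarrow> hilbert_module F \<Longrightarrow> x \<in> carrier E \<Longrightarrow> y \<in> carrier F
    \<Longrightarrow> x' \<in> carrier E \<Longrightarrow> y' \<in> carrier F
    \<Longrightarrow> inner (tensor E F) (elem_tensor E F x y) (elem_tensor E F x' y') = inner E x x' * inner F y y'"
  by (rule tensor_pair.inner_elem[OF tensor_pairI])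

lemma elem_tensor_act:
  fixes E F :: "('c::comm_cstar_algebra, 'x) umod"
  assumes "hilbert_module E" "hilbert_module F" "x \<in> carrier E" "y \<in> carrier F"
  shows "elem_tensor E F (act E x a) y = act (tensor E F) (elem_tensor E F x y) a"
    "elem_tensor E F x (act F y a) = act (tensor E F) (elem_tensor E F x y) a"
  by (rule tensor_pair.elem_linear(5)[OF tensor_pairI] tensor_pair.elem_linear(6)[OF tensor_pairI]; fact assms)+

lemma total_tensor:
  fixes E F :: "('c::comm_cstar_algebra, 'x) umod"
  assumes "hilbert_module E" "hilbert_module F" "total E X" "total F Y"
  shows "total (tensor E F) (case_prod (elem_tensor E F) ` (X \<times> Y))"
  using tensor_pair.total_elem_pair[OF tensor_pairI] assms by (simp add: case_prod_unfold)

lemmas hilbert_total_carrier = pre_hilbert.total_carrier[OF hilbert_pre_hilbert]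

abbreviation "elem3_left A B D \<equiv> \<lambda>(x, y, w). elem_tensor (tensor A B) D (elem_tensor A B x y) w"
abbreviation "elem3_right A B D \<equiv> \<lambda>(x, y, w). elem_tensor A (tensor B D) x (elem_tensor B D y w)"
abbreviation "elem4_left A B D E \<equiv>
  \<lambda>(x, y, w, v). elem_tensor (tensor (tensor A B) D) E (elem_tensor (tensor A B) D (elem_tensor A B x y) w) v"

text \<open>Iterates \<open>total_tensor\<close>: the total set of a factor may itself consist of
  elementary tensors.\<close>

lemma total_elem_tensor:
  fixes A B D E :: "('c::comm_cstar_algebra, 'x) umod"
  assumes A: "hilbert_module A" and B: "hilbert_module B"
  shows "total (tensor A B) (case_prod (elem_tensor A B) ` (carrier A \<times> carrier B))"
    and "hilbert_module D \<Longrightarrow>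
      total (tensor (tensor A B) D) (elem3_left A B D ` (carrier A \<times> carrier B \<times> carrier D))"
    and "hilbert_module D \<Longrightarrow>
      total (tensor A (tensor B D)) (elem3_right A B D ` (carrier A \<times> carrier B \<times> carrier D))"
    and "hilbert_module D \<Longrightarrow> hilbert_module E \<Longrightarrow> total (tensor (tensor (tensor A B) D) E)
      (elem4_left A B D E ` (carrier A \<times> carrier B \<times> carrier D \<times> carrier E))"
proof -
  have AB: "total (tensor A B) (case_prod (elem_tensor A B) ` (carrier A \<times> carrier B))" if "hilbert_module A" "hilbert_module B"
    for A B :: "('c, 'x) umod"
    using that by (intro total_tensor hilbert_total_carrier)
  show "total (tensor A B) (case_prod (elem_tensor A B) ` (carrier A \<times> carrier B))" by (rule AB[OF A B])
  assume D: "hilbert_module D"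
  have "elem3_right A B D ` (carrier A \<times> carrier B \<times> carrier D)
      = case_prod (elem_tensor A (tensor B D)) ` (carrier A \<times> case_prod (elem_tensor B D) ` (carrier B \<times> carrier D))"
    by force
  then show "total (tensor A (tensor B D)) (elem3_right A B D ` (carrier A \<times> carrier B \<times> carrier D))"
    using A B D by (auto intro!: total_tensor AB hilbert_total_carrier)
  have "elem3_left A B D ` (carrier A \<times> carrier B \<times> carrier D)
      = case_prod (elem_tensor (tensor A B) D) ` (case_prod (elem_tensor A B) ` (carrier A \<times> carrier B) \<times> carrier D)"
    by force
  then show ABD: "total (tensor (tensor A B) D) (elem3_left A B D ` (carrier A \<times> carrier B \<times> carrier D))"
    using A B D by (auto intro!: total_tensor AB hilbert_total_carrier)
  assume E: "hilbert_module E"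
  have "elem4_left A B D E ` (carrier A \<times> carrier B \<times> carrier D \<times> carrier E)
      = case_prod (elem_tensor (tensor (tensor A B) D) E) `
        (elem3_left A B D ` (carrier A \<times> carrier B \<times> carrier D) \<times> carrier E)"
    by force
  then show "total (tensor (tensor (tensor A B) D) E)
      (elem4_left A B D E ` (carrier A \<times> carrier B \<times> carrier D \<times> carrier E))"
    using A B D E by (auto intro!: total_tensor ABD hilbert_total_carrier)
qed

section \<open>Existence of the associator, the unitors and the symmetry\<close>

lemma assoc_map_exists:
  fixes A B D :: "('c::comm_cstar_algebra, 'x) umod"
  assumes "hilbert_module A" "hilbert_module B" "hilbert_module D"
  shows "\<exists>f. unitary_map (tensor (tensor A B) D) (tensor A (tensor B D)) f \<and>
    (\<forall>x\<in>carrier A. \<forall>y\<in>carrier B. \<forall>w\<in>carrier D. f (elem_tensor (tensor A B) D (elem_tensor A B x y) w)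
      = elem_tensor A (tensor B D) x (elem_tensor B D y w))"
proof -
  note [simp] = assms
  have "\<exists>f. unitary_map (tensor (tensor A B) D) (tensor A (tensor B D)) f \<and>
    (\<forall>i\<in>carrier A \<times> carrier B \<times> carrier D. f ((elem3_left A B D) i)
      = (elem3_right A B D) i)"
  proof (rule unitary_map_exists[OF _ _ total_elem_tensor(2) total_elem_tensor(3)])
    fix i a assume "i \<in> carrier A \<times> carrier B \<times> carrier D"
    then obtain x y w where i: "i = (x, y, w)" "x \<in> carrier A" "y \<in> carrier B" "w \<in> carrier D" by auto
    have "act D w a \<in> carrier D" using i pre_hilbert.act_in[OF hilbert_pre_hilbert[OF assms(3)]] by simp
    then show "\<exists>j\<in>carrier A \<times> carrier B \<times> carrier D.
        (elem3_left A B D) j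
          = act (tensor (tensor A B) D) ((elem3_left A B D) i) a \<and>
        (elem3_right A B D) j
          = act (tensor A (tensor B D)) ((elem3_right A B D) i) a"
      using i by (intro bexI[of _ "(x, y, act D w a)"]) (simp_all add: elem_tensor_act)
  qed (auto simp: mult.assoc)
  then show ?thesis by simp
qed

text \<open>Inner products are preserved because c^* <x|x'> c' = c^* c' <x|x'> in a commutative
  algebra.\<close>

lemma lunit_map_exists:
  fixes A :: "('c::comm_cstar_algebra, 'x) umod"
  assumes A: "hilbert_module A"
  shows "\<exists>f. unitary_map (tensor tensor_unit A) A f \<and>
    (\<forall>c. \<forall>x\<in>carrier A. f (elem_tensor tensor_unit A (Scalar c) x) = act A x c)"
proof -
  interpret A: pre_hilbert A by (rule hilbert_pre_hilbert[OF A])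
  note [simp] = A hilbert_tensor_unit
  have e: "(\<lambda>(x, c). elem_tensor tensor_unit A (Scalar c) x) ` (carrier A \<times> UNIV)
      = (\<lambda>(u, x). elem_tensor tensor_unit A u x) ` (carrier tensor_unit \<times> carrier A)"
    by force
  have "\<exists>f. unitary_map (tensor tensor_unit A) A f \<and>
    (\<forall>i\<in>carrier A \<times> UNIV. f ((\<lambda>(x, c). elem_tensor tensor_unit A (Scalar c) x) i) = (\<lambda>(x, c). act A x c) i)"
  proof (rule unitary_map_exists[OF _ A _ A.total_act])
    show "total (tensor tensor_unit A) ((\<lambda>(x, c). elem_tensor tensor_unit A (Scalar c) x) ` (carrier A \<times> UNIV))"
      unfolding e by (rule total_elem_tensor(1)) simp_all
    fix i a assume "i \<in> carrier A \<times> (UNIV :: 'c set)"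
    then obtain x c where i: "i = (x, c)" "x \<in> carrier A" by auto
    show "\<exists>j\<in>carrier A \<times> UNIV. (\<lambda>(x, c). elem_tensor tensor_unit A (Scalar c) x) j
          = act (tensor tensor_unit A) ((\<lambda>(x, c). elem_tensor tensor_unit A (Scalar c) x) i) a \<and>
        (\<lambda>(x, c). act A x c) j = act A ((\<lambda>(x, c). act A x c) i) a"
      \<comment> \<open>By commutativity (x a) c = (x c) a.\<close>
      using i by (intro bexI[of _ "(act A x a, c)"])
        (simp_all add: elem_tensor_act hilbert_module.act_act[OF A] mult.commute)
  qed (auto simp: A.inner_simps mult_ac)
  then show ?thesis by simp blast
qed

lemma runit_map_exists:
  fixes A :: "('c::comm_cstar_algebra, 'x) umod"
  assumes A: "hilbert_module A"
  shows "\<exists>f. unitary_map (tensor A tensor_unit) A f \<and>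
    (\<forall>c. \<forall>x\<in>carrier A. f (elem_tensor A tensor_unit x (Scalar c)) = act A x c)"
proof -
  interpret A: pre_hilbert A by (rule hilbert_pre_hilbert[OF A])
  note [simp] = A hilbert_tensor_unit
  have e: "(\<lambda>(x, c). elem_tensor A tensor_unit x (Scalar c)) ` (carrier A \<times> UNIV)
      = (\<lambda>(x, u). elem_tensor A tensor_unit x u) ` (carrier A \<times> carrier tensor_unit)"
    by force
  have "\<exists>f. unitary_map (tensor A tensor_unit) A f \<and>
    (\<forall>i\<in>carrier A \<times> UNIV. f ((\<lambda>(x, c). elem_tensor A tensor_unit x (Scalar c)) i) = (\<lambda>(x, c). act A x c) i)"
  proof (rule unitary_map_exists[OF _ A _ A.total_act])
    show "total (tensor A tensor_unit) ((\<lambda>(x, c). elem_tensor A tensor_unit x (Scalar c)) ` (carrier A \<times> UNIV))"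
      unfolding e by (rule total_elem_tensor(1)) simp_all
    fix i a assume "i \<in> carrier A \<times> (UNIV :: 'c set)"
    then obtain x c where i: "i = (x, c)" "x \<in> carrier A" by auto
    show "\<exists>j\<in>carrier A \<times> UNIV. (\<lambda>(x, c). elem_tensor A tensor_unit x (Scalar c)) j
          = act (tensor A tensor_unit) ((\<lambda>(x, c). elem_tensor A tensor_unit x (Scalar c)) i) a \<and>
        (\<lambda>(x, c). act A x c) j = act A ((\<lambda>(x, c). act A x c) i) a"
      using i by (intro bexI[of _ "(act A x a, c)"])
        (simp_all add: elem_tensor_act hilbert_module.act_act[OF A] mult.commute)
  qed (auto simp: A.inner_simps mult_ac)
  then show ?thesis by simp blast
qed

lemma symm_map_exists:
  fixes A B :: "('c::comm_cstar_algebra, 'x) umod"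
  assumes A: "hilbert_module A" and B: "hilbert_module B"
  shows "\<exists>f. unitary_map (tensor A B) (tensor B A) f \<and>
    (\<forall>x\<in>carrier A. \<forall>y\<in>carrier B. f (elem_tensor A B x y) = elem_tensor B A y x)"
proof -
  interpret B: pre_hilbert B by (rule hilbert_pre_hilbert[OF B])
  note [simp] = A B
  have \<phi>: "(\<lambda>(x, y). elem_tensor B A y x) ` (carrier A \<times> carrier B)
      = (\<lambda>(y, x). elem_tensor B A y x) ` (carrier B \<times> carrier A)"
    by force
  have "\<exists>f. unitary_map (tensor A B) (tensor B A) f \<and>
    (\<forall>i\<in>carrier A \<times> carrier B. f (case_prod (elem_tensor A B) i) = (\<lambda>(x, y). elem_tensor B A y x) i)"
  proof (rule unitary_map_exists[OF _ _ total_elem_tensor(1)])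
    show "total (tensor B A) ((\<lambda>(x, y). elem_tensor B A y x) ` (carrier A \<times> carrier B))"
      unfolding \<phi> by (rule total_elem_tensor(1)) simp_all
    fix i a assume "i \<in> carrier A \<times> carrier B"
    then obtain x y where i: "i = (x, y)" "x \<in> carrier A" "y \<in> carrier B" by auto
    then show "\<exists>j\<in>carrier A \<times> carrier B. case_prod (elem_tensor A B) j
          = act (tensor A B) (case_prod (elem_tensor A B) i) a \<and>
        (\<lambda>(x, y). elem_tensor B A y x) j = act (tensor B A) ((\<lambda>(x, y). elem_tensor B A y x) i) a"
      by (intro bexI[of _ "(x, act B y a)"]) (simp_all add: elem_tensor_act)
  qed (auto simp: mult.commute)
  then show ?thesis by simp
qed

section \<open>Morphisms\<close>

definition hcomp :: "('c, 'u) hmap \<Rightarrow> ('c, 'u) hmap \<Rightarrow> ('c, 'u) hmap" where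
  "hcomp g f = HMap (src f) (compose (carrier (src f)) (fn g) (fn f)) (tgt g)"

definition hid :: "('c, 'u) hmod \<Rightarrow> ('c, 'u) hmap" where
  "hid E = HMap E (\<lambda>x\<in>carrier E. x) E"

lemma hcomp_simps [simp]:
  "src (hcomp g f) = src f" "tgt (hcomp g f) = tgt g"
  "x \<in> carrier (src f) \<Longrightarrow> fn (hcomp g f) x = fn g (fn f x)"
  by (simp_all add: hcomp_def compose_eq)

lemma hid_simps [simp]:
  "src (hid E) = E" "tgt (hid E) = E" "x \<in> carrier E \<Longrightarrow> fn (hid E) x = x"
  by (simp_all add: hid_def)

lemma hcomp_hid_extensional:
  "fn (hcomp g f) \<in> extensional (carrier (src f))" "fn (hid E) \<in> extensional (carrier E)"
  by (simp_all add: hcomp_def hid_def)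

text \<open>Replacing \<open>K\<close> by its absolute value makes the bound nonnegative, as
  composition and tensor products require.\<close>

lemma bounded_linear_hmap_iff:
  "bounded_linear_hmap (f :: ('c::comm_cstar_algebra, 'u) hmap) \<longleftrightarrow> hilbert_module (src f) \<and> hilbert_module (tgt f)
    \<and> fn f \<in> extensional (carrier (src f)) \<and> (\<exists>M\<ge>0. bounded_map (src f) (tgt f) (fn f) M)"
proof
  assume f: "bounded_linear_hmap f"
  then obtain K where K: "\<forall>x\<in>carrier (src f). hnorm (tgt f) (fn f x) \<le> K * hnorm (src f) x"
    unfolding bounded_linear_hmap_def by blast
  have H: "hilbert_module (src f)" "hilbert_module (tgt f)"
    using f by (simp_all add: bounded_linear_hmap_def is_hmap_def)
  have "hnorm (tgt f) (fn f x) \<le> \<bar>K\<bar> * hnorm (src f) x" if "x \<in> carrier (src f)" for x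
    using K[rule_format, OF that] mult_right_mono[OF abs_ge_self, of "hnorm (src f) x" K]
      pre_hilbert.hnorm_nonneg[OF hilbert_pre_hilbert[OF H(1)], of x] by linarith
  then have "bounded_map (src f) (tgt f) (fn f) \<bar>K\<bar>"
    using f by (auto simp: bounded_linear_hmap_def is_hmap_def bounded_map_def module_map_def PiE_iff)
  then show "hilbert_module (src f) \<and> hilbert_module (tgt f)
    \<and> fn f \<in> extensional (carrier (src f)) \<and> (\<exists>M\<ge>0. bounded_map (src f) (tgt f) (fn f) M)"
    using f by (auto simp: bounded_linear_hmap_def is_hmap_def PiE_iff intro!: exI[of _ "\<bar>K\<bar>"])
next
  assume "hilbert_module (src f) \<and> hilbert_module (tgt f)
    \<and> fn f \<in> extensional (carrier (src f)) \<and> (\<exists>M\<ge>0. bounded_map (src f) (tgt f) (fn f) M)"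
  then show "bounded_linear_hmap f"
    by (auto simp: bounded_linear_hmap_def is_hmap_def bounded_map_def module_map_def PiE_iff)
qed

lemma bounded_map_restrict:
  fixes H :: "('c::comm_cstar_algebra, 'u) hmod"
  assumes "pre_hilbert H"
  shows "bounded_map H K (restrict f (carrier H)) M \<longleftrightarrow> bounded_map H K f M"
proof -
  interpret pre_hilbert H by fact
  show ?thesis by (simp add: bounded_map_def module_map_def)
qed

lemma bounded_linear_HMap:
  fixes H :: "('c::comm_cstar_algebra, 'u) hmod"
  assumes "hilbert_module H" "hilbert_module K" "bounded_map H K f M" "0 \<le> M"
  shows "bounded_linear_hmap (HMap H (restrict f (carrier H)) K)"
  using assms by (auto simp: bounded_linear_hmap_iff bounded_map_restrict hilbert_pre_hilbert)

lemma bounded_linear_hmap_hilbert [simp]: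
  "bounded_linear_hmap f \<Longrightarrow> hilbert_module (src f)" "bounded_linear_hmap f \<Longrightarrow> hilbert_module (tgt f)"
  by (simp_all add: bounded_linear_hmap_def is_hmap_def)

lemma bounded_linear_hmap_in [simp]:
  "bounded_linear_hmap f \<Longrightarrow> x \<in> carrier (src f) \<Longrightarrow> fn f x \<in> carrier (tgt f)"
  unfolding bounded_linear_hmap_def is_hmap_def by (blast dest: PiE_mem)

lemma bounded_linear_hmap_extensional:
  "bounded_linear_hmap f \<Longrightarrow> fn f \<in> extensional (carrier (src f))"
  unfolding bounded_linear_hmap_def is_hmap_def by (simp add: PiE_iff)

lemma bounded_linear_hmap_act:
  "bounded_linear_hmap f \<Longrightarrow> x \<in> carrier (src f) \<Longrightarrow> fn f (act (src f) x a) = act (tgt f) (fn f x) a"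
  by (simp add: bounded_linear_hmap_def)

lemma bounded_linear_hcomp [simp]:
  fixes f g :: "('c::comm_cstar_algebra, 'u) hmap"
  assumes f: "bounded_linear_hmap f" and g: "bounded_linear_hmap g" and fg: "tgt f = src g"
  shows "bounded_linear_hmap (hcomp g f)"
proof -
  obtain M N where M: "0 \<le> M" "bounded_map (src f) (tgt f) (fn f) M"
    and N: "0 \<le> N" "bounded_map (src g) (tgt g) (fn g) N"
    using f g unfolding bounded_linear_hmap_iff by blast
  have "bounded_map (src f) (tgt g) (\<lambda>x. fn g (fn f x)) (N * M)"
    by (rule bounded_map_comp[OF M(2)]) (use N fg in auto)
  then show ?thesis
    unfolding hcomp_def compose_def using f g M N by (intro bounded_linear_HMap[where M = "N * M"]) auto
qed

lemma bounded_linear_hid [simp]: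
  "hilbert_module (E :: ('c::comm_cstar_algebra, 'u) hmod) \<Longrightarrow> bounded_linear_hmap (hid E)"
  unfolding hid_def by (rule bounded_linear_HMap[OF _ _ bounded_map_id]) auto

lemma hmap_eqI_carrier:
  assumes "src f = src g" "tgt f = tgt g" "fn f \<in> extensional (carrier (src f))" "fn g \<in> extensional (carrier (src g))"
    and "\<And>x. x \<in> carrier (src f) \<Longrightarrow> fn f x = fn g x"
  shows "f = g"
  using assms by (auto intro!: hmap.expand extensionalityI)

lemma hmap_eqI:
  fixes f g :: "('c::comm_cstar_algebra, 'u) hmap"
  assumes f: "bounded_linear_hmap f" and g: "bounded_linear_hmap g" and fg: "src f = src g" "tgt f = tgt g"
    and S: "total (src f) S" "\<And>s. s \<in> S \<Longrightarrow> fn f s = fn g s"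
  shows "f = g"
proof (rule hmap_eqI_carrier[OF fg])
  fix x assume x: "x \<in> carrier (src f)"
  obtain M N where M: "bounded_map (src f) (tgt f) (fn f) M" and N: "bounded_map (src f) (tgt f) (fn g) N"
    using f g fg unfolding bounded_linear_hmap_iff by auto
  show "fn f x = fn g x"
    by (rule bounded_map_eqI[OF _ _ M N S x]) (use f in auto)
qed (simp_all add: bounded_linear_hmap_extensional f g)

lemma hmap_eqI2:
  fixes f g :: "('c::comm_cstar_algebra, ('c, 'x) univ) hmap"
  assumes "bounded_linear_hmap f" "bounded_linear_hmap g" "hilbert_module A" "hilbert_module B"
    and "src f = tensor A B" "src g = tensor A B" "tgt f = tgt g"
    and "\<And>x y. x \<in> carrier A \<Longrightarrow> y \<in> carrier B \<Longrightarrow> fn f (elem_tensor A B x y) = fn g (elem_tensor A B x y)"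
  shows "f = g"
  by (rule hmap_eqI[where S = "case_prod (elem_tensor A B) ` (carrier A \<times> carrier B)"])
    (use assms total_elem_tensor(1)[OF assms(3,4)] in auto)

lemma hmap_eqI3:
  fixes f g :: "('c::comm_cstar_algebra, ('c, 'x) univ) hmap"
  assumes "bounded_linear_hmap f" "bounded_linear_hmap g" "hilbert_module A" "hilbert_module B" "hilbert_module D"
    and "src f = tensor (tensor A B) D" "src g = tensor (tensor A B) D" "tgt f = tgt g"
    and "\<And>x y w. x \<in> carrier A \<Longrightarrow> y \<in> carrier B \<Longrightarrow> w \<in> carrier D \<Longrightarrow>
      fn f (elem_tensor (tensor A B) D (elem_tensor A B x y) w) = fn g (elem_tensor (tensor A B) D (elem_tensor A B x y) w)"
  shows "f = g"
  by (rule hmap_eqI[OF _ _ _ _ total_elem_tensor(2)[OF assms(3-5), folded assms(6)]]) (use assms in auto)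

lemma hmap_eqI4:
  fixes f g :: "('c::comm_cstar_algebra, ('c, 'x) univ) hmap"
  assumes "bounded_linear_hmap f" "bounded_linear_hmap g"
    "hilbert_module A" "hilbert_module B" "hilbert_module D" "hilbert_module E"
    and "src f = tensor (tensor (tensor A B) D) E" "src g = tensor (tensor (tensor A B) D) E" "tgt f = tgt g"
    and "\<And>x y w v. x \<in> carrier A \<Longrightarrow> y \<in> carrier B \<Longrightarrow> w \<in> carrier D \<Longrightarrow> v \<in> carrier E \<Longrightarrow>
      fn f (elem_tensor (tensor (tensor A B) D) E (elem_tensor (tensor A B) D (elem_tensor A B x y) w) v)
      = fn g (elem_tensor (tensor (tensor A B) D) E (elem_tensor (tensor A B) D (elem_tensor A B x y) w) v)"
  shows "f = g"
  by (rule hmap_eqI[OF _ _ _ _ total_elem_tensor(4)[OF assms(3-6), folded assms(7)]]) (use assms in auto)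

subsection \<open>Adjoints\<close>

lemma is_adjoint_sym: "is_adjoint f g \<Longrightarrow> is_adjoint (g :: ('c::comm_cstar_algebra, 'u) hmap) f"
  unfolding is_adjoint_def
proof (elim conjE, intro conjI ballI; simp?)
  fix x y
  assume f: "is_hmap f" "is_hmap g" "src g = tgt f" "tgt g = src f"
    and eq: "\<forall>x\<in>carrier (src f). \<forall>y\<in>carrier (tgt f). inner (tgt f) (fn f x) y = inner (src f) x (fn g y)"
    and xy: "x \<in> carrier (tgt f)" "y \<in> carrier (src f)"
  interpret S: pre_hilbert "src f" using f by (intro hilbert_pre_hilbert) (simp add: is_hmap_def)
  interpret T: pre_hilbert "tgt f" using f by (intro hilbert_pre_hilbert) (simp add: is_hmap_def)
  have "fn g x \<in> carrier (src f)" "fn f y \<in> carrier (tgt f)"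
    using f xy by (auto simp: is_hmap_def PiE_iff)
  then show "inner (src f) (fn g x) y = inner (tgt f) x (fn f y)"
    using arg_cong[OF eq[rule_format, OF xy(2,1)], of star] xy by (simp add: S.inner_conj T.inner_conj)
qed

lemma is_adjoint_ends: "is_adjoint f g \<Longrightarrow> src g = tgt f" "is_adjoint f g \<Longrightarrow> tgt g = src f"
  by (simp_all add: is_adjoint_def)

lemma is_adjoint_unique:
  fixes f :: "('c::comm_cstar_algebra, 'u) hmap"
  assumes "is_adjoint f g" "is_adjoint f h"
  shows "g = h"
proof (rule hmap_eqI_carrier)
  fix y assume "y \<in> carrier (src g)"
  then show "fn g y = fn h y"
    using assms by (intro hilbert_inner_eqI[of "src f"]) (auto simp: is_adjoint_def is_hmap_def PiE_iff)
qed (use assms in \<open>auto simp: is_adjoint_def is_hmap_def PiE_iff\<close>)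

lemma hilb_dagger_eqI:
  "is_adjoint f g \<Longrightarrow> hilb_dagger f = (g :: ('c::comm_cstar_algebra, 'u) hmap)"
  unfolding hilb_dagger_def by (rule the_equality) (auto intro: is_adjoint_unique)

lemma is_adjoint_dagger:
  "adjointable f \<Longrightarrow> is_adjoint f (hilb_dagger (f :: ('c::comm_cstar_algebra, 'u) hmap))"
  unfolding adjointable_def using hilb_dagger_eqI by blast

text \<open>Together with the symmetry of \<open>is_adjoint\<close> this places both partners among
  the bounded maps.\<close>

lemma is_adjoint_bounded:
  fixes f :: "('c::comm_cstar_algebra, 'u) hmap"
  assumes "is_adjoint f g"
  shows "bounded_linear_hmap g"
proof -
  have "\<exists>K\<ge>0. bounded_map (tgt f) (src f) (fn g) K"
    by (rule adjoint_bounded_map[where f = "fn f"]) (use assms in \<open>auto simp: is_adjoint_def is_hmap_def PiE_iff\<close>)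
  then show ?thesis
    using assms unfolding bounded_linear_hmap_iff by (auto simp: is_adjoint_def is_hmap_def PiE_iff)
qed

lemma adjointable_bounded:
  "adjointable (f :: ('c::comm_cstar_algebra, 'u) hmap) \<Longrightarrow> bounded_linear_hmap f"
  unfolding adjointable_def using is_adjoint_bounded is_adjoint_sym by blast

lemma is_adjointI:
  fixes f g :: "('c::comm_cstar_algebra, 'u) hmap"
  assumes f: "bounded_linear_hmap f" and g: "bounded_linear_hmap g" and fg: "src g = tgt f" "tgt g = src f"
    and S: "total (src f) S" and R: "total (tgt f) R"
    and eq: "\<And>s r. s \<in> S \<Longrightarrow> r \<in> R \<Longrightarrow> inner (tgt f) (fn f s) r = inner (src f) s (fn g r)"
  shows "is_adjoint f g"
proof -
  obtain M N where M: "0 \<le> M" "bounded_map (src f) (tgt f) (fn f) M"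
    and N: "0 \<le> N" "bounded_map (tgt f) (src f) (fn g) N"
    using f g fg unfolding bounded_linear_hmap_iff by auto
  have "inner (tgt f) (fn f x) y = inner (src f) x (fn g y)" if "x \<in> carrier (src f)" "y \<in> carrier (tgt f)" for x y
    by (rule adjoint_on_total[OF _ _ M(2) N(2) M(1) N(1) S R eq that]) (use f in auto)
  then show ?thesis using f g fg by (simp add: is_adjoint_def bounded_linear_hmap_def)
qed

lemma is_adjoint_hid: "hilbert_module (E :: ('c::comm_cstar_algebra, 'u) hmod) \<Longrightarrow> is_adjoint (hid E) (hid E)"
  by (rule is_adjointI[where S = "carrier E" and R = "carrier E"]) (auto intro: hilbert_total_carrier)

lemma is_adjoint_hcomp:
  fixes f g :: "('c::comm_cstar_algebra, 'u) hmap"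
  assumes f: "is_adjoint f f'" and g: "is_adjoint g g'" and fg: "tgt f = src g"
  shows "is_adjoint (hcomp g f) (hcomp f' g')"
proof (rule is_adjointI[where S = "carrier (src f)" and R = "carrier (tgt g)"])
  note bl = is_adjoint_bounded[OF f] is_adjoint_bounded[OF g]
    is_adjoint_bounded[OF is_adjoint_sym[OF f]] is_adjoint_bounded[OF is_adjoint_sym[OF g]]
  have eqs: "src f' = tgt f" "tgt f' = src f" "src g' = tgt g" "tgt g' = src g"
    using f g by (auto simp: is_adjoint_def)
  show "bounded_linear_hmap (hcomp g f)" "bounded_linear_hmap (hcomp f' g')"
    using bl fg eqs by auto
  show "src (hcomp f' g') = tgt (hcomp g f)" "tgt (hcomp f' g') = src (hcomp g f)" using eqs by auto
  show "total (src (hcomp g f)) (carrier (src f))" "total (tgt (hcomp g f)) (carrier (tgt g))"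
    using bl by (auto intro: hilbert_total_carrier)
  fix x y assume x: "x \<in> carrier (src f)" and y: "y \<in> carrier (tgt g)"
  have fx: "fn f x \<in> carrier (src g)" using bounded_linear_hmap_in[OF bl(3) x] fg by simp
  have gy: "fn g' y \<in> carrier (tgt f)" using bounded_linear_hmap_in[OF bl(2)] y eqs fg by simp
  show "inner (tgt (hcomp g f)) (fn (hcomp g f) x) y = inner (src (hcomp g f)) x (fn (hcomp f' g') y)"
    using f g x y fx gy eqs fg by (simp add: is_adjoint_def)
qed

text \<open>The inverse is kept as an explicit partner that is also the adjoint: it shows
  \<open>u\<close> invertible in either category, and it is the dagger of \<open>u\<close> by
  uniqueness of adjoints.\<close>

definition unitary_hmap :: "('c::cstar_algebra, 'u) hmap \<Rightarrow> ('c, 'u) hmap \<Rightarrow> bool" where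
  "unitary_hmap u v \<longleftrightarrow> bounded_linear_hmap u \<and> bounded_linear_hmap v \<and> is_adjoint u v \<and>
     hcomp v u = hid (src u) \<and> hcomp u v = hid (tgt u)"

lemma unitary_hmap_sym:
  fixes u v :: "('c::comm_cstar_algebra, 'u) hmap"
  shows "unitary_hmap u v \<Longrightarrow> unitary_hmap v u"
  unfolding unitary_hmap_def using is_adjoint_sym is_adjoint_ends by metis

lemma unitary_map_hmap:
  fixes H K :: "('c::comm_cstar_algebra, 'u) hmod"
  assumes H: "hilbert_module H" and K: "hilbert_module K" and f: "unitary_map H K f"
  shows "\<exists>v. unitary_hmap (HMap H (restrict f (carrier H)) K) v"
proof -
  obtain g where g: "bounded_map K H g 1" "\<forall>x\<in>carrier H. g (f x) = x" "\<forall>y\<in>carrier K. f (g y) = y"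
    "\<forall>x\<in>carrier H. \<forall>y\<in>carrier K. inner K (f x) y = inner H x (g y)"
    and fb: "bounded_map H K f 1" using f unfolding unitary_map_def by blast
  define u v where "u = HMap H (restrict f (carrier H)) K" and "v = HMap K (restrict g (carrier K)) H"
  have u: "bounded_linear_hmap u" unfolding u_def by (rule bounded_linear_HMap[OF H K fb]) simp
  have v: "bounded_linear_hmap v" unfolding v_def by (rule bounded_linear_HMap[OF K H g(1)]) simp
  have st: "src u = H" "tgt u = K" "src v = K" "tgt v = H" by (simp_all add: u_def v_def)
  have fin: "f x \<in> carrier K" if "x \<in> carrier H" for x
    using that fb by (auto simp: bounded_map_def module_map_def)
  have gin: "g y \<in> carrier H" if "y \<in> carrier K" for y
    using that g by (auto simp: bounded_map_def module_map_def)
  have "is_adjoint u v"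
    using u v st g(4) fin gin by (auto simp: is_adjoint_def bounded_linear_hmap_def u_def v_def)
  moreover have "hcomp v u = hid (src u)" unfolding st
  proof (rule hmap_eqI_carrier)
    show "fn (hcomp v u) x = fn (hid H) x" if "x \<in> carrier (src (hcomp v u))" for x
      using that fin g(2) by (simp add: st) (simp add: u_def v_def)
  qed (use hcomp_hid_extensional(1)[of v u] hcomp_hid_extensional(2)[of H] in \<open>simp_all add: st\<close>)
  moreover have "hcomp u v = hid (tgt u)" unfolding st
  proof (rule hmap_eqI_carrier)
    show "fn (hcomp u v) y = fn (hid K) y" if "y \<in> carrier (src (hcomp u v))" for y
      using that gin g(3) by (simp add: st) (simp add: u_def v_def)
  qed (use hcomp_hid_extensional(1)[of u v] hcomp_hid_extensional(2)[of K] in \<open>simp_all add: st\<close>)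
  ultimately show ?thesis using u v unfolding unitary_hmap_def u_def by blast
qed

section \<open>The monoidal structure\<close>

type_synonym ('c, 'x) uhmap = "('c, ('c, 'x) univ) hmap"

text \<open>The choice is harmless: the prescribed values lie on a total set, so at most one bounded
  map has them.\<close>

definition ten_map :: "('c::comm_cstar_algebra, 'x) uhmap \<Rightarrow> ('c, 'x) uhmap \<Rightarrow> ('c, 'x) uhmap" where
  "ten_map f g = (SOME h. src h = tensor (src f) (src g) \<and> tgt h = tensor (tgt f) (tgt g) \<and> bounded_linear_hmap h \<and>
     (\<forall>x\<in>carrier (src f). \<forall>y\<in>carrier (src g).
       fn h (elem_tensor (src f) (src g) x y) = elem_tensor (tgt f) (tgt g) (fn f x) (fn g y)))"

lemma ten_map:
  assumes f: "bounded_linear_hmap f" and g: "bounded_linear_hmap g"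
  shows "src (ten_map f g) = tensor (src f) (src g)" "tgt (ten_map f g) = tensor (tgt f) (tgt g)"
    "bounded_linear_hmap (ten_map f g)"
    "x \<in> carrier (src f) \<Longrightarrow> y \<in> carrier (src g) \<Longrightarrow>
      fn (ten_map f g) (elem_tensor (src f) (src g) x y) = elem_tensor (tgt f) (tgt g) (fn f x) (fn g y)"
proof -
  obtain M N where M: "0 \<le> M" "bounded_map (src f) (tgt f) (fn f) M"
    and N: "0 \<le> N" "bounded_map (src g) (tgt g) (fn g) N"
    using f g unfolding bounded_linear_hmap_iff by blast
  have H: "hilbert_module (src f)" "hilbert_module (src g)" "hilbert_module (tgt f)" "hilbert_module (tgt g)"
    using f g by auto
  obtain h where h: "bounded_map (tensor (src f) (src g)) (tensor (tgt f) (tgt g)) h (M * N)"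
    "\<forall>x\<in>carrier (src f). \<forall>y\<in>carrier (src g).
       h (elem_tensor (src f) (src g) x y) = elem_tensor (tgt f) (tgt g) (fn f x) (fn g y)"
    using tensor_map_exists[OF H M(2) N(2) M(1) N(1)] by blast
  let ?h = "HMap (tensor (src f) (src g)) (restrict h (carrier (tensor (src f) (src g)))) (tensor (tgt f) (tgt g))"
  have "bounded_linear_hmap ?h"
    by (rule bounded_linear_HMap[OF _ _ h(1)]) (use H M N in auto)
  then have "\<exists>h. src h = tensor (src f) (src g) \<and> tgt h = tensor (tgt f) (tgt g) \<and> bounded_linear_hmap h \<and>
     (\<forall>x\<in>carrier (src f). \<forall>y\<in>carrier (src g).
       fn h (elem_tensor (src f) (src g) x y) = elem_tensor (tgt f) (tgt g) (fn f x) (fn g y))"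
    using h(2) H by (intro exI[of _ ?h]) simp
  from someI_ex[OF this, folded ten_map_def]
  show "src (ten_map f g) = tensor (src f) (src g)" "tgt (ten_map f g) = tensor (tgt f) (tgt g)"
    "bounded_linear_hmap (ten_map f g)"
    "x \<in> carrier (src f) \<Longrightarrow> y \<in> carrier (src g) \<Longrightarrow>
      fn (ten_map f g) (elem_tensor (src f) (src g) x y) = elem_tensor (tgt f) (tgt g) (fn f x) (fn g y)"
    by blast+
qed

text \<open>The evaluation rule with the domains as separate variables, so that it can rewrite.\<close>

lemma fn_ten_map:
  "bounded_linear_hmap f \<Longrightarrow> bounded_linear_hmap g \<Longrightarrow> src f = A \<Longrightarrow> src g = B \<Longrightarrow> x \<in> carrier A \<Longrightarrow> y \<in> carrier B
    \<Longrightarrow> fn (ten_map f g) (elem_tensor A B x y) = elem_tensor (tgt f) (tgt g) (fn f x) (fn g y)"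
  using ten_map(4) by blast

text \<open>A common form for the coherence maps, with \<open>Q\<close> prescribing the values on
  elementary tensors.\<close>

definition unitary_choice :: "('c::cstar_algebra, 'u) hmod \<Rightarrow> ('c, 'u) hmod \<Rightarrow> (('u \<Rightarrow> 'u) \<Rightarrow> bool) \<Rightarrow> ('c, 'u) hmap" where
  "unitary_choice H K Q = HMap H (restrict (SOME f. unitary_map H K f \<and> Q f) (carrier H)) K"

lemma unitary_choice:
  fixes H K :: "('c::comm_cstar_algebra, 'u) hmod"
  assumes "hilbert_module H" "hilbert_module K" "\<exists>f. unitary_map H K f \<and> Q f"
  shows "src (unitary_choice H K Q) = H" "tgt (unitary_choice H K Q) = K"
    "\<exists>v. unitary_hmap (unitary_choice H K Q) v" "bounded_linear_hmap (unitary_choice H K Q)"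
    "\<exists>f. Q f \<and> (\<forall>x\<in>carrier H. fn (unitary_choice H K Q) x = f x)"
proof -
  define f where "f = (SOME f. unitary_map H K f \<and> Q f)"
  have f: "unitary_map H K f" "Q f" using someI_ex[OF assms(3)] by (simp_all add: f_def)
  show "src (unitary_choice H K Q) = H" "tgt (unitary_choice H K Q) = K" by (simp_all add: unitary_choice_def)
  show v: "\<exists>v. unitary_hmap (unitary_choice H K Q) v"
    using unitary_map_hmap[OF assms(1,2) f(1)] by (simp add: unitary_choice_def f_def)
  then show "bounded_linear_hmap (unitary_choice H K Q)" by (auto simp: unitary_hmap_def)
  show "\<exists>f. Q f \<and> (\<forall>x\<in>carrier H. fn (unitary_choice H K Q) x = f x)"
    using f(2) by (intro exI[of _ f]) (simp add: unitary_choice_def f_def)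
qed

definition assoc_map :: "('c::comm_cstar_algebra, 'x) umod \<Rightarrow> ('c, 'x) umod \<Rightarrow> ('c, 'x) umod \<Rightarrow> ('c, 'x) uhmap" where
  "assoc_map A B D = unitary_choice (tensor (tensor A B) D) (tensor A (tensor B D))
    (\<lambda>f. \<forall>x\<in>carrier A. \<forall>y\<in>carrier B. \<forall>w\<in>carrier D. f (elem_tensor (tensor A B) D (elem_tensor A B x y) w)
      = elem_tensor A (tensor B D) x (elem_tensor B D y w))"

definition lunit_map :: "('c::comm_cstar_algebra, 'x) umod \<Rightarrow> ('c, 'x) uhmap" where
  "lunit_map A = unitary_choice (tensor tensor_unit A) A
    (\<lambda>f. \<forall>c. \<forall>x\<in>carrier A. f (elem_tensor tensor_unit A (Scalar c) x) = act A x c)"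

definition runit_map :: "('c::comm_cstar_algebra, 'x) umod \<Rightarrow> ('c, 'x) uhmap" where
  "runit_map A = unitary_choice (tensor A tensor_unit) A
    (\<lambda>f. \<forall>c. \<forall>x\<in>carrier A. f (elem_tensor A tensor_unit x (Scalar c)) = act A x c)"

definition symm_map :: "('c::comm_cstar_algebra, 'x) umod \<Rightarrow> ('c, 'x) umod \<Rightarrow> ('c, 'x) uhmap" where
  "symm_map A B = unitary_choice (tensor A B) (tensor B A)
    (\<lambda>f. \<forall>x\<in>carrier A. \<forall>y\<in>carrier B. f (elem_tensor A B x y) = elem_tensor B A y x)"

lemma assoc_map:
  assumes "hilbert_module A" "hilbert_module B" "hilbert_module D"
  shows "src (assoc_map A B D) = tensor (tensor A B) D" "tgt (assoc_map A B D) = tensor A (tensor B D)"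
    "\<exists>v. unitary_hmap (assoc_map A B D) v" "bounded_linear_hmap (assoc_map A B D)"
    "x \<in> carrier A \<Longrightarrow> y \<in> carrier B \<Longrightarrow> w \<in> carrier D \<Longrightarrow>
      fn (assoc_map A B D) (elem_tensor (tensor A B) D (elem_tensor A B x y) w) = elem_tensor A (tensor B D) x (elem_tensor B D y w)"
  unfolding assoc_map_def using unitary_choice[OF _ _ assoc_map_exists[OF assms]] assms by auto

lemma lunit_map:
  assumes "hilbert_module A"
  shows "src (lunit_map A) = tensor tensor_unit A" "tgt (lunit_map A) = A"
    "\<exists>v. unitary_hmap (lunit_map A) v" "bounded_linear_hmap (lunit_map A)"
    "x \<in> carrier A \<Longrightarrow> fn (lunit_map A) (elem_tensor tensor_unit A (Scalar c) x) = act A x c"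
  unfolding lunit_map_def using unitary_choice[OF _ _ lunit_map_exists[OF assms]] assms by (auto simp: hilbert_tensor_unit)

lemma runit_map:
  assumes "hilbert_module A"
  shows "src (runit_map A) = tensor A tensor_unit" "tgt (runit_map A) = A"
    "\<exists>v. unitary_hmap (runit_map A) v" "bounded_linear_hmap (runit_map A)"
    "x \<in> carrier A \<Longrightarrow> fn (runit_map A) (elem_tensor A tensor_unit x (Scalar c)) = act A x c"
  unfolding runit_map_def using unitary_choice[OF _ _ runit_map_exists[OF assms]] assms by (auto simp: hilbert_tensor_unit)

lemma symm_map:
  assumes "hilbert_module A" "hilbert_module B"
  shows "src (symm_map A B) = tensor A B" "tgt (symm_map A B) = tensor B A"
    "\<exists>v. unitary_hmap (symm_map A B) v" "bounded_linear_hmap (symm_map A B)"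
    "x \<in> carrier A \<Longrightarrow> y \<in> carrier B \<Longrightarrow> fn (symm_map A B) (elem_tensor A B x y) = elem_tensor B A y x"
  unfolding symm_map_def using unitary_choice[OF _ _ symm_map_exists[OF assms]] assms by auto

text \<open>On elementary tensors both sides are products of inner products, and each factor is
  moved across by its own adjoint.\<close>

lemma is_adjoint_ten_map:
  assumes f: "is_adjoint f f'" and g: "is_adjoint g g'"
  shows "is_adjoint (ten_map f g) (ten_map f' g')"
proof -
  note bl = is_adjoint_bounded[OF f] is_adjoint_bounded[OF g]
    is_adjoint_bounded[OF is_adjoint_sym[OF f]] is_adjoint_bounded[OF is_adjoint_sym[OF g]]
  have eqs: "src f' = tgt f" "tgt f' = src f" "src g' = tgt g" "tgt g' = src g"
    using f g by (auto simp: is_adjoint_def)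
  have in': "fn f' y \<in> carrier (src f)" if "y \<in> carrier (tgt f)" for y
    using bounded_linear_hmap_in[OF bl(1)] that eqs by simp
  have in'': "fn g' y \<in> carrier (src g)" if "y \<in> carrier (tgt g)" for y
    using bounded_linear_hmap_in[OF bl(2)] that eqs by simp
  show ?thesis
  proof (rule is_adjointI)
    show "total (src (ten_map f g)) (case_prod (elem_tensor (src f) (src g)) ` (carrier (src f) \<times> carrier (src g)))"
      "total (tgt (ten_map f g)) (case_prod (elem_tensor (tgt f) (tgt g)) ` (carrier (tgt f) \<times> carrier (tgt g)))"
      using bl by (simp_all add: ten_map total_elem_tensor(1))
    fix s r
    assume "s \<in> case_prod (elem_tensor (src f) (src g)) ` (carrier (src f) \<times> carrier (src g))"
      and "r \<in> case_prod (elem_tensor (tgt f) (tgt g)) ` (carrier (tgt f) \<times> carrier (tgt g))"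
    then obtain x y x' y' where s: "s = elem_tensor (src f) (src g) x y" "x \<in> carrier (src f)" "y \<in> carrier (src g)"
      and r: "r = elem_tensor (tgt f) (tgt g) x' y'" "x' \<in> carrier (tgt f)" "y' \<in> carrier (tgt g)"
      by auto
    show "inner (tgt (ten_map f g)) (fn (ten_map f g) s) r = inner (src (ten_map f g)) s (fn (ten_map f' g') r)"
      using f g s r bl eqs in' in'' by (simp add: ten_map fn_ten_map) (simp add: is_adjoint_def)
  qed (use bl eqs in \<open>simp_all add: ten_map\<close>)
qed

text \<open>Captures bounded and adjointable maps at once. Containing the unitaries puts the
  identities and all coherence maps, with their inverses, into the class.\<close>

locale map_class =
  fixes P :: "('c::comm_cstar_algebra, 'x) uhmap \<Rightarrow> bool"
  assumes P_bounded: "P f \<Longrightarrow> bounded_linear_hmap f"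
    and P_hcomp: "P f \<Longrightarrow> P g \<Longrightarrow> tgt f = src g \<Longrightarrow> P (hcomp g f)"
    and P_ten_map: "P f \<Longrightarrow> P g \<Longrightarrow> P (ten_map f g)"
    and P_unitary: "unitary_hmap u v \<Longrightarrow> P u"
begin

abbreviation "\<C> \<equiv> hmap_cat P"

lemma cat_simps [simp]:
  "Obj \<C> = {E. hilbert_module E}" "Arr \<C> = {f. P f}" "Dom \<C> = src" "Cod \<C> = tgt"
  "Id \<C> = hid" "Comp \<C> = hcomp"
  by (auto simp: hmap_cat_def hid_def hcomp_def fun_eq_iff)

lemma homset_iff [simp]: "f \<in> homset \<C> A B \<longleftrightarrow> P f \<and> src f = A \<and> tgt f = B"
  by (auto simp: homset_def)

lemma P_hid: "hilbert_module E \<Longrightarrow> P (hid E)"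
  by (rule P_unitary[of _ "hid E"])
    (auto simp: unitary_hmap_def is_adjoint_hid intro!: hmap_eqI[where S = "carrier E"] hilbert_total_carrier)

lemma P_coherence:
  "hilbert_module A \<Longrightarrow> hilbert_module B \<Longrightarrow> hilbert_module D \<Longrightarrow> P (assoc_map A B D)"
  "hilbert_module A \<Longrightarrow> P (lunit_map A)" "hilbert_module A \<Longrightarrow> P (runit_map A)"
  "hilbert_module A \<Longrightarrow> hilbert_module B \<Longrightarrow> P (symm_map A B)"
  using assoc_map(3) lunit_map(3) runit_map(3) symm_map(3) P_unitary by blast+

lemma is_iso_unitary: "unitary_hmap u v \<Longrightarrow> is_iso \<C> u"
  using P_unitary[of u v] P_unitary[OF unitary_hmap_sym, of u v]
  by (auto simp: is_iso_def unitary_hmap_def is_adjoint_def intro!: bexI[of _ v])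

lemma is_iso_coherence:
  "hilbert_module A \<Longrightarrow> hilbert_module B \<Longrightarrow> hilbert_module D \<Longrightarrow> is_iso \<C> (assoc_map A B D)"
  "hilbert_module A \<Longrightarrow> is_iso \<C> (lunit_map A)" "hilbert_module A \<Longrightarrow> is_iso \<C> (runit_map A)"
  using assoc_map(3) lunit_map(3) runit_map(3) is_iso_unitary by blast+

lemmas hmap_simps = assoc_map lunit_map runit_map symm_map ten_map(1-3) fn_ten_map hilbert_tensor_unit P_bounded

lemma category: "category \<C>"
proof
  fix f g h A B D E
  assume f: "f \<in> homset \<C> A B"
  then have bl: "bounded_linear_hmap f" using P_bounded by simp
  show "Comp \<C> f (Id \<C> A) = f" "Comp \<C> (Id \<C> B) f = f"
    using f bl by (auto intro!: hmap_eqI[where S = "carrier A"] hilbert_total_carrier)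
  assume g: "g \<in> homset \<C> B D"
  then show "Comp \<C> g f \<in> homset \<C> A D" using f by (simp add: P_hcomp)
  assume h: "h \<in> homset \<C> D E"
  show "Comp \<C> (Comp \<C> h g) f = Comp \<C> h (Comp \<C> g f)"
    using f g h bl P_bounded
    by (auto intro!: hmap_eqI[where S = "carrier A"] hilbert_total_carrier)
qed (use P_bounded P_hid in auto)

lemma symmetric_monoidal:
  "symmetric_monoidal_category \<C> tensor ten_map tensor_unit assoc_map lunit_map runit_map symm_map"
proof -
  interpret category \<C> by (rule category)
  show ?thesis
  proof
    fix A B :: "('c, 'x) umod"
    assume A: "A \<in> Obj \<C>"
    then have [simp]: "hilbert_module A" by simp
    show "lunit_map A \<in> homset \<C> (tensor tensor_unit A) A" "runit_map A \<in> homset \<C> (tensor A tensor_unit) A"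
      by (simp_all add: P_coherence hmap_simps)
    show "is_iso \<C> (lunit_map A)" "is_iso \<C> (runit_map A)"
      by (simp_all add: is_iso_coherence)
    assume B: "B \<in> Obj \<C>"
    then have [simp]: "hilbert_module B" by simp
    show "tensor A B \<in> Obj \<C>" by simp
    show "ten_map (Id \<C> A) (Id \<C> B) = Id \<C> (tensor A B)"
      by (rule hmap_eqI2[of _ _ A B]) (simp_all add: hmap_simps)
    show "symm_map A B \<in> homset \<C> (tensor A B) (tensor B A)" by (simp add: P_coherence hmap_simps)
    show "Comp \<C> (symm_map B A) (symm_map A B) = Id \<C> (tensor A B)"
      by (rule hmap_eqI2[of _ _ A B]) (simp_all add: hmap_simps)
    \<comment> \<open>On elementary tensors this is the identity x \<otimes> (y c) = (x c) \<otimes>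
      y.\<close>
    show "Comp \<C> (ten_map (Id \<C> A) (lunit_map B)) (assoc_map A tensor_unit B) = ten_map (runit_map A) (Id \<C> B)"
    proof -
      interpret A: pre_hilbert A by (rule hilbert_pre_hilbert) simp
      interpret B: pre_hilbert B by (rule hilbert_pre_hilbert) simp
      show ?thesis
        by (rule hmap_eqI3[of _ _ A tensor_unit B]) (auto simp: hmap_simps elem_tensor_act)
    qed
  next
    fix A B D :: "('c, 'x) umod"
    assume "A \<in> Obj \<C>" "B \<in> Obj \<C>" "D \<in> Obj \<C>"
    then have [simp]: "hilbert_module A" "hilbert_module B" "hilbert_module D" by simp_all
    show "assoc_map A B D \<in> homset \<C> (tensor (tensor A B) D) (tensor A (tensor B D))"
      by (simp add: P_coherence hmap_simps)
    show "is_iso \<C> (assoc_map A B D)" by (simp add: is_iso_coherence)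
    show "Comp \<C> (assoc_map B D A) (Comp \<C> (symm_map A (tensor B D)) (assoc_map A B D))
        = Comp \<C> (ten_map (Id \<C> B) (symm_map A D)) (Comp \<C> (assoc_map B A D) (ten_map (symm_map A B) (Id \<C> D)))"
      by (rule hmap_eqI3[of _ _ A B D]) (simp_all add: hmap_simps)
  next
    fix A B D E :: "('c, 'x) umod"
    assume "A \<in> Obj \<C>" "B \<in> Obj \<C>" "D \<in> Obj \<C>" "E \<in> Obj \<C>"
    then have [simp]: "hilbert_module A" "hilbert_module B" "hilbert_module D" "hilbert_module E" by simp_all
    show "Comp \<C> (ten_map (Id \<C> A) (assoc_map B D E))
        (Comp \<C> (assoc_map A (tensor B D) E) (ten_map (assoc_map A B D) (Id \<C> E)))
      = Comp \<C> (assoc_map A B (tensor D E)) (assoc_map (tensor A B) D E)"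
      by (rule hmap_eqI4[of _ _ A B D E]) (simp_all add: hmap_simps)
  next
    fix f g A A' B B' :: _
    assume f: "f \<in> homset \<C> A A'" and g: "g \<in> homset \<C> B B'"
    then have [simp]: "bounded_linear_hmap f" "bounded_linear_hmap g" using P_bounded by simp_all
    have st: "A = src f" "A' = tgt f" "B = src g" "B' = tgt g" using f g by simp_all
    show "ten_map f g \<in> homset \<C> (tensor A B) (tensor A' B')"
      using f g by (simp add: hmap_simps P_ten_map)
    show "Comp \<C> (symm_map A' B') (ten_map f g) = Comp \<C> (ten_map g f) (symm_map A B)"
      unfolding st by (rule hmap_eqI2[of _ _ "src f" "src g"]) (simp_all add: hmap_simps)
  next
    fix f A B
    assume f: "f \<in> homset \<C> A B"
    then have [simp]: "bounded_linear_hmap f" using P_bounded by simp_all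
    have st: "A = src f" "B = tgt f" using f by simp_all
    interpret A: pre_hilbert "src f" by (rule hilbert_pre_hilbert) simp
    show "Comp \<C> (lunit_map B) (ten_map (Id \<C> tensor_unit) f) = Comp \<C> f (lunit_map A)"
      unfolding st by (rule hmap_eqI2[of _ _ tensor_unit "src f"]) (auto simp: hmap_simps bounded_linear_hmap_act)
    show "Comp \<C> (runit_map B) (ten_map f (Id \<C> tensor_unit)) = Comp \<C> f (runit_map A)"
      unfolding st by (rule hmap_eqI2[of _ _ "src f" tensor_unit]) (auto simp: hmap_simps bounded_linear_hmap_act)
  next
    fix f f' g g' A A' A'' B B' B''
    assume "f \<in> homset \<C> A A'" "f' \<in> homset \<C> A' A''" "g \<in> homset \<C> B B'" "g' \<in> homset \<C> B' B''"
    then have [simp]: "bounded_linear_hmap f" "bounded_linear_hmap f'" "bounded_linear_hmap g" "bounded_linear_hmap g'"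
      and st [simp]: "src f' = tgt f" "src g' = tgt g" using P_bounded by simp_all
    have [simp]: "fn f x \<in> carrier (tgt f)" if "x \<in> carrier (src f)" for x using that by simp
    show "ten_map (Comp \<C> f' f) (Comp \<C> g' g) = Comp \<C> (ten_map f' g') (ten_map f g)"
      by (rule hmap_eqI2[of _ _ "src f" "src g"]) (simp_all add: hmap_simps)
  next
    fix f g h A A' B B' D D'
    assume "f \<in> homset \<C> A A'" "g \<in> homset \<C> B B'" "h \<in> homset \<C> D D'"
    then have [simp]: "bounded_linear_hmap f" "bounded_linear_hmap g" "bounded_linear_hmap h"
      and st: "A = src f" "A' = tgt f" "B = src g" "B' = tgt g" "D = src h" "D' = tgt h"
      using P_bounded by simp_all
    show "Comp \<C> (assoc_map A' B' D') (ten_map (ten_map f g) h) = Comp \<C> (ten_map f (ten_map g h)) (assoc_map A B D)"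
      unfolding st by (rule hmap_eqI3[of _ _ "src f" "src g" "src h"]) (simp_all add: hmap_simps)
  qed (simp add: hilbert_tensor_unit)
qed

end

section \<open>The two categories\<close>

lemma map_class_bounded: "map_class bounded_linear_hmap"
  by unfold_locales (auto simp: ten_map unitary_hmap_def)

lemma map_class_adjointable: "map_class (adjointable :: ('c::comm_cstar_algebra, 'x) uhmap \<Rightarrow> bool)"
proof
  show "adjointable (hcomp g f)" if "adjointable f" "adjointable g" "tgt f = src g" for f g :: "('c, 'x) uhmap"
    using that is_adjoint_hcomp unfolding adjointable_def by blast
  show "adjointable (ten_map f g)" if "adjointable f" "adjointable g" for f g :: "('c, 'x) uhmap"
    using that is_adjoint_ten_map unfolding adjointable_def by blast
qed (auto simp: adjointable_bounded unitary_hmap_def adjointable_def)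

theorem proposition2p2:
  shows "\<exists>tenA assoc lunit runit symm.
    canonical_on_elem_tensors tenA assoc lunit runit symm \<and>
    symmetric_monoidal_category
      (Hilb_bd :: (('c::comm_cstar_algebra, 'x) umod, ('c, ('c, 'x) univ) hmap) cat)
      tensor tenA tensor_unit assoc lunit runit symm \<and>
    symmetric_monoidal_dagger_category
      (Hilb :: (('c, 'x) umod, ('c, ('c, 'x) univ) hmap) cat)
      tensor tenA tensor_unit assoc lunit runit symm hilb_dagger"
proof (intro exI conjI)
  interpret B: map_class "bounded_linear_hmap :: ('c, 'x) uhmap \<Rightarrow> bool" by (rule map_class_bounded)
  interpret D: map_class "adjointable :: ('c, 'x) uhmap \<Rightarrow> bool" by (rule map_class_adjointable)
  show "canonical_on_elem_tensors ten_map assoc_map lunit_map runit_map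
      (symm_map :: ('c, 'x) umod \<Rightarrow> ('c, 'x) umod \<Rightarrow> ('c, 'x) uhmap)"
    unfolding canonical_on_elem_tensors_def by (simp add: ten_map assoc_map lunit_map runit_map symm_map)
  show "symmetric_monoidal_category (Hilb_bd :: (('c, 'x) umod, ('c, 'x) uhmap) cat)
      tensor ten_map tensor_unit assoc_map lunit_map runit_map symm_map"
    unfolding Hilb_bd_def by (rule B.symmetric_monoidal)
  interpret symmetric_monoidal_category "hmap_cat adjointable :: (('c, 'x) umod, ('c, 'x) uhmap) cat"
    tensor ten_map tensor_unit assoc_map lunit_map runit_map symm_map
    by (rule D.symmetric_monoidal)
  have adj: "is_adjoint f (hilb_dagger f)" if "adjointable f" for f :: "('c, 'x) uhmap"
    using is_adjoint_dagger[OF that] .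
  have dag: "adjointable (hilb_dagger f)" "src (hilb_dagger f) = tgt f" "tgt (hilb_dagger f) = src f"
    if "adjointable f" for f :: "('c, 'x) uhmap"
    using adj[OF that] is_adjoint_sym[OF adj[OF that]] by (auto simp: adjointable_def is_adjoint_def)
  \<comment> \<open>The partner \<open>v\<close> is an adjoint of \<open>u\<close>, hence its
    dagger, and both composites are identities.\<close>
  have unitary: "unitary (hmap_cat adjointable) hilb_dagger u" if "unitary_hmap u v" for u v :: "('c, 'x) uhmap"
    using that hilb_dagger_eqI[of u v] D.P_unitary[OF that] by (simp add: unitary_def unitary_hmap_def)
  have coherence: "unitary (hmap_cat adjointable) hilb_dagger (assoc_map A B E)"
    "unitary (hmap_cat adjointable) hilb_dagger (lunit_map A)"
    "unitary (hmap_cat adjointable) hilb_dagger (runit_map A)"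
    "unitary (hmap_cat adjointable) hilb_dagger (symm_map A B)"
    if "hilbert_module A" "hilbert_module B" "hilbert_module E" for A B E :: "('c, 'x) umod"
    using assoc_map(3)[OF that] lunit_map(3)[OF that(1)] runit_map(3)[OF that(1)] symm_map(3)[OF that(1,2)]
    by (blast intro: unitary)+
  show "symmetric_monoidal_dagger_category (Hilb :: (('c, 'x) umod, ('c, 'x) uhmap) cat)
      tensor ten_map tensor_unit assoc_map lunit_map runit_map symm_map hilb_dagger"
    unfolding Hilb_def
  proof (intro symmetric_monoidal_dagger_category.intro monoidal_dagger_category.intro
      symmetric_monoidal_category_axioms monoidal_category_axioms dagger_category.intro category_axioms
      dagger_category_axioms.intro monoidal_dagger_category_axioms.intro symmetric_monoidal_dagger_category_axioms.intro)
    show "hilb_dagger f \<in> homset (hmap_cat adjointable) B A" if "f \<in> homset (hmap_cat adjointable) A B"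
      for f :: "('c, 'x) uhmap" and A B
      using that dag by simp
    show "hilb_dagger (Id (hmap_cat adjointable) A) = Id (hmap_cat adjointable) A"
      if "A \<in> Obj (hmap_cat adjointable)" for A :: "('c, 'x) umod"
      using that by (simp add: hilb_dagger_eqI is_adjoint_hid)
    show "hilb_dagger (Comp (hmap_cat adjointable) g f)
        = Comp (hmap_cat adjointable) (hilb_dagger f) (hilb_dagger g)"
      if "f \<in> homset (hmap_cat adjointable) A B" "g \<in> homset (hmap_cat adjointable) B E"
      for f g :: "('c, 'x) uhmap" and A B E
      using that by (simp add: hilb_dagger_eqI is_adjoint_hcomp adj)
    show "hilb_dagger (hilb_dagger f) = f" if "f \<in> Arr (hmap_cat adjointable)" for f :: "('c, 'x) uhmap"
      using that by (simp add: hilb_dagger_eqI is_adjoint_sym adj)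
    show "hilb_dagger (ten_map f g) = ten_map (hilb_dagger f) (hilb_dagger g)"
      if "f \<in> Arr (hmap_cat adjointable)" "g \<in> Arr (hmap_cat adjointable)" for f g :: "('c, 'x) uhmap"
      using that by (simp add: hilb_dagger_eqI is_adjoint_ten_map adj)
  qed (simp_all add: coherence)
qed

end
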